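(* Suppose that $U$ is an ultrafilter on the complete Boolean algebra $\mathbb{B}$. Then the following are equivalent: (1) The Boolean ultrapower $j_U:V\to\check V_U$ is isomorphic to a classical power set ultrapower by a measure $U^*$ on some set $Z$. (2) The ultrafilter $U$ is $V$-generic relative to some maximal antichain $A\subseteq\mathbb{B}$. In this case, one can take $Z=A$ and the Boolean ultrapower $j_U$ is isomorphic to the power set ultrapower $j_{U_A}$.
   Context: Relative genericity. All antichains are in $V$. A maximal antichain $C$ refines $A$ if every $c\in C$ is below some $a\in A$. If $C$ is a maximal antichain refining the maximal antichain $A$, then $U$ meets $C$ relative to $A$ if one can choose (in $V$) for each $a\in A$ an element $c_a\in C$ with $c_a\leq a$ such that $\bigvee_{a\in A}c_a\in U$. $U$ is ($V$-)generic relative to $A$ if $U$ meets, relative to $A$, every maximal antichain $C$ refining $A$. Classical ultrapowers. For an ultrafilter $U^*$ on (the power set algebra $P(Z)$ of) a set $Z$, the classical ultrapower $j_{U^*}:V\to V^Z/U^*$ uses functions $f:Z\to V$ in $V$. "Measure" here just means ultrafilter. For a maximal antichain $A\subseteq\mathbb{B}$, $U_A$ is the ultrafilter on $P(A)$ with $X\in U_A$ iff $X\subseteq A$ and $\bigvee X\in U$. Two embeddings of $V$ are isomorphic if there is an $\in$-isomorphism of their target structures commuting with the embeddings. Boolean ultrapower. $\mathbb{B}$-names (elements of $V^{\mathbb{B}}$) are defined recursively: $\tau$ is a $\mathbb{B}$-name if $\tau$ is a set of pairs $\langle\sigma,b\rangle$ with $\sigma$ a $\mathbb{B}$-name and $b\in\mathbb{B}$.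 Boolean values: $[\![\tau\in\sigma]\!]=\bigvee_{\langle\eta,b\rangle\in\sigma}[\![\tau=\eta]\!]\wedge b$, $[\![\tau=\sigma]\!]=[\![\tau\subseteq\sigma]\!]\wedge[\![\sigma\subseteq\tau]\!]$, $[\![\tau\subseteq\sigma]\!]=\bigwedge_{\eta\in\mathrm{dom}(\tau)}(\neg[\![\eta\in\tau]\!]\vee[\![\eta\in\sigma]\!])$. For $x\in V$, $\check x=\{\langle\check y,1\rangle : y\in x\}$; $[\![\tau\in\check V]\!]=\bigvee_{x\in V}[\![\tau=\check x]\!]$. Let $\tau=_U\sigma$ iff $[\![\tau=\sigma]\!]\in U$, $\tau\in_U\sigma$ iff $[\![\tau\in\sigma]\!]\in U$; $[\tau]_U$ is the $=_U$-class of $\tau$ (restricted to members of minimal rank). $\check V_U=\{[\tau]_U : [\![\tau\in\check V]\!]\in U\}$ under $\in_U$, and $j_U(x)=[\check x]_U$. *)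

theory Defs
  imports "HOL-Algebra.Lattice" "HOL-Library.Multiset"
begin

section \<open>The universe \<open>V\<close>\<close>

text \<open>First-order formulas in the language of set theory, with named variables.
  They are needed for the schemes of separation and replacement.\<close>

datatype fm = Mem nat nat | Equ nat nat | Neg fm | Conj fm fm | Ex nat fm

primrec sat :: "('a \<Rightarrow> 'a \<Rightarrow> bool) \<Rightarrow> (nat \<Rightarrow> 'a) \<Rightarrow> fm \<Rightarrow> bool" where
  "sat R e (Mem i j) \<longleftrightarrow> R (e i) (e j)"
| "sat R e (Equ i j) \<longleftrightarrow> e i = e j"
| "sat R e (Neg p) \<longleftrightarrow> \<not> sat R e p"
| "sat R e (Conj p q) \<longleftrightarrow> sat R e p \<and> sat R e q"
| "sat R e (Ex i p) \<longleftrightarrow> (\<exists>x. sat R (e(i := x)) p)"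

text \<open>
  The type \<open>'v\<close> plays the role of \<open>V\<close>: a well-founded model of first-order ZFC. It is not
  required to contain every HOL set of elements of one of its members, so that ``in \<open>V\<close>'' is a
  genuine restriction. Objects of type \<^typ>\<open>'v\<close> are the sets of \<open>V\<close>; objects of type
  \<^typ>\<open>'v set\<close> are arbitrary collections of them, possibly outside \<open>V\<close>.
  In the two schemes the assignment \<open>e\<close> supplies the parameters.
\<close>

class zfc_universe =
  fixes vmem :: "'a \<Rightarrow> 'a \<Rightarrow> bool" (infix \<open>\<in>\<^sub>V\<close> 50)
  assumes extensionality: "(\<forall>z. z \<in>\<^sub>V x \<longleftrightarrow> z \<in>\<^sub>V y) \<Longrightarrow> x = y"
    and wellfounded: "wfp (\<in>\<^sub>V)"
    and pairing: "\<exists>c. \<forall>z. z \<in>\<^sub>V c \<longleftrightarrow> z = x \<or> z = y"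
    and union: "\<exists>c. \<forall>z. z \<in>\<^sub>V c \<longleftrightarrow> (\<exists>y. z \<in>\<^sub>V y \<and> y \<in>\<^sub>V x)"
    and powerset: "\<exists>c. \<forall>z. z \<in>\<^sub>V c \<longleftrightarrow> (\<forall>w. w \<in>\<^sub>V z \<longrightarrow> w \<in>\<^sub>V x)"
    and infinity: "\<exists>w. (\<exists>u. u \<in>\<^sub>V w \<and> (\<forall>z. \<not> z \<in>\<^sub>V u)) \<and>
      (\<forall>x. x \<in>\<^sub>V w \<longrightarrow> (\<exists>y. y \<in>\<^sub>V w \<and> (\<forall>z. z \<in>\<^sub>V y \<longleftrightarrow> z \<in>\<^sub>V x \<or> z = x)))"
    and separation: "\<exists>c. \<forall>x. x \<in>\<^sub>V c \<longleftrightarrow> x \<in>\<^sub>V a \<and> sat (\<in>\<^sub>V) (e(0 := x)) p"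
    and replacement:
      "(\<forall>x. x \<in>\<^sub>V a \<longrightarrow> (\<forall>y y'. sat (\<in>\<^sub>V) (e(0 := x, 1 := y)) p \<and>
          sat (\<in>\<^sub>V) (e(0 := x, 1 := y')) p \<longrightarrow> y = y')) \<Longrightarrow>
       \<exists>c. \<forall>y. y \<in>\<^sub>V c \<longleftrightarrow> (\<exists>x. x \<in>\<^sub>V a \<and> sat (\<in>\<^sub>V) (e(0 := x, 1 := y)) p)"
    and choice:
      "(\<forall>x. x \<in>\<^sub>V a \<longrightarrow> (\<exists>z. z \<in>\<^sub>V x)) \<and>
       (\<forall>x y. x \<in>\<^sub>V a \<and> y \<in>\<^sub>V a \<and> x \<noteq> y \<longrightarrow> \<not> (\<exists>z. z \<in>\<^sub>V x \<and> z \<in>\<^sub>V y)) \<Longrightarrow>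
       \<exists>c. \<forall>x. x \<in>\<^sub>V a \<longrightarrow> (\<exists>!z. z \<in>\<^sub>V x \<and> z \<in>\<^sub>V c)"

definition elts :: "'v::zfc_universe \<Rightarrow> 'v set" where
  "elts x = {y. y \<in>\<^sub>V x}"

text \<open>\<open>vset X\<close> is the set of \<open>V\<close> whose elements are those of \<open>X\<close>; it is meaningful only if
  \<open>X \<in> range elts\<close>.\<close>

definition vset :: "'v::zfc_universe set \<Rightarrow> 'v" where
  "vset X = (THE x. elts x = X)"

definition vpair :: "'v::zfc_universe \<Rightarrow> 'v \<Rightarrow> 'v" where
  "vpair x y = vset {vset {x}, vset {x, y}}"

definition vfun :: "'v::zfc_universe \<Rightarrow> 'v \<Rightarrow> bool" where
  "vfun Z f \<longleftrightarrow> (\<forall>p\<in>elts f. \<exists>z\<in>elts Z. \<exists>y. p = vpair z y) \<and>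
                (\<forall>z\<in>elts Z. \<exists>!y. vpair z y \<in>\<^sub>V f)"

definition vapp :: "'v::zfc_universe \<Rightarrow> 'v \<Rightarrow> 'v" where
  "vapp f z = (THE y. vpair z y \<in>\<^sub>V f)"

lemma elts_inject: "elts x = elts y \<longleftrightarrow> x = y"
proof
  assume "elts x = elts y"
  then have "\<forall>z. z \<in>\<^sub>V x \<longleftrightarrow> z \<in>\<^sub>V y" unfolding elts_def by (simp add: set_eq_iff)
  then show "x = y" by (rule extensionality)
qed simp

lemma vset_eqI: "elts x = X \<Longrightarrow> vset X = x"
  unfolding vset_def by (rule the_equality) (simp_all flip: elts_inject)

lemma elts_vset: "X \<in> range elts \<Longrightarrow> elts (vset X) = X"
  by (metis image_iff vset_eqI)

lemma elts_vset_pair [simp]: "elts (vset {x, y}) = {x, y}"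
proof (rule elts_vset)
  obtain c where "\<forall>z. z \<in>\<^sub>V c \<longleftrightarrow> z = x \<or> z = y"
    using pairing by blast
  then have "{x, y} = elts c" by (auto simp: elts_def)
  then show "{x, y} \<in> range elts" by blast
qed

lemma elts_vset_single [simp]: "elts (vset {x}) = {x}"
  using elts_vset_pair[of x x] by simp

lemma elts_vpair: "elts (vpair x y) = {vset {x}, vset {x, y}}"
  unfolding vpair_def by simp


section \<open>Boolean algebras in \<open>V\<close>\<close>

text \<open>Carrier and order are elements of \<open>V\<close>, and completeness refers to the subsets in \<open>V\<close>.\<close>

locale complete_boolean_algebra_in_V = bounded_lattice L for L :: "'v::zfc_universe gorder" (structure) +
  assumes carrier_in_V: "\<exists>c. elts c = carrier L"
    and order_in_V: "\<exists>r. elts r = {vpair x y | x y. x \<in> carrier L \<and> y \<in> carrier L \<and> x \<sqsubseteq> y}"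
    and distributive: "\<lbrakk>x \<in> carrier L; y \<in> carrier L; z \<in> carrier L\<rbrakk> \<Longrightarrow>
      x \<sqinter> (y \<squnion> z) = (x \<sqinter> y) \<squnion> (x \<sqinter> z)"
    and complemented: "x \<in> carrier L \<Longrightarrow> \<exists>y\<in>carrier L. x \<sqinter> y = \<bottom> \<and> x \<squnion> y = \<top>"
    and sup_exists_in_V: "elts X \<subseteq> carrier L \<Longrightarrow> \<exists>s. least L s (Upper L (elts X))"
    and inf_exists_in_V: "elts X \<subseteq> carrier L \<Longrightarrow> \<exists>s. greatest L s (Lower L (elts X))"

definition compl :: "'v gorder \<Rightarrow> 'v \<Rightarrow> 'v" where
  "compl L x = (THE y. y \<in> carrier L \<and> x \<sqinter>\<^bsub>L\<^esub> y = \<bottom>\<^bsub>L\<^esub> \<and> x \<squnion>\<^bsub>L\<^esub> y = \<top>\<^bsub>L\<^esub>)"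

definition ultrafilter :: "'v gorder \<Rightarrow> 'v set \<Rightarrow> bool" where
  "ultrafilter L U \<longleftrightarrow>
     U \<subseteq> carrier L \<and> \<top>\<^bsub>L\<^esub> \<in> U \<and> \<bottom>\<^bsub>L\<^esub> \<notin> U \<and>
     (\<forall>x\<in>U. \<forall>y\<in>U. x \<sqinter>\<^bsub>L\<^esub> y \<in> U) \<and>
     (\<forall>x\<in>U. \<forall>y\<in>carrier L. x \<sqsubseteq>\<^bsub>L\<^esub> y \<longrightarrow> y \<in> U) \<and>
     (\<forall>x\<in>carrier L. x \<in> U \<or> compl L x \<in> U)"

definition powerset_algebra :: "'v::zfc_universe \<Rightarrow> 'v gorder" where
  "powerset_algebra Z =
     \<lparr>carrier = {X. elts X \<subseteq> elts Z}, eq = (=), le = (\<lambda>X Y. elts X \<subseteq> elts Y)\<rparr>"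


section \<open>Relative genericity\<close>

definition antichain :: "'v::zfc_universe gorder \<Rightarrow> 'v \<Rightarrow> bool" where
  "antichain B A \<longleftrightarrow> elts A \<subseteq> carrier B - {\<bottom>\<^bsub>B\<^esub>} \<and>
     (\<forall>a\<in>elts A. \<forall>b\<in>elts A. a \<noteq> b \<longrightarrow> a \<sqinter>\<^bsub>B\<^esub> b = \<bottom>\<^bsub>B\<^esub>)"

definition maximal_antichain :: "'v::zfc_universe gorder \<Rightarrow> 'v \<Rightarrow> bool" where
  "maximal_antichain B A \<longleftrightarrow>
     antichain B A \<and> (\<forall>C. antichain B C \<and> elts A \<subseteq> elts C \<longrightarrow> C = A)"

definition refines :: "'v::zfc_universe gorder \<Rightarrow> 'v \<Rightarrow> 'v \<Rightarrow> bool" where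
  "refines B C A \<longleftrightarrow> (\<forall>c\<in>elts C. \<exists>a\<in>elts A. c \<sqsubseteq>\<^bsub>B\<^esub> a)"

definition meets_relative :: "'v::zfc_universe gorder \<Rightarrow> 'v set \<Rightarrow> 'v \<Rightarrow> 'v \<Rightarrow> bool" where
  "meets_relative B U A C \<longleftrightarrow>
     (\<exists>s. vfun A s \<and> (\<forall>a\<in>elts A. vapp s a \<in>\<^sub>V C \<and> vapp s a \<sqsubseteq>\<^bsub>B\<^esub> a) \<and>
          \<Squnion>\<^bsub>B\<^esub> (vapp s ` elts A) \<in> U)"

definition generic_relative :: "'v::zfc_universe gorder \<Rightarrow> 'v set \<Rightarrow> 'v \<Rightarrow> bool" where
  "generic_relative B U A \<longleftrightarrow>
     (\<forall>C. maximal_antichain B C \<and> refines B C A \<longrightarrow> meets_relative B U A C)"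

definition induced_ultrafilter :: "'v::zfc_universe gorder \<Rightarrow> 'v set \<Rightarrow> 'v \<Rightarrow> 'v set" where
  "induced_ultrafilter B U A = {X. elts X \<subseteq> elts A \<and> \<Squnion>\<^bsub>B\<^esub> (elts X) \<in> U}"


section \<open>Names and Boolean values\<close>

inductive bname :: "'v::zfc_universe gorder \<Rightarrow> 'v \<Rightarrow> bool" for B where
  "(\<forall>p\<in>elts \<tau>. \<exists>\<sigma> b. p = vpair \<sigma> b \<and> bname B \<sigma> \<and> b \<in> carrier B) \<Longrightarrow> bname B \<tau>"

definition ndom :: "'v::zfc_universe \<Rightarrow> 'v set" where
  "ndom \<tau> = {\<eta>. \<exists>b. vpair \<eta> b \<in>\<^sub>V \<tau>}"

lemma wf_ndom: "wf {(\<eta>, \<tau>). \<eta> \<in> ndom (\<tau>::'v::zfc_universe)}"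
proof (rule wf_subset)
  have "wf {(x, y::'v). x \<in>\<^sub>V y}"
    using wellfounded unfolding wfp_def .
  then show "wf ({(x, y::'v). x \<in>\<^sub>V y}\<^sup>+)"
    by (rule wf_trancl)
  show "{(\<eta>, \<tau>). \<eta> \<in> ndom \<tau>} \<subseteq> {(x, y::'v). x \<in>\<^sub>V y}\<^sup>+"
  proof clarify
    fix \<eta> \<tau> :: 'v assume "\<eta> \<in> ndom \<tau>"
    then obtain b where b: "vpair \<eta> b \<in>\<^sub>V \<tau>" unfolding ndom_def by blast
    let ?E = "{(x, y::'v). x \<in>\<^sub>V y}"
    have "\<eta> \<in> elts (vset {\<eta>})" by simp
    then have 1: "(\<eta>, vset {\<eta>}) \<in> ?E" by (simp add: elts_def)
    have "vset {\<eta>} \<in> elts (vpair \<eta> b)" by (simp add: elts_vpair)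
    then have 2: "(vset {\<eta>}, vpair \<eta> b) \<in> ?E" by (simp add: elts_def)
    have 3: "(vpair \<eta> b, \<tau>) \<in> ?E" using b by simp
    show "(\<eta>, \<tau>) \<in> ?E\<^sup>+"
      by (rule trancl_into_trancl2[OF 1 trancl_into_trancl2[OF 2 r_into_trancl[OF 3]]])
  qed
qed

text \<open>The Boolean values satisfy the usual recursion unconditionally. For the termination
  argument, \<open>[\<tau> = \<sigma>]\<close> and \<open>[\<tau> \<subseteq> \<sigma>]\<close> are weighted by the multiset \<open>{\<tau>, \<tau>, \<sigma>, \<sigma>}\<close>, and
  \<open>[\<tau> \<in> \<sigma>]\<close> by \<open>{\<tau>, \<tau>, \<sigma>}\<close>.\<close>

function bval_mem :: "'v::zfc_universe gorder \<Rightarrow> 'v \<Rightarrow> 'v \<Rightarrow> 'v"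
  and bval_eq :: "'v gorder \<Rightarrow> 'v \<Rightarrow> 'v \<Rightarrow> 'v"
  and bval_sub :: "'v gorder \<Rightarrow> 'v \<Rightarrow> 'v \<Rightarrow> 'v" where
  "bval_mem B \<tau> \<sigma> =
     \<Squnion>\<^bsub>B\<^esub> ((\<lambda>(\<eta>, b). bval_eq B \<tau> \<eta> \<sqinter>\<^bsub>B\<^esub> b) ` {(\<eta>, b). vpair \<eta> b \<in>\<^sub>V \<sigma>})"
| "bval_eq B \<tau> \<sigma> = bval_sub B \<tau> \<sigma> \<sqinter>\<^bsub>B\<^esub> bval_sub B \<sigma> \<tau>"
| "bval_sub B \<tau> \<sigma> =
     \<Sqinter>\<^bsub>B\<^esub> ((\<lambda>\<eta>. compl B (bval_mem B \<eta> \<tau>) \<squnion>\<^bsub>B\<^esub> bval_mem B \<eta> \<sigma>) ` ndom \<tau>)"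
  by pat_completeness auto
termination
proof -
  let ?N = "{(\<eta>, \<tau>). \<eta> \<in> ndom (\<tau>::'v::zfc_universe)}"
  let ?m = "\<lambda>x. case x of
      Inl (_, \<tau>, \<sigma>) \<Rightarrow> ({#\<tau>, \<tau>, \<sigma>#}, 0)
    | Inr (Inl (_, \<tau>, \<sigma>)) \<Rightarrow> ({#\<tau>, \<tau>, \<sigma>, \<sigma>#}, Suc 0)
    | Inr (Inr (_, \<tau>, \<sigma>)) \<Rightarrow> ({#\<tau>, \<tau>, \<sigma>, \<sigma>#}, 0::nat)"
  have mult: "(M, N) \<in> mult ?N"
    if "M = I + K" "N = I + J" "J \<noteq> {#}" "\<forall>k\<in>set_mset K. \<exists>j\<in>set_mset J. (k, j) \<in> ?N"
    for M N I J K :: "'v::zfc_universe multiset"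
    unfolding that(1,2) using that(3,4) by (rule one_step_implies_mult)
  show ?thesis
  proof (relation "inv_image (mult ?N <*lex*> less_than) ?m")
    show "wf (inv_image (mult ?N <*lex*> less_than) ?m)"
      by (intro wf_inv_image wf_lex_prod wf_mult wf_ndom wf_less_than)
  next
    fix B :: "'v::zfc_universe gorder" and \<tau> \<sigma> \<eta> b :: 'v and x
    assume "x \<in> {(\<eta>, b). vpair \<eta> b \<in>\<^sub>V \<sigma>}" "(\<eta>, b) = x"
    then have "\<eta> \<in> ndom \<sigma>" by (auto simp: ndom_def)
    then have "({#\<tau>, \<tau>, \<eta>, \<eta>#}, {#\<tau>, \<tau>, \<sigma>#}) \<in> mult ?N"
      by (intro mult[of _ "{#\<tau>, \<tau>#}" "{#\<eta>, \<eta>#}" _ "{#\<sigma>#}"]) (simp_all add: add_mset_commute)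
    then show "(Inr (Inl (B, \<tau>, \<eta>)), Inl (B, \<tau>, \<sigma>)) \<in> inv_image (mult ?N <*lex*> less_than) ?m"
      by simp
  next
    fix B :: "'v::zfc_universe gorder" and \<tau> \<sigma> :: 'v
    show "(Inr (Inr (B, \<tau>, \<sigma>)), Inr (Inl (B, \<tau>, \<sigma>))) \<in> inv_image (mult ?N <*lex*> less_than) ?m"
      by simp
  next
    fix B :: "'v::zfc_universe gorder" and \<tau> \<sigma> :: 'v
    show "(Inr (Inr (B, \<sigma>, \<tau>)), Inr (Inl (B, \<tau>, \<sigma>))) \<in> inv_image (mult ?N <*lex*> less_than) ?m"
      by (simp add: add_mset_commute)
  next
    fix B :: "'v::zfc_universe gorder" and \<tau> \<sigma> \<eta> :: 'v
    assume "\<eta> \<in> ndom \<tau>"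
    then have "({#\<eta>, \<eta>, \<tau>#}, {#\<tau>, \<tau>, \<sigma>, \<sigma>#}) \<in> mult ?N"
      by (intro mult[of _ "{#\<tau>#}" "{#\<eta>, \<eta>#}" _ "{#\<tau>, \<sigma>, \<sigma>#}"]) (simp_all add: add_mset_commute)
    then show "(Inl (B, \<eta>, \<tau>), Inr (Inr (B, \<tau>, \<sigma>))) \<in> inv_image (mult ?N <*lex*> less_than) ?m"
      by simp
  next
    fix B :: "'v::zfc_universe gorder" and \<tau> \<sigma> \<eta> :: 'v
    assume "\<eta> \<in> ndom \<tau>"
    then have "({#\<eta>, \<eta>, \<sigma>#}, {#\<tau>, \<tau>, \<sigma>, \<sigma>#}) \<in> mult ?N"
      by (intro mult[of _ "{#\<sigma>#}" "{#\<eta>, \<eta>#}" _ "{#\<tau>, \<tau>, \<sigma>#}"]) (simp_all add: add_mset_commute)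
    then show "(Inl (B, \<eta>, \<sigma>), Inr (Inr (B, \<tau>, \<sigma>))) \<in> inv_image (mult ?N <*lex*> less_than) ?m"
      by simp
  qed
qed

declare bval_mem.simps [simp del] bval_eq.simps [simp del] bval_sub.simps [simp del]

function check :: "'v::zfc_universe gorder \<Rightarrow> 'v \<Rightarrow> 'v" where
  "check B x = vset ((\<lambda>y. vpair (check B y) \<top>\<^bsub>B\<^esub>) ` elts x)"
  by pat_completeness auto
termination
  by (relation "inv_image {(x, y). x \<in>\<^sub>V y} snd")
    (use wellfounded in \<open>auto simp: wfp_def elts_def\<close>)

declare check.simps [simp del]

definition bval_in_V :: "'v::zfc_universe gorder \<Rightarrow> 'v \<Rightarrow> 'v" where
  "bval_in_V B \<tau> = \<Squnion>\<^bsub>B\<^esub> (range (\<lambda>x. bval_eq B \<tau> (check B x)))"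


section \<open>Ultrapowers\<close>

text \<open>Equivalence classes are HOL sets here, so they need not be cut down to their members of
  minimal rank.\<close>

definition name_class :: "'v::zfc_universe gorder \<Rightarrow> 'v set \<Rightarrow> 'v \<Rightarrow> 'v set" where
  "name_class B U \<tau> = {\<sigma>. bname B \<sigma> \<and> bval_eq B \<tau> \<sigma> \<in> U}"

definition bool_ultrapower :: "'v::zfc_universe gorder \<Rightarrow> 'v set \<Rightarrow> 'v set set" where
  "bool_ultrapower B U = {name_class B U \<tau> | \<tau>. bname B \<tau> \<and> bval_in_V B \<tau> \<in> U}"

definition bool_ultrapower_mem :: "'v::zfc_universe gorder \<Rightarrow> 'v set \<Rightarrow> 'v set \<Rightarrow> 'v set \<Rightarrow> bool" where
  "bool_ultrapower_mem B U X Y \<longleftrightarrow> (\<exists>\<tau>\<in>X. \<exists>\<sigma>\<in>Y. bval_mem B \<tau> \<sigma> \<in> U)"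

definition bool_ultrapower_emb :: "'v::zfc_universe gorder \<Rightarrow> 'v set \<Rightarrow> 'v \<Rightarrow> 'v set" where
  "bool_ultrapower_emb B U x = name_class B U (check B x)"

definition fun_class :: "'v::zfc_universe \<Rightarrow> 'v set \<Rightarrow> 'v \<Rightarrow> 'v set" where
  "fun_class Z W f = {g. vfun Z g \<and> vset {z \<in> elts Z. vapp f z = vapp g z} \<in> W}"

definition ultrapower :: "'v::zfc_universe \<Rightarrow> 'v set \<Rightarrow> 'v set set" where
  "ultrapower Z W = {fun_class Z W f | f. vfun Z f}"

definition ultrapower_mem :: "'v::zfc_universe \<Rightarrow> 'v set \<Rightarrow> 'v set \<Rightarrow> 'v set \<Rightarrow> bool" where
  "ultrapower_mem Z W X Y \<longleftrightarrow>
     (\<exists>f\<in>X. \<exists>g\<in>Y. vset {z \<in> elts Z. vapp f z \<in>\<^sub>V vapp g z} \<in> W)"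

definition ultrapower_emb :: "'v::zfc_universe \<Rightarrow> 'v set \<Rightarrow> 'v \<Rightarrow> 'v set" where
  "ultrapower_emb Z W x = fun_class Z W (vset ((\<lambda>z. vpair z x) ` elts Z))"

text \<open>Isomorphism of two embeddings \<open>j : V \<rightarrow> (M, E)\<close> and \<open>k : V \<rightarrow> (N, F)\<close>.\<close>

definition isomorphic_embeddings ::
  "'m set \<Rightarrow> ('m \<Rightarrow> 'm \<Rightarrow> bool) \<Rightarrow> ('v::zfc_universe \<Rightarrow> 'm) \<Rightarrow>
   'n set \<Rightarrow> ('n \<Rightarrow> 'n \<Rightarrow> bool) \<Rightarrow> ('v \<Rightarrow> 'n) \<Rightarrow> bool" where
  "isomorphic_embeddings M E j N F k \<longleftrightarrow>
     (\<exists>\<pi>. bij_betw \<pi> M N \<and> (\<forall>x\<in>M. \<forall>y\<in>M. E x y \<longleftrightarrow> F (\<pi> x) (\<pi> y)) \<and> (\<forall>x. \<pi> (j x) = k x))"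

definition bool_ultrapower_iso_classical ::
  "'v::zfc_universe gorder \<Rightarrow> 'v set \<Rightarrow> 'v \<Rightarrow> 'v set \<Rightarrow> bool" where
  "bool_ultrapower_iso_classical B U Z W \<longleftrightarrow>
     isomorphic_embeddings
       (bool_ultrapower B U) (bool_ultrapower_mem B U) (bool_ultrapower_emb B U)
       (ultrapower Z W) (ultrapower_mem Z W) (ultrapower_emb Z W)"

end

theory Submission
  imports Defs
begin

text \<open>
  Write \<open>[\<tau> = \<sigma>]\<close> for the Boolean value of an equation between names and \<open>[\<tau> = x]\<close> when the second
  name is the check name of \<open>x\<close>.

  \<^emph>\<open>From genericity to a power set ultrapower.\<close> A name \<open>\<tau>\<close> with \<open>[\<tau> \<in> V] \<in> U\<close> has a decision
  antichain: the nonzero values \<open>[\<tau> = x]\<close> together with the complement of \<open>[\<tau> \<in> V]\<close>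
  (\<open>decision_antichain\<close>). Refine \<open>A\<close> by it. If \<open>U\<close> meets the refinement relative to \<open>A\<close>, then the chosen
  pieces below the members of \<open>A\<close> single out a value \<open>f a\<close> of \<open>\<tau>\<close> for \<open>U\<close>-almost every \<open>a\<close>, and the join of all
  \<open>a \<sqinter> [\<tau> = f a]\<close> lies in \<open>U\<close> (\<open>generic_name_agrees\<close>). Conversely every \<open>f\<close> on \<open>A\<close> in \<open>V\<close> arises from a
  name, the mixture of the values \<open>f a\<close> along \<open>A\<close>. So ``\<open>\<tau>\<close> agrees with \<open>f\<close>'' is a total and surjective
  relation between the names \<open>\<tau>\<close> with \<open>[\<tau> \<in> V] \<in> U\<close> and the functions on \<open>A\<close> in \<open>V\<close>, and below
  \<open>a\<close> the truth of \<open>\<tau> = \<sigma>\<close> or \<open>\<tau> \<in> \<sigma>\<close> is settled by the values at \<open>a\<close>; hence the relation induces an isomorphism with the ultrapower by \<open>U\<^sub>A\<close>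
  (\<open>agreement_decides\<close>, \<open>generic_iso_classical\<close>).

  \<^emph>\<open>From a power set ultrapower to genericity.\<close> Let \<open>\<tau>\<close> be a name that corresponds to the identity
  function on \<open>Z\<close>; the classical ultrapower is generated by this element. Let \<open>A\<close> be the decision
  antichain of \<open>\<tau>\<close>. Given a refinement \<open>C\<close> of \<open>A\<close>, the mixture \<open>\<sigma>\<close> that takes a code of \<open>c\<close> as its value
  on \<open>c\<close> corresponds to some function \<open>g\<close> on \<open>Z\<close>, so that, \<open>U\<close>-almost surely, ``\<open>\<sigma>\<close> is \<open>g\<close> applied to
  \<open>\<tau>\<close>''. Therefore \<open>g\<close> tells which \<open>c\<close> to choose below \<open>[\<tau> = z]\<close>. The isomorphism preserves only
  membership and the embeddings, so ``\<open>\<sigma>\<close> is \<open>g\<close> applied to \<open>\<tau>\<close>'' must be expressed with them: the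
  element corresponding to \<open>z \<mapsto> {z, g z}\<close> contains \<open>\<tau>\<close> and \<open>\<sigma>\<close> and belongs to the image of the set of
  all doubletons \<open>{z, g z}\<close>. The codes of the members of \<open>C\<close> lie outside \<open>Z\<close>, so that the two elements
  of such a doubleton can be told apart (\<open>iso_classical_generic\<close>).

  \<^emph>\<open>Existence in \<open>V\<close>.\<close> Completeness of the algebra, maximality of antichains and the functions of the
  ultrapower all refer to sets of \<open>V\<close>, which is merely a well-founded model of first-order ZFC. So
  every collection that is used must be shown to be first-order definable over \<open>V\<close>, including those
  that mention Boolean values, which are defined by transfinite recursion. A small calculus of
  definable predicates, terms and sets makes this a syntax-directed search; its main point is that a
  recursion with definable step has a definable solution (\<open>definable_term_recursion\<close>).

  \<^emph>\<open>Inequalities.\<close> Statements about Boolean values have the form \<open>p \<sqsubseteq> [\<dots>]\<close>. They are proved like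
  forcing statements: joins are eliminated by passing to elements \<open>q \<sqsubseteq> p\<close> below one of the joinands
  (\<open>le_Sup_cases\<close>), so that transitivity of the order is nearly all that remains.
\<close>

section \<open>First-order definability with parameters\<close>

primrec fm_vars :: "fm \<Rightarrow> nat set" where
  "fm_vars (Mem i j) = {i, j}"
| "fm_vars (Equ i j) = {i, j}"
| "fm_vars (Neg p) = fm_vars p"
| "fm_vars (Conj p q) = fm_vars p \<union> fm_vars q"
| "fm_vars (Ex i p) = insert i (fm_vars p)"

lemma finite_fm_vars: "finite (fm_vars p)"
  by (induction p) auto

lemma sat_cong: "(\<And>i. i \<in> fm_vars p \<Longrightarrow> e i = e' i) \<Longrightarrow> sat R e p \<longleftrightarrow> sat R e' p"
proof (induction p arbitrary: e e')
  case (Ex i p)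
  have "sat R (e(i := x)) p \<longleftrightarrow> sat R (e'(i := x)) p" for x
    by (rule Ex.IH) (use Ex.prems in auto)
  then show ?case by simp
next
  case (Conj p q)
  have "sat R e p \<longleftrightarrow> sat R e' p" by (rule Conj.IH) (use Conj.prems in simp)
  moreover have "sat R e q \<longleftrightarrow> sat R e' q" by (rule Conj.IH) (use Conj.prems in simp)
  ultimately show ?case by simp
next
  case (Neg p)
  have "sat R e p \<longleftrightarrow> sat R e' p" by (rule Neg.IH) (use Neg.prems in simp)
  then show ?case by simp
qed simp_all

text \<open>The substitution \<open>r\<close> need not be injective, so a bound variable has to be replaced by one outside the
  range of \<open>r\<close> on the formula.\<close>

lemma sat_rename: "\<exists>q. \<forall>e. sat R e q \<longleftrightarrow> sat R (\<lambda>i. e (r i)) p"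
proof (induction p arbitrary: r)
  case (Mem i j)
  show ?case by (rule exI[of _ "Mem (r i) (r j)"]) simp
next
  case (Equ i j)
  show ?case by (rule exI[of _ "Equ (r i) (r j)"]) simp
next
  case (Neg p)
  obtain p' where "\<And>e. sat R e p' \<longleftrightarrow> sat R (\<lambda>i. e (r i)) p"
    using Neg by blast
  then show ?case by (intro exI[of _ "Neg p'"]) simp
next
  case (Conj p q)
  obtain p' where "\<And>e. sat R e p' \<longleftrightarrow> sat R (\<lambda>i. e (r i)) p"
    using Conj by blast
  moreover obtain q' where "\<And>e. sat R e q' \<longleftrightarrow> sat R (\<lambda>i. e (r i)) q"
    using Conj by blast
  ultimately show ?case by (intro exI[of _ "Conj p' q'"]) simp
next
  case (Ex i p)
  obtain k where k: "k \<notin> r ` fm_vars p"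
    using ex_new_if_finite[of "r ` fm_vars p"] finite_fm_vars by auto
  obtain q where q: "\<And>e. sat R e q \<longleftrightarrow> sat R (\<lambda>n. e ((r(i := k)) n)) p"
    using Ex.IH by blast
  have "sat R (e(k := x)) q \<longleftrightarrow> sat R ((\<lambda>n. e (r n))(i := x)) p" for e x
    unfolding q by (rule sat_cong) (use k in auto)
  then show ?case by (intro exI[of _ "Ex k q"]) simp
qed

text \<open>The even variables of a formula serve as its arguments and the odd ones as its parameters. Both
  kinds are unlimited, so predicates with different parameters can be combined.\<close>

definition interleave :: "(nat \<Rightarrow> 'a) \<Rightarrow> (nat \<Rightarrow> 'a) \<Rightarrow> nat \<Rightarrow> 'a" where
  "interleave e c n = (if even n then e (n div 2) else c (n div 2))"

text \<open>Predicates, terms and sets depend on an environment that plays the role of a de Bruijn context: in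
  the body of a binder, \<open>e 0\<close> is the bound variable and \<open>\<lambda>n. e (Suc n)\<close> the outer environment. With this
  convention the closure rules below are higher-order patterns and can be applied by resolution. A
  definable set must also be an element of \<open>V\<close> in every environment.\<close>

definition definable :: "((nat \<Rightarrow> 'v::zfc_universe) \<Rightarrow> bool) \<Rightarrow> bool" where
  "definable P \<longleftrightarrow> (\<exists>p c. \<forall>e. P e \<longleftrightarrow> sat (\<in>\<^sub>V) (interleave e c) p)"

definition definable_term :: "((nat \<Rightarrow> 'v::zfc_universe) \<Rightarrow> 'v) \<Rightarrow> bool" where
  "definable_term t \<longleftrightarrow> definable (\<lambda>e. e 0 = t (\<lambda>n. e (Suc n)))"

definition definable_set :: "((nat \<Rightarrow> 'v::zfc_universe) \<Rightarrow> 'v set) \<Rightarrow> bool" where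
  "definable_set A \<longleftrightarrow> (\<forall>e. A e \<in> range elts) \<and> definable (\<lambda>e. e 0 \<in> A (\<lambda>n. e (Suc n)))"

lemma definable_by_formula:
  fixes P :: "(nat \<Rightarrow> 'v::zfc_universe) \<Rightarrow> bool"
  assumes "\<And>e. P e \<longleftrightarrow> sat (\<in>\<^sub>V) (\<lambda>i. interleave e c (r i)) p"
  shows "definable P"
proof -
  obtain q where "\<And>e :: nat \<Rightarrow> 'v. sat (\<in>\<^sub>V) e q \<longleftrightarrow> sat (\<in>\<^sub>V) (\<lambda>i. e (r i)) p"
    using sat_rename[of "(\<in>\<^sub>V)" r p] by blast
  with assms have "P e \<longleftrightarrow> sat (\<in>\<^sub>V) (interleave e c) q" for e
    by simp
  then show ?thesis unfolding definable_def by blast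
qed

lemma definable_rename:
  assumes "definable P" shows "definable (\<lambda>e. P (\<lambda>n. e (r n)))"
proof -
  obtain p c where p: "\<And>e. P e \<longleftrightarrow> sat (\<in>\<^sub>V) (interleave e c) p"
    using assms unfolding definable_def by blast
  have "interleave (\<lambda>n. e (r n)) c = (\<lambda>i. interleave e c (if even i then 2 * r (i div 2) else i))" for e
    by (auto simp: interleave_def)
  then show ?thesis
    by (intro definable_by_formula) (simp add: p)
qed

text \<open>A new argument in front can be regarded as a new parameter in front. This is how parameters
  are supplied and how a variable is set aside for a quantifier.\<close>

lemma interleave_case_nat:
  "interleave (case_nat x e) c =
     (\<lambda>i. interleave e (case_nat x c) (if i = 0 then 1 else if even i then i - 2 else i + 2))"
proof
  fix i
  show "interleave (case_nat x e) c i =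
     interleave e (case_nat x c) (if i = 0 then 1 else if even i then i - 2 else i + 2)"
  proof (cases "even i")
    case True
    then obtain k where "i = 2 * k" by blast
    then show ?thesis by (cases k) (auto simp: interleave_def)
  qed (auto simp: interleave_def)
qed

lemma definable_parameter:
  assumes "definable (\<lambda>e. P (e 0) (\<lambda>n. e (Suc n)))" shows "definable (P x)"
proof -
  obtain p c where p: "\<And>e. P (e 0) (\<lambda>n. e (Suc n)) \<longleftrightarrow> sat (\<in>\<^sub>V) (interleave e c) p"
    using assms unfolding definable_def by blast
  from p[of "case_nat x _"] show ?thesis
    by (intro definable_by_formula) (simp add: interleave_case_nat)
qed

lemma definable_Ex:
  fixes P :: "'v::zfc_universe \<Rightarrow> (nat \<Rightarrow> 'v) \<Rightarrow> bool"
  assumes "definable (\<lambda>e. P (e 0) (\<lambda>n. e (Suc n)))" shows "definable (\<lambda>e. \<exists>x. P x e)"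
proof -
  obtain p c where p: "\<And>e. P (e 0) (\<lambda>n. e (Suc n)) \<longleftrightarrow> sat (\<in>\<^sub>V) (interleave e c) p"
    using assms unfolding definable_def by blast
  let ?r = "\<lambda>i::nat. if i = 0 then 1 else if even i then i - 2 else i + 2"
  obtain q where q: "\<And>e :: nat \<Rightarrow> 'v. sat (\<in>\<^sub>V) e q \<longleftrightarrow> sat (\<in>\<^sub>V) (\<lambda>i. e (?r i)) p"
    using sat_rename[of "(\<in>\<^sub>V)" ?r p] by blast
  \<comment> \<open>Variable 1 is the freed first parameter; it becomes the quantified variable.\<close>
  have *: "(interleave e (case_nat undefined c))(1 := x) = interleave e (case_nat x c)" for e :: "nat \<Rightarrow> 'v" and x
  proof
    fix i :: nat
    show "((interleave e (case_nat undefined c))(1 := x)) i = interleave e (case_nat x c) i"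
      by (cases "i div 2") (auto simp: interleave_def elim: oddE)
  qed
  have "(\<exists>x. P x e) \<longleftrightarrow> sat (\<in>\<^sub>V) (interleave e (case_nat undefined c)) (Ex 1 q)" for e
  proof -
    have "P x e \<longleftrightarrow> sat (\<in>\<^sub>V) ((interleave e (case_nat undefined c))(1 := x)) q" for x
      using p[of "case_nat x e"] unfolding * q interleave_case_nat by simp
    then show ?thesis by simp
  qed
  then show ?thesis unfolding definable_def by blast
qed

lemma definable_Not:
  assumes "definable P" shows "definable (\<lambda>e. \<not> P e)"
proof -
  obtain p c where "\<And>e. P e \<longleftrightarrow> sat (\<in>\<^sub>V) (interleave e c) p"
    using assms unfolding definable_def by blast
  then have "(\<not> P e) \<longleftrightarrow> sat (\<in>\<^sub>V) (interleave e c) (Neg p)" for e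
    by simp
  then show ?thesis unfolding definable_def by blast
qed

lemma definable_conj:
  fixes P Q :: "(nat \<Rightarrow> 'v::zfc_universe) \<Rightarrow> bool"
  assumes "definable P" "definable Q" shows "definable (\<lambda>e. P e \<and> Q e)"
proof -
  obtain p c where p: "\<And>e. P e \<longleftrightarrow> sat (\<in>\<^sub>V) (interleave e c) p"
    using assms unfolding definable_def by blast
  obtain q d where q: "\<And>e. Q e \<longleftrightarrow> sat (\<in>\<^sub>V) (interleave e d) q"
    using assms unfolding definable_def by blast
  \<comment> \<open>In the combined assignment, the parameters \<open>c\<close> occupy the variables 1 modulo 4, and \<open>d\<close> those 3 modulo 4.\<close>
  have c: "interleave e c = (\<lambda>i. interleave e (interleave c d) (if even i then i else 2 * (i div 2) * 2 + 1))" for e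
  proof
    fix i show "interleave e c i = interleave e (interleave c d) (if even i then i else 2 * (i div 2) * 2 + 1)"
      by (cases "even i") (auto simp: interleave_def elim!: oddE)
  qed
  have d: "interleave e d = (\<lambda>i. interleave e (interleave c d) (if even i then i else 2 * (i div 2) * 2 + 3))" for e
  proof
    fix i :: nat
    have "(2 * (i div 2) * 2 + 3) div 2 = 2 * (i div 2) + 1" by simp
    then show "interleave e d i = interleave e (interleave c d) (if even i then i else 2 * (i div 2) * 2 + 3)"
      by (cases "even i") (simp_all add: interleave_def)
  qed
  obtain p' where p': "\<And>e :: nat \<Rightarrow> 'v. sat (\<in>\<^sub>V) e p' \<longleftrightarrow> sat (\<in>\<^sub>V) (\<lambda>i. e (if even i then i else 2 * (i div 2) * 2 + 1)) p"
    using sat_rename[of "(\<in>\<^sub>V)" "\<lambda>i. if even i then i else 2 * (i div 2) * 2 + 1" p] by blast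
  obtain q' where q': "\<And>e :: nat \<Rightarrow> 'v. sat (\<in>\<^sub>V) e q' \<longleftrightarrow> sat (\<in>\<^sub>V) (\<lambda>i. e (if even i then i else 2 * (i div 2) * 2 + 3)) q"
    using sat_rename[of "(\<in>\<^sub>V)" "\<lambda>i. if even i then i else 2 * (i div 2) * 2 + 3" q] by blast
  have "P e \<and> Q e \<longleftrightarrow> sat (\<in>\<^sub>V) (interleave e (interleave c d)) (Conj p' q')" for e
    unfolding p q sat.simps p' q' by (subst c, subst d) (rule refl)
  then show ?thesis unfolding definable_def by blast
qed

lemma definable_disj: "definable P \<Longrightarrow> definable Q \<Longrightarrow> definable (\<lambda>e. P e \<or> Q e)"
  using definable_Not[OF definable_conj[OF definable_Not definable_Not], of P Q] by simp

lemma definable_imp: "definable P \<Longrightarrow> definable Q \<Longrightarrow> definable (\<lambda>e. P e \<longrightarrow> Q e)"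
  using definable_Not[OF definable_conj[OF _ definable_Not], of P Q] by simp

lemma definable_iff: "definable P \<Longrightarrow> definable Q \<Longrightarrow> definable (\<lambda>e. P e = Q e)"
  using definable_conj[OF definable_imp definable_imp, of P Q Q P] by (simp add: iff_conv_conj_imp)

lemma definable_All:
  assumes "definable (\<lambda>e. P (e 0) (\<lambda>n. e (Suc n)))" shows "definable (\<lambda>e. \<forall>x. P x e)"
  using definable_Not[OF definable_Ex[of "\<lambda>x e. \<not> P x e", OF definable_Not[OF assms]]] by simp

lemma definable_var_mem: "definable (\<lambda>e. e i \<in>\<^sub>V e j)"
  by (rule definable_by_formula[of _ undefined "\<lambda>i. i" "Mem (2 * i) (2 * j)"]) (simp add: interleave_def)

lemma definable_var_eq: "definable (\<lambda>e. e i = e j)"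
  by (rule definable_by_formula[of _ undefined "\<lambda>i. i" "Equ (2 * i) (2 * j)"]) (simp add: interleave_def)

lemma definable_term_var: "definable_term (\<lambda>e. e i)"
  unfolding definable_term_def by (rule definable_var_eq)

lemma definable_term_const: "definable_term (\<lambda>e. c)"
  unfolding definable_term_def
  by (rule definable_parameter[of "\<lambda>c e. e 0 = c"]) (rule definable_var_eq)

lemma definable_term_shift: "definable_term t \<Longrightarrow> definable_term (\<lambda>e. t (\<lambda>n. e (r n)))"
  unfolding definable_term_def
  by (drule definable_rename[of _ "case_nat 0 (\<lambda>n. Suc (r n))"]) simp

text \<open>Terms are eliminated by quantifiers: \<open>P (t e) e\<close> holds iff some \<open>x\<close> with \<open>x = t e\<close> satisfies \<open>P x e\<close>.\<close>

lemma definable_subst: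
  assumes "definable (\<lambda>e. P (e 0) (\<lambda>n. e (Suc n)))" "definable_term t"
  shows "definable (\<lambda>e. P (t e) e)"
proof -
  have "definable (\<lambda>e. \<exists>x. x = t e \<and> P x e)"
    by (rule definable_Ex, rule definable_conj)
       (use assms in \<open>simp_all add: definable_term_def\<close>)
  then show ?thesis by simp
qed

lemma definable_mem:
  assumes "definable_term t" "definable_term s" shows "definable (\<lambda>e. t e \<in>\<^sub>V s e)"
proof -
  have "definable (\<lambda>e. e 0 \<in>\<^sub>V s (\<lambda>n. e (Suc n)))"
    by (rule definable_subst[of "\<lambda>x e. e 0 \<in>\<^sub>V x"])
       (rule definable_var_mem, rule definable_term_shift, rule assms)
  then show ?thesis
    by (rule definable_subst[of "\<lambda>x e. x \<in>\<^sub>V s e"]) (rule assms)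
qed

lemma definable_eq:
  assumes "definable_term t" "definable_term s" shows "definable (\<lambda>e. t e = s e)"
  using assms(2,1) unfolding definable_term_def[of s]
  by (rule definable_subst[of "\<lambda>x e. x = s e"])

lemma definable_True: "definable (\<lambda>e. True)"
  using definable_eq[OF definable_term_var definable_term_var, of 0 0] by simp

lemma definable_constant: "definable (\<lambda>e. b)"
  using definable_True definable_Not[OF definable_True] by (cases b) simp_all

text \<open>It suffices to establish definability of a function for a variable argument. The rules for the
  defined operations are obtained from this and the next lemma.\<close>

lemma definable_term_app1:
  assumes "definable_term (\<lambda>e. F (e 0))" "definable_term t"
  shows "definable_term (\<lambda>e. F (t e))"
  unfolding definable_term_def
proof (rule definable_subst[of "\<lambda>x e. e 0 = F x"])
  show "definable (\<lambda>e. e (Suc 0) = F (e 0))"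
    using definable_rename[OF assms(1)[unfolded definable_term_def], of "case_nat 1 (\<lambda>n. 0)"] by simp
  show "definable_term (\<lambda>e. t (\<lambda>n. e (Suc n)))"
    by (rule definable_term_shift) (rule assms)
qed

lemma definable_term_app2:
  assumes "definable_term (\<lambda>e. F (e 0) (e (Suc 0)))" "definable_term t" "definable_term s"
  shows "definable_term (\<lambda>e. F (t e) (s e))"
  unfolding definable_term_def
proof (rule definable_subst[of "\<lambda>x e. e 0 = F x (s (\<lambda>n. e (Suc n)))"],
       rule definable_subst[of "\<lambda>y e. e (Suc 0) = F (e 0) y"])
  show "definable (\<lambda>e. e (Suc (Suc 0)) = F (e (Suc 0)) (e 0))"
    using definable_rename[OF assms(1)[unfolded definable_term_def], of "case_nat 2 (case_nat 1 (\<lambda>n. 0))"]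
    by (simp add: numeral_2_eq_2)
  show "definable_term (\<lambda>e. s (\<lambda>n. e (Suc (Suc n))))"
    by (rule definable_term_shift) (rule assms)
  show "definable_term (\<lambda>e. t (\<lambda>n. e (Suc n)))"
    by (rule definable_term_shift) (rule assms)
qed

lemma definable_set_in_V: "definable_set A \<Longrightarrow> A e \<in> range elts"
  unfolding definable_set_def by blast

lemma definable_set_elts: "definable_term t \<Longrightarrow> definable_set (\<lambda>e. elts (t e))"
  using definable_mem[OF definable_term_var[of 0] definable_term_shift[of t Suc]]
  by (simp add: definable_set_def elts_def)

lemma definable_set_shift:
  assumes "definable_set A" shows "definable_set (\<lambda>e. A (\<lambda>n. e (r n)))"
  using assms definable_rename[of "\<lambda>e. e 0 \<in> A (\<lambda>n. e (Suc n))" "case_nat 0 (\<lambda>n. Suc (r n))"]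
  unfolding definable_set_def by simp

lemma definable_in:
  assumes "definable_term t" "definable_set A" shows "definable (\<lambda>e. t e \<in> A e)"
  using assms unfolding definable_set_def by (intro definable_subst[of "\<lambda>x e. x \<in> A e"]) auto

lemma definable_set_app1:
  assumes "definable_set (\<lambda>e. S (e 0))" "definable_term t" shows "definable_set (\<lambda>e. S (t e))"
proof -
  have "definable (\<lambda>e. e 0 \<in> S (t (\<lambda>n. e (Suc n))))"
  proof (rule definable_subst[of "\<lambda>x e. e 0 \<in> S x"])
    show "definable (\<lambda>e. e (Suc 0) \<in> S (e 0))"
      by (rule definable_in[OF definable_term_var assms(1)])
    show "definable_term (\<lambda>e. t (\<lambda>n. e (Suc n)))"
      by (rule definable_term_shift) (rule assms)
  qed
  moreover have "S x \<in> range elts" for x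
    using assms(1) unfolding definable_set_def by (auto dest: spec[of _ "\<lambda>_. x"])
  ultimately show ?thesis unfolding definable_set_def by blast
qed

lemma definable_Ball:
  assumes "definable_set A" "definable (\<lambda>e. P (e 0) (\<lambda>n. e (Suc n)))"
  shows "definable (\<lambda>e. \<forall>x\<in>A e. P x e)"
  using assms unfolding Ball_def definable_set_def by (intro definable_All definable_imp) auto

lemma definable_Bex:
  assumes "definable_set A" "definable (\<lambda>e. P (e 0) (\<lambda>n. e (Suc n)))"
  shows "definable (\<lambda>e. \<exists>x\<in>A e. P x e)"
  using assms unfolding Bex_def definable_set_def by (intro definable_Ex definable_conj) auto

lemma separation_set:
  assumes "definable (\<lambda>e. P (e 0) (\<lambda>n. e (Suc n)))" "A \<in> range elts"
  shows "{x\<in>A. P x e} \<in> range elts"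
proof -
  obtain p c where p: "\<And>e. P (e 0) (\<lambda>n. e (Suc n)) \<longleftrightarrow> sat (\<in>\<^sub>V) (interleave e c) p"
    using assms unfolding definable_def by blast
  obtain a where a: "A = elts a" using assms by blast
  have "(interleave (case_nat undefined e) c)(0 := x) = interleave (case_nat x e) c" for x
    by (auto simp: interleave_def fun_eq_iff split: nat.split)
  then have "sat (\<in>\<^sub>V) ((interleave (case_nat undefined e) c)(0 := x)) p \<longleftrightarrow> P x e" for x
    using p[of "case_nat x e"] by simp
  then obtain d where "\<And>x. x \<in>\<^sub>V d \<longleftrightarrow> x \<in>\<^sub>V a \<and> P x e"
    using separation[of a "interleave (case_nat undefined e) c" p] by auto
  then have "{x\<in>A. P x e} = elts d" unfolding a elts_def by auto
  then show ?thesis by blast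
qed

lemma replacement_set:
  fixes t :: "'v::zfc_universe \<Rightarrow> (nat \<Rightarrow> 'v) \<Rightarrow> 'v"
  assumes "definable_term (\<lambda>e. t (e 0) (\<lambda>n. e (Suc n)))" "A \<in> range elts"
  shows "(\<lambda>x. t x e) ` A \<in> range elts"
proof -
  have "definable (\<lambda>e. e (Suc 0) = t (e 0) (\<lambda>n. e (Suc (Suc n))))"
    using definable_rename[OF assms(1)[unfolded definable_term_def],
        of "case_nat 1 (case_nat 0 (\<lambda>n. Suc (Suc n)))"]
    by simp
  then obtain p c where p: "\<And>e. e (Suc 0) = t (e 0) (\<lambda>n. e (Suc (Suc n))) \<longleftrightarrow>
      sat (\<in>\<^sub>V) (interleave e c) p"
    unfolding definable_def by blast
  \<comment> \<open>The replacement scheme reserves variables 0 and 1, whereas the second argument is variable 2.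
    So the parameters move up by one place to make room for it at 1.\<close>
  let ?r = "\<lambda>i::nat. if i = 2 then 1 else if even i then i else i + 2"
  obtain q where q: "\<And>e :: nat \<Rightarrow> 'v. sat (\<in>\<^sub>V) e q \<longleftrightarrow> sat (\<in>\<^sub>V) (\<lambda>i. e (?r i)) p"
    using sat_rename[of "(\<in>\<^sub>V)" ?r p] by blast
  obtain a where a: "A = elts a" using assms by blast
  define E where "E = interleave (case_nat undefined (case_nat undefined e)) (case_nat undefined c)"
  have "(\<lambda>i. (E(0 := x, 1 := y)) (?r i)) = interleave (case_nat x (case_nat y e)) c" for x y
  proof
    fix i :: nat
    show "(E(0 := x, 1 := y)) (?r i) = interleave (case_nat x (case_nat y e)) c i"
    proof (cases "even i")
      case True
      then obtain k where "i = 2 * k" by blast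
      then show ?thesis by (auto simp: E_def interleave_def split: nat.split)
    qed (auto simp: E_def interleave_def)
  qed
  then have "sat (\<in>\<^sub>V) (E(0 := x, 1 := y)) q \<longleftrightarrow> y = t x e" for x y
    using p[of "case_nat x (case_nat y e)"] unfolding q by simp
  then obtain d where "\<And>y. y \<in>\<^sub>V d \<longleftrightarrow> (\<exists>x. x \<in>\<^sub>V a \<and> y = t x e)"
    using replacement[of a E q] by auto
  then have "(\<lambda>x. t x e) ` A = elts d" unfolding a elts_def by auto
  then show ?thesis by blast
qed

lemma definable_set_Collect:
  assumes "definable_set A" "definable (\<lambda>e. P (e 0) (\<lambda>n. e (Suc n)))"
  shows "definable_set (\<lambda>e. {x \<in> A e. P x e})"
proof -
  have "definable (\<lambda>e. e 0 \<in> A (\<lambda>n. e (Suc n)) \<and> P (e 0) (\<lambda>n. e (Suc n)))"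
    using assms by (intro definable_conj) (auto simp: definable_set_def)
  then show ?thesis
    using separation_set[OF assms(2) definable_set_in_V[OF assms(1)]]
    by (simp add: definable_set_def)
qed

lemma definable_set_image:
  assumes "definable_set A" "definable_term (\<lambda>e. t (e 0) (\<lambda>n. e (Suc n)))"
  shows "definable_set (\<lambda>e. (\<lambda>x. t x e) ` A e)"
proof -
  have "definable (\<lambda>e. \<exists>x\<in>A (\<lambda>n. e (Suc n)). e 0 = t x (\<lambda>n. e (Suc n)))"
  proof (rule definable_Bex)
    show "definable_set (\<lambda>e. A (\<lambda>n. e (Suc n)))"
      by (rule definable_set_shift) (rule assms)
    show "definable (\<lambda>e. e (Suc 0) = t (e 0) (\<lambda>n. e (Suc (Suc n))))"
      using definable_rename[OF assms(2)[unfolded definable_term_def],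
          of "case_nat 1 (case_nat 0 (\<lambda>n. Suc (Suc n)))"]
      by simp
  qed
  then show ?thesis
    using replacement_set[OF assms(2)] definable_set_in_V[OF assms(1)]
    by (simp add: definable_set_def image_iff)
qed

lemma definable_set_empty: "definable_set (\<lambda>e. {})"
proof -
  have "definable_set (\<lambda>e. {x \<in> elts undefined. False})"
    by (intro definable_set_Collect definable_set_elts definable_constant definable_term_const)
  then show ?thesis by simp
qed

lemma Union_in_V:
  assumes "A \<in> range elts" "\<And>x. x \<in> A \<Longrightarrow> S x = elts (s x)" "s ` A \<in> range elts"
  shows "(\<Union>x\<in>A. S x) \<in> range elts"
proof -
  obtain b where b: "s ` A = elts b" using assms by blast
  obtain c where c: "\<And>z. z \<in>\<^sub>V c \<longleftrightarrow> (\<exists>y. z \<in>\<^sub>V y \<and> y \<in>\<^sub>V b)"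
    using union[of b] by blast
  have "(\<Union>x\<in>A. S x) = (\<Union>y\<in>s ` A. elts y)" using assms(2) by simp
  also have "\<dots> = elts c" unfolding b by (auto simp: elts_def c)
  finally show ?thesis by blast
qed

lemma definable_term_vset:
  assumes "definable_set A" shows "definable_term (\<lambda>e. vset (A e))"
proof -
  have "z = vset (A e) \<longleftrightarrow> (\<forall>x. x \<in>\<^sub>V z \<longleftrightarrow> x \<in> A e)" for z e
  proof -
    have "z = vset (A e) \<longleftrightarrow> elts z = A e"
      using elts_vset[OF definable_set_in_V[OF assms, of e]] elts_inject[of z "vset (A e)"] by simp
    then show ?thesis by (simp add: elts_def set_eq_iff)
  qed
  then show ?thesis unfolding definable_term_def
    using definable_in[OF definable_term_var[of 0] definable_set_shift[OF assms, of "\<lambda>n. Suc (Suc n)"]]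
    by (simp, intro definable_All definable_iff definable_mem definable_term_var) simp
qed

lemma definable_set_UN:
  assumes "definable_set A" "definable_set (\<lambda>e. S (e 0) (\<lambda>n. e (Suc n)))"
  shows "definable_set (\<lambda>e. \<Union>x\<in>A e. S x e)"
proof -
  have S: "S x e \<in> range elts" for x e
    using definable_set_in_V[OF assms(2), of "case_nat x e"] by simp
  have "(\<Union>x\<in>A e. S x e) \<in> range elts" for e
  proof (rule Union_in_V)
    show "A e \<in> range elts" by (rule definable_set_in_V) (rule assms)
    show "S x e = elts (vset (S x e))" for x by (simp add: elts_vset S)
    show "(\<lambda>x. vset (S x e)) ` A e \<in> range elts"
      by (rule replacement_set[OF definable_term_vset[OF assms(2)]]) fact
  qed
  moreover have "definable (\<lambda>e. \<exists>x\<in>A (\<lambda>n. e (Suc n)). e 0 \<in> S x (\<lambda>n. e (Suc n)))"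
  proof (rule definable_Bex)
    show "definable_set (\<lambda>e. A (\<lambda>n. e (Suc n)))"
      by (rule definable_set_shift) (rule assms)
    show "definable (\<lambda>e. e (Suc 0) \<in> S (e 0) (\<lambda>n. e (Suc (Suc n))))"
      using definable_in[OF definable_term_var[of 1]
         definable_set_shift[OF assms(2), of "case_nat 0 (\<lambda>n. Suc (Suc n))"]] by simp
  qed
  ultimately show ?thesis unfolding definable_set_def by simp
qed

lemma definable_set_doubleton:
  assumes "definable_term s" "definable_term t" shows "definable_set (\<lambda>e. {s e, t e})"
proof -
  have "{s e, t e} \<in> range elts" for e
    using rangeI[of elts "vset {s e, t e}"] by simp
  then show ?thesis
    using definable_disj[OF definable_eq[OF definable_term_var[of 0] definable_term_shift[OF assms(1), of Suc]]
        definable_eq[OF definable_term_var[of 0] definable_term_shift[OF assms(2), of Suc]]]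
    unfolding definable_set_def by simp
qed

lemma definable_set_Un:
  assumes "definable_set A" "definable_set B" shows "definable_set (\<lambda>e. A e \<union> B e)"
proof -
  have "A e \<union> B e \<in> range elts" for e
  proof -
    have "A e \<union> B e = (\<Union>x\<in>elts (vset {vset (A e), vset (B e)}). elts x)"
      using assms by (simp add: definable_set_in_V elts_vset)
    also have "\<dots> \<in> range elts"
      by (rule definable_set_in_V)
         (intro definable_set_UN definable_set_elts definable_term_const definable_term_var)
    finally show ?thesis .
  qed
  moreover have "definable (\<lambda>e. e 0 \<in> A (\<lambda>n. e (Suc n)) \<or> e 0 \<in> B (\<lambda>n. e (Suc n)))"
    using assms by (intro definable_disj) (simp_all add: definable_set_def)
  ultimately show ?thesis by (simp add: definable_set_def)
qed

lemma definable_set_singleton: "definable_term t \<Longrightarrow> definable_set (\<lambda>e. {t e})"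
  using definable_set_doubleton[of t t] by simp

lemma definable_set_insert:
  "definable_term t \<Longrightarrow> definable_set A \<Longrightarrow> definable_set (\<lambda>e. insert (t e) (A e))"
  using definable_set_Un[OF definable_set_singleton] by simp

subsection \<open>Definable operations on sets\<close>

text \<open>A description operator whose value does not depend on the predicate when there is no unique
  witness. In contrast to \<open>THE\<close>, it preserves definability without a proof of uniqueness.\<close>

definition the_default :: "('a \<Rightarrow> bool) \<Rightarrow> 'a" where
  "the_default P = (if \<exists>!x. P x then THE x. P x else undefined)"

lemma the_default_eqI: "P x \<Longrightarrow> (\<And>y. P y \<Longrightarrow> y = x) \<Longrightarrow> the_default P = x"
proof -
  assume "P x" and "\<And>y. P y \<Longrightarrow> y = x"
  then have "\<exists>!x. P x" "(THE x. P x) = x" by (blast, blast intro: the_equality)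
  then show "the_default P = x" unfolding the_default_def by simp
qed

lemma definable_term_the_default:
  fixes P :: "'v::zfc_universe \<Rightarrow> (nat \<Rightarrow> 'v) \<Rightarrow> bool"
  assumes "definable (\<lambda>e. P (e 0) (\<lambda>n. e (Suc n)))"
  shows "definable_term (\<lambda>e. the_default (\<lambda>x. P x e))"
proof -
  have *: "z = the_default Q \<longleftrightarrow> Q z \<and> (\<forall>y. Q y \<longrightarrow> y = z) \<or>
      \<not> (\<exists>x. Q x \<and> (\<forall>y. Q y \<longrightarrow> y = x)) \<and> z = undefined" for z :: 'v and Q
  proof (cases "\<exists>x. Q x \<and> (\<forall>y. Q y \<longrightarrow> y = x)")
    case True
    then obtain x where x: "Q x" "\<And>y. Q y \<Longrightarrow> y = x" by blast
    then have "the_default Q = x" by (rule the_default_eqI)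
    then show ?thesis using x by blast
  next
    case False
    then have "the_default Q = undefined" by (auto simp: the_default_def)
    then show ?thesis using False by auto
  qed
  have ren: "definable (\<lambda>e. P (e (r 0)) (\<lambda>n. e (r (Suc n))))" for r
    by (rule definable_rename[OF assms])
  have 0: "definable (\<lambda>e. P (e 0) (\<lambda>n. e (Suc (n + k))))" for k
    using ren[of "case_nat 0 (\<lambda>n. Suc (n + k))"] by simp
  show ?thesis unfolding definable_term_def *
    by (intro definable_disj definable_conj definable_Not definable_Ex definable_All definable_imp
       definable_eq definable_term_var definable_term_const)
       (use 0[of 0] 0[of 1] 0[of 2] in \<open>simp_all add: numeral_2_eq_2\<close>)
qed

lemmas definable_intros =
  definable_Ex definable_All definable_Ball definable_Bex definable_Not definable_conj definable_disj
  definable_imp definable_iff definable_in definable_mem definable_eq definable_constant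
  definable_set_elts definable_set_Collect definable_set_image definable_set_empty definable_set_UN
  definable_set_doubleton definable_set_Un definable_set_singleton definable_set_insert
  definable_term_var definable_term_const definable_term_vset definable_term_the_default

lemma vpair_inject [simp]: "vpair x y = vpair x' y' \<longleftrightarrow> x = x' \<and> y = y'"
proof
  assume "vpair x y = vpair x' y'"
  then have "{vset {x}, vset {x, y}} = {vset {x'}, vset {x', y'}}"
    using elts_vpair[of x y] elts_vpair[of x' y'] by simp
  moreover have "vset {a, b} = vset {c, d} \<longleftrightarrow> {a, b} = {c, d}" for a b c d :: 'a
    using elts_inject[of "vset {a, b}" "vset {c, d}"] by simp
  moreover have "vset {a} = vset {c, d} \<longleftrightarrow> {a} = {c, d}" for a c d :: 'a
    using elts_inject[of "vset {a}" "vset {c, d}"] by simp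
  moreover have "vset {a} = vset {c} \<longleftrightarrow> a = c" for a c :: 'a
    using elts_inject[of "vset {a}" "vset {c}"] by simp
  moreover have "vset {c, d} = vset {a} \<longleftrightarrow> c = a \<and> d = a" for a c d :: 'a
    using elts_inject[of "vset {c, d}" "vset {a}"] by auto
  ultimately show "x = x' \<and> y = y'"
    unfolding doubleton_eq_iff by auto
qed auto

lemma definable_term_vpair:
  "definable_term s \<Longrightarrow> definable_term t \<Longrightarrow> definable_term (\<lambda>e. vpair (s e) (t e))"
  unfolding vpair_def by (intro definable_intros)

lemma in_range_elts_Collect: 
  assumes "A \<in> range elts" "definable (\<lambda>e. P (e 0))" shows "{x \<in> A. P x} \<in> range elts"
  using separation_set[of "\<lambda>x e. P x"] assms by simp

lemma in_range_elts_image: 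
  assumes "A \<in> range elts" "definable_term (\<lambda>e. f (e 0))" shows "f ` A \<in> range elts"
  using replacement_set[of "\<lambda>x e. f x"] assms by simp

lemma ndom_eq: "ndom \<tau> = {\<eta> \<in> \<Union>p\<in>elts \<tau>. \<Union>q\<in>elts p. elts q. \<exists>b. vpair \<eta> b \<in>\<^sub>V \<tau>}"
proof -
  have "\<eta> \<in> (\<Union>p\<in>elts \<tau>. \<Union>q\<in>elts p. elts q)" if "vpair \<eta> b \<in>\<^sub>V \<tau>" for \<eta> b
    using that by (intro UN_I[of "vpair \<eta> b"] UN_I[of "vset {\<eta>}"]) (simp_all add: elts_def[of \<tau>] elts_vpair)
  then show ?thesis unfolding ndom_def by blast
qed

lemma definable_set_ndom: "definable_term t \<Longrightarrow> definable_set (\<lambda>e. ndom (t e))"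
  unfolding ndom_eq
  by (rule definable_set_app1[of "\<lambda>\<tau>. {\<eta> \<in> \<Union>p\<in>elts \<tau>. \<Union>q\<in>elts p. elts q. \<exists>b. vpair \<eta> b \<in>\<^sub>V \<tau>}"])
     (intro definable_intros definable_term_vpair)

text \<open>A total variant of \<open>vapp\<close> that is definable for arbitrary arguments. The two agree on functions of \<open>V\<close>
  (\<open>vapp_eq_app\<close>).\<close>

definition app :: "'v::zfc_universe \<Rightarrow> 'v \<Rightarrow> 'v" where
  "app f x = the_default (\<lambda>y. vpair x y \<in>\<^sub>V f)"

definition vfst :: "'v::zfc_universe \<Rightarrow> 'v" where
  "vfst p = the_default (\<lambda>x. \<exists>y. p = vpair x y)"

definition vsnd :: "'v::zfc_universe \<Rightarrow> 'v" where
  "vsnd p = the_default (\<lambda>y. \<exists>x. p = vpair x y)"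

lemma vfst_vpair [simp]: "vfst (vpair x y) = x"
  unfolding vfst_def by (rule the_default_eqI) auto

lemma vsnd_vpair [simp]: "vsnd (vpair x y) = y"
  unfolding vsnd_def by (rule the_default_eqI) auto

text \<open>Replacement applies to images of single sets, so images over pairs are rephrased with projections.\<close>

lemma image_pairs_eq:
  "(\<lambda>(\<eta>, b). g \<eta> b) ` {(\<eta>, b). vpair \<eta> b \<in>\<^sub>V \<sigma>} =
     (\<lambda>q. g (vfst q) (vsnd q)) ` {q \<in> elts \<sigma>. \<exists>\<eta> b. q = vpair \<eta> b}" (is "?l = ?r")
proof
  show "?l \<subseteq> ?r"
  proof clarify
    fix \<eta> b assume "vpair \<eta> b \<in>\<^sub>V \<sigma>"
    then show "g \<eta> b \<in> ?r" by (intro image_eqI[of _ _ "vpair \<eta> b"]) (auto simp: elts_def)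
  qed
  show "?r \<subseteq> ?l"
  proof clarify
    fix \<eta> b assume "vpair \<eta> b \<in> elts \<sigma>"
    then show "g (vfst (vpair \<eta> b)) (vsnd (vpair \<eta> b)) \<in> ?l"
      by (intro image_eqI[of _ _ "(\<eta>, b)"]) (simp_all add: elts_def)
  qed
qed

lemma definable_term_app: "definable_term s \<Longrightarrow> definable_term t \<Longrightarrow> definable_term (\<lambda>e. app (s e) (t e))"
  unfolding app_def
  by (rule definable_term_app2[of "\<lambda>f x. the_default (\<lambda>y. vpair x y \<in>\<^sub>V f)"])
     (intro definable_intros definable_term_vpair, assumption+)

lemma definable_term_vfst: "definable_term t \<Longrightarrow> definable_term (\<lambda>e. vfst (t e))"
  unfolding vfst_def
  by (rule definable_term_app1[of "\<lambda>p. the_default (\<lambda>x. \<exists>y. p = vpair x y)"])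
     (intro definable_intros definable_term_vpair)

lemma definable_term_vsnd: "definable_term t \<Longrightarrow> definable_term (\<lambda>e. vsnd (t e))"
  unfolding vsnd_def
  by (rule definable_term_app1[of "\<lambda>p. the_default (\<lambda>y. \<exists>x. p = vpair x y)"])
     (intro definable_intros definable_term_vpair)

lemmas definable_fun_intros = definable_intros definable_set_ndom definable_term_vpair
  definable_term_app definable_term_vfst definable_term_vsnd

subsection \<open>Transfinite recursion and choice\<close>

text \<open>The solution \<open>F\<close> is given, and the task is to define it over \<open>V\<close>: \<open>F x = v\<close> iff some attempt, that is, a
  set function obeying the recursion on a domain closed under predecessors, maps \<open>x\<close> to \<open>v\<close>. Attempts
  agree with \<open>F\<close> by induction. To get an attempt at \<open>x\<close>, one has to collect attempts at the
  predecessors without choosing them. Each predecessor \<open>y\<close> has a least attempt, the intersection of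
  all attempts at \<open>y\<close>. It is definable from \<open>y\<close>, so replacement applies.\<close>

lemma definable_term_recursion:
  fixes F :: "'v::zfc_universe \<Rightarrow> 'v" and S :: "'v \<Rightarrow> 'v set" and H :: "'v \<Rightarrow> ('v \<Rightarrow> 'v) \<Rightarrow> 'v"
  assumes wf: "wf {(y, x). y \<in> S x}"
    and S: "definable_set (\<lambda>e. S (e 0))"
    and H: "definable_term (\<lambda>e. H (e 0) (app (e (Suc 0))))"
    and only_S: "\<And>x f g. (\<And>y. y \<in> S x \<Longrightarrow> f y = g y) \<Longrightarrow> H x f = H x g"
    and eq: "\<And>x. F x = H x F"
  shows "definable_term (\<lambda>e. F (e 0))"
proof -
  define att where "att f \<longleftrightarrow> (\<forall>p\<in>elts f. \<exists>x. p = vpair x (H x (app f)) \<and>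
    (\<forall>y\<in>S x. \<exists>v. vpair y v \<in>\<^sub>V f))" for f
  have S_term: "definable_set (\<lambda>e. S (t e))" if "definable_term t" for t
    by (rule definable_set_app1[OF S that])
  have H_term: "definable_term (\<lambda>e. H (s e) (app (t e)))" if "definable_term s" "definable_term t" for s t
    by (rule definable_term_app2[OF H that])
  have att_term: "definable (\<lambda>e. att (t e))" if "definable_term t" for t
    by (rule definable_subst[OF _ that])
       (unfold att_def, intro definable_fun_intros S_term H_term)
  have sound: "v = F x" if "att f" "vpair x v \<in>\<^sub>V f" for f x v
    using wf that(2)
  proof (induction x arbitrary: v rule: wf_induct_rule)
    case (less x)
    from \<open>att f\<close> less.prems have v: "v = H x (app f)" and dom: "\<forall>y\<in>S x. \<exists>v. vpair y v \<in>\<^sub>V f"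
      unfolding att_def by (auto simp: elts_def)
    have "app f y = F y" if y: "y \<in> S x" for y
    proof -
      obtain w where w: "vpair y w \<in>\<^sub>V f" using dom y by blast
      have *: "w' = F y" if "vpair y w' \<in>\<^sub>V f" for w'
        by (rule less.IH[OF _ that]) (simp add: y)
      show ?thesis unfolding app_def
        by (rule the_default_eqI) (use w * in auto)
    qed
    then have "H x (app f) = H x F" by (rule only_S)
    then show "v = F x" unfolding v eq[of x] .
  qed
  \<comment> \<open>The intersection of all attempts at \<open>y\<close>; \<open>m y\<close> below is the corresponding set.\<close>
  define mem_all where "mem_all y q \<longleftrightarrow> (\<forall>f. att f \<and> (\<exists>v. vpair y v \<in>\<^sub>V f) \<longrightarrow> q \<in>\<^sub>V f)" for y q
  define m where "m y = the_default (\<lambda>z. \<forall>q. q \<in>\<^sub>V z \<longleftrightarrow> mem_all y q)" for y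
  have m_term: "definable_term (\<lambda>e. m (t e))" if "definable_term t" for t
    by (rule definable_term_app1[OF _ that])
       (unfold m_def mem_all_def, intro definable_fun_intros att_term)
  have complete: "\<exists>f. att f \<and> vpair x (F x) \<in>\<^sub>V f" for x
    using wf
  proof (induction x rule: wf_induct_rule)
    case (less x)
    have elts_m: "elts (m y) = {q. mem_all y q}" if "y \<in> S x" for y
    proof -
      obtain f where f: "att f" "vpair y (F y) \<in>\<^sub>V f" using less \<open>y \<in> S x\<close> by blast
      have "{q \<in> elts f. mem_all y q} \<in> range elts"
        by (rule in_range_elts_Collect)
           (simp, unfold mem_all_def, intro definable_fun_intros att_term)
      moreover have "{q \<in> elts f. mem_all y q} = {q. mem_all y q}"
        using f unfolding mem_all_def by (auto simp: elts_def)
      ultimately obtain z where z: "elts z = {q. mem_all y q}" by auto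
      have "m y = z" unfolding m_def
      proof (rule the_default_eqI)
        show "\<forall>q. q \<in>\<^sub>V z \<longleftrightarrow> mem_all y q" using z unfolding elts_def by blast
        show "z' = z" if "\<forall>q. q \<in>\<^sub>V z' \<longleftrightarrow> mem_all y q" for z'
          using that z unfolding elts_inject[symmetric] by (simp add: elts_def)
      qed
      then show ?thesis using z by simp
    qed
    have "insert (vpair x (F x)) (\<Union>y\<in>S x. elts (m y)) \<in> range elts"
      by (rule definable_set_in_V[where e = undefined])
         (intro definable_fun_intros S_term m_term)
    then obtain f where f: "elts f = insert (vpair x (F x)) (\<Union>y\<in>S x. elts (m y))" by auto
    have vals: "\<exists>u. q = vpair u (F u) \<and> (\<forall>w\<in>S u. vpair w (F w) \<in>\<^sub>V f)" if q: "q \<in>\<^sub>V f" for q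
    proof (cases "q = vpair x (F x)")
      case True
      have "mem_all w (vpair w (F w))" for w
        unfolding mem_all_def using sound by blast
      then have "vpair w (F w) \<in> elts f" if "w \<in> S x" for w
        unfolding f using elts_m that by blast
      then show ?thesis using True by (auto simp: elts_def)
    next
      case False
      then obtain y where y: "y \<in> S x" "mem_all y q"
        using q f elts_m by (auto simp: elts_def)
      obtain g where g: "att g" "vpair y (F y) \<in>\<^sub>V g" using less y by blast
      have "q \<in>\<^sub>V g" using y(2) g unfolding mem_all_def by blast
      then obtain u v where u: "q = vpair u v" using g unfolding att_def by (auto simp: elts_def)
      have v: "v = F u" using sound g \<open>q \<in>\<^sub>V g\<close> u by blast
      have "vpair w (F w) \<in>\<^sub>V f" if "w \<in> S u" for w
      proof -
        have "mem_all y (vpair w (F w))"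
          unfolding mem_all_def
        proof (intro allI impI)
          fix h assume h: "att h \<and> (\<exists>v. vpair y v \<in>\<^sub>V h)"
          then have "q \<in>\<^sub>V h" using y(2) unfolding mem_all_def by blast
          then obtain w' where "vpair w w' \<in>\<^sub>V h"
            using h \<open>w \<in> S u\<close> unfolding att_def u by (force simp: elts_def)
          then show "vpair w (F w) \<in>\<^sub>V h" using sound h by blast
        qed
        then have "vpair w (F w) \<in> elts f" unfolding f using elts_m y(1) by blast
        then show ?thesis by (simp add: elts_def)
      qed
      then show ?thesis using u v by blast
    qed
    have "att f" unfolding att_def
    proof
      fix q assume "q \<in> elts f"
      then obtain u where u: "q = vpair u (F u)" "\<And>w. w \<in> S u \<Longrightarrow> vpair w (F w) \<in>\<^sub>V f"
        using vals by (auto simp: elts_def)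
      have "app f w = F w" if "w \<in> S u" for w
        unfolding app_def
      proof (rule the_default_eqI)
        show "vpair w (F w) \<in>\<^sub>V f" by (rule u(2)[OF that])
        show "y = F w" if "vpair w y \<in>\<^sub>V f" for y
          using vals[OF that] by auto
      qed
      then have "H u (app f) = H u F" by (rule only_S)
      then have "F u = H u (app f)" unfolding eq[of u] by simp
      with u(1) have "q = vpair u (H u (app f))" by simp
      then show "\<exists>x. q = vpair x (H x (app f)) \<and> (\<forall>y\<in>S x. \<exists>v. vpair y v \<in>\<^sub>V f)"
        using u(2) by blast
    qed
    moreover have "vpair x (F x) \<in>\<^sub>V f" using f by (auto simp: elts_def)
    ultimately show ?case by blast
  qed
  have "v = F x \<longleftrightarrow> (\<exists>f. att f \<and> vpair x v \<in>\<^sub>V f)" for v x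
    using sound complete by blast
  then show ?thesis unfolding definable_term_def
    by (simp, intro definable_fun_intros att_term)
qed

lemma vapp_mem: "vfun Z f \<Longrightarrow> z \<in> elts Z \<Longrightarrow> vpair z (vapp f z) \<in>\<^sub>V f"
  unfolding vapp_def vfun_def by (rule theI') blast

lemma vapp_eqI: "vfun Z f \<Longrightarrow> z \<in> elts Z \<Longrightarrow> vpair z y \<in>\<^sub>V f \<Longrightarrow> vapp f z = y"
  using vapp_mem[of Z f z] unfolding vfun_def by blast

lemma vapp_eq_app: assumes "vfun Z f" "z \<in> elts Z" shows "vapp f z = app f z"
proof -
  have "app f z = vapp f z" unfolding app_def
    by (rule the_default_eqI) (rule vapp_mem[OF assms], rule vapp_eqI[OF assms, symmetric])
  then show ?thesis by simp
qed

definition graph_on :: "'v::zfc_universe \<Rightarrow> ('v \<Rightarrow> 'v) \<Rightarrow> 'v" where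
  "graph_on Z F = vset ((\<lambda>z. vpair z (F z)) ` elts Z)"

lemma
  assumes "definable_term (\<lambda>e. F (e 0))"
  shows vfun_graph_on: "vfun Z (graph_on Z F)"
    and vapp_graph_on: "z \<in> elts Z \<Longrightarrow> vapp (graph_on Z F) z = F z"
proof -
  have "(\<lambda>z. vpair z (F z)) ` elts Z \<in> range elts"
    by (rule in_range_elts_image) (simp, intro definable_fun_intros assms)
  then have elts: "elts (graph_on Z F) = (\<lambda>z. vpair z (F z)) ` elts Z"
    unfolding graph_on_def by (rule elts_vset)
  then have mem: "p \<in>\<^sub>V graph_on Z F \<longleftrightarrow> (\<exists>z\<in>elts Z. p = vpair z (F z))" for p
    unfolding elts_def[of "graph_on Z F"] by blast
  show *: "vfun Z (graph_on Z F)"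
    unfolding vfun_def elts mem by auto
  show "vapp (graph_on Z F) z = F z" if "z \<in> elts Z"
    by (rule vapp_eqI[OF * that]) (use that mem in blast)
qed

lemma doubleton_in_V: "{x, y} \<in> range elts"
  using rangeI[of elts "vset {x, y}"] by simp

text \<open>The axiom of choice concerns disjoint families, so it is applied to the sets \<open>{a} \<times> {c. R a c}\<close>.\<close>

lemma vfun_choice:
  fixes A C :: "'v::zfc_universe"
  assumes R: "definable (\<lambda>e. R (e 0) (e (Suc 0)))"
    and ex: "\<And>a. a \<in> elts A \<Longrightarrow> \<exists>c\<in>elts C. R a c"
  obtains s where "vfun A s" "\<And>a. a \<in> elts A \<Longrightarrow> vapp s a \<in> elts C" "\<And>a. a \<in> elts A \<Longrightarrow> R a (vapp s a)"
proof -
  define F where "F a = vset ((\<lambda>c. vpair a c) ` {c \<in> elts C. R a c})" for a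
  have R_term: "definable (\<lambda>e. R (t e) (u e))" if "definable_term t" "definable_term u" for t u
  proof (rule definable_subst[OF _ \<open>definable_term t\<close>, of "\<lambda>x e. R x (u e)"])
    show "definable (\<lambda>e. R (e 0) (u (\<lambda>n. e (Suc n))))"
      by (rule definable_subst[OF _ definable_term_shift[OF \<open>definable_term u\<close>], of "\<lambda>x e. R (e 0) x"])
         (rule definable_rename[OF R, of "case_nat 1 (\<lambda>_. 0)", simplified])
  qed
  have img: "definable_set (\<lambda>e. (\<lambda>c. vpair (t e) c) ` {c \<in> elts C. R (t e) c})" if "definable_term t" for t
    by (rule definable_set_app1[OF _ that, of "\<lambda>a. (\<lambda>c. vpair a c) ` {c \<in> elts C. R a c}"])
       (intro definable_fun_intros R_term)
  have F_term: "definable_term (\<lambda>e. F (t e))" if "definable_term t" for t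
    unfolding F_def by (intro definable_fun_intros img that)
  have elts_F: "elts (F a) = (\<lambda>c. vpair a c) ` {c \<in> elts C. R a c}" for a
    unfolding F_def by (rule elts_vset) (rule definable_set_in_V[OF img], rule definable_term_const)
  have "F ` elts A \<in> range elts"
    by (rule in_range_elts_image) (simp, intro definable_fun_intros F_term)
  then obtain fam where fam: "elts fam = F ` elts A" by auto
  have "\<exists>k. \<forall>x. x \<in>\<^sub>V fam \<longrightarrow> (\<exists>!z. z \<in>\<^sub>V x \<and> z \<in>\<^sub>V k)"
  proof (rule choice, intro conjI allI impI)
    fix x assume "x \<in>\<^sub>V fam"
    then obtain a where "a \<in> elts A" "x = F a" using fam unfolding elts_def[of fam] by auto
    then have "elts x \<noteq> {}" using ex[of a] elts_F[of a] by auto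
    then show "\<exists>z. z \<in>\<^sub>V x" by (auto simp: elts_def)
  next
    fix x y assume "x \<in>\<^sub>V fam \<and> y \<in>\<^sub>V fam \<and> x \<noteq> y"
    then have "x \<in> elts fam" "y \<in> elts fam" "x \<noteq> y" by (simp_all add: elts_def)
    then obtain a b where "x = F a" "y = F b" "a \<noteq> b" unfolding fam by blast
    then have "elts x \<inter> elts y = {}" using elts_F[of a] elts_F[of b] by auto
    then show "\<not> (\<exists>z. z \<in>\<^sub>V x \<and> z \<in>\<^sub>V y)" by (auto simp: elts_def)
  qed
  then obtain k where k0: "\<And>x. x \<in>\<^sub>V fam \<Longrightarrow> \<exists>!z. z \<in>\<^sub>V x \<and> z \<in>\<^sub>V k" by blast
  have k: "\<exists>!z. z \<in> elts (F a) \<and> z \<in> elts k" if "a \<in> elts A" for a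
  proof -
    have "F a \<in> elts fam" using fam that by simp
    then show ?thesis using k0[of "F a"] by (simp add: elts_def)
  qed
  have "{p \<in> \<Union>a\<in>elts A. elts (F a). p \<in> elts k} \<in> range elts"
    by (rule definable_set_in_V[where e = undefined]) (intro definable_fun_intros F_term)
  then obtain s where s: "elts s = {p \<in> \<Union>a\<in>elts A. elts (F a). p \<in> elts k}" by auto
  have mem: "vpair a c \<in>\<^sub>V s \<longleftrightarrow> a \<in> elts A \<and> c \<in> elts C \<and> R a c \<and> vpair a c \<in> elts k" for a c
  proof -
    have "vpair a c \<in>\<^sub>V s \<longleftrightarrow> vpair a c \<in> elts s" by (simp add: elts_def)
    then show ?thesis unfolding s elts_F by auto
  qed
  have unique: "\<exists>!c. vpair a c \<in>\<^sub>V s" if a: "a \<in> elts A" for a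
  proof -
    obtain z where z: "z \<in> elts (F a)" "z \<in> elts k" "\<And>z'. z' \<in> elts (F a) \<Longrightarrow> z' \<in> elts k \<Longrightarrow> z' = z"
      using k[OF a] by blast
    obtain c where c: "z = vpair a c" "c \<in> elts C" "R a c" using z(1) unfolding elts_F by blast
    show ?thesis
    proof (rule ex1I)
      show "vpair a c \<in>\<^sub>V s" unfolding mem using a c z(2) by simp
      fix c' assume "vpair a c' \<in>\<^sub>V s"
      then have "vpair a c' = z" unfolding mem by (intro z(3)) (auto simp: elts_F)
      then show "c' = c" using c by simp
    qed
  qed
  have "vfun A s"
    unfolding vfun_def using unique s elts_F by auto
  moreover have "vapp s a \<in> elts C \<and> R a (vapp s a)" if "a \<in> elts A" for a
    using vapp_mem[OF \<open>vfun A s\<close> that] unfolding mem by blast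
  ultimately show thesis using that by blast
qed

context complete_boolean_algebra_in_V
begin

section \<open>Complete Boolean algebras in V\<close>

lemma definable_set_carrier: "definable_set (\<lambda>e. carrier L)"
proof -
  obtain c where "elts c = carrier L" using carrier_in_V by blast
  then show ?thesis using definable_set_elts[OF definable_term_const, of c] by simp
qed

text \<open>Only the restriction of the order to the carrier belongs to \<open>V\<close>; elsewhere \<open>\<sqsubseteq>\<close> is arbitrary.\<close>

lemma definable_le:
  assumes "definable_term s" "definable_term t"
  shows "definable (\<lambda>e. s e \<in> carrier L \<and> t e \<in> carrier L \<and> s e \<sqsubseteq> t e)"
proof -
  obtain r where r: "elts r = {vpair x y | x y. x \<in> carrier L \<and> y \<in> carrier L \<and> x \<sqsubseteq> y}"
    using order_in_V by blast
  have "vpair x y \<in>\<^sub>V r \<longleftrightarrow> x \<in> carrier L \<and> y \<in> carrier L \<and> x \<sqsubseteq> y" for x y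
  proof -
    have "vpair x y \<in>\<^sub>V r \<longleftrightarrow> vpair x y \<in> elts r" by (simp add: elts_def)
    then show ?thesis unfolding r by auto
  qed
  moreover have "definable (\<lambda>e. vpair (s e) (t e) \<in>\<^sub>V r)"
    by (intro definable_fun_intros assms)
  ultimately show ?thesis by simp
qed

lemma Int_carrier_in_V: assumes "X \<in> range elts" shows "X \<inter> carrier L \<in> range elts"
proof -
  have "{x \<in> X. x \<in> carrier L} \<in> range elts"
    by (rule in_range_elts_Collect[OF assms]) (intro definable_fun_intros definable_set_carrier)
  then show ?thesis by (simp add: Int_def)
qed

text \<open>Upper bounds ignore the elements outside the carrier, so that every set of \<open>V\<close> has a join. Thus joins
  and meets are definable without side conditions on their arguments, and Boolean values lie in the
  carrier by their form alone.\<close>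

lemma least_Sup: assumes "X \<in> range elts" shows "least L (\<Squnion> X) (Upper L X)"
proof -
  obtain x where x: "elts x = X \<inter> carrier L" using Int_carrier_in_V[OF assms] by auto
  have "\<exists>s. least L s (Upper L (elts x))" by (rule sup_exists_in_V) (simp add: x)
  moreover have "Upper L (elts x) = Upper L X" unfolding x Upper_def by blast
  ultimately show ?thesis unfolding sup_def by (auto intro: someI_ex)
qed

lemma greatest_Inf: assumes "X \<in> range elts" shows "greatest L (\<Sqinter> X) (Lower L X)"
proof -
  obtain x where x: "elts x = X \<inter> carrier L" using Int_carrier_in_V[OF assms] by auto
  have "\<exists>s. greatest L s (Lower L (elts x))" by (rule inf_exists_in_V) (simp add: x)
  moreover have "Lower L (elts x) = Lower L X" unfolding x Lower_def by blast
  ultimately show ?thesis unfolding inf_def by (auto intro: someI_ex)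
qed

lemma Sup_closed: "X \<in> range elts \<Longrightarrow> \<Squnion> X \<in> carrier L"
  using least_Sup least_closed by blast

lemma Inf_closed: "X \<in> range elts \<Longrightarrow> \<Sqinter> X \<in> carrier L"
  using greatest_Inf greatest_closed by blast

lemma Sup_upper: "X \<in> range elts \<Longrightarrow> x \<in> X \<Longrightarrow> x \<in> carrier L \<Longrightarrow> x \<sqsubseteq> \<Squnion> X"
  using least_Sup[of X] unfolding least_def Upper_def by blast

lemma Sup_least:
  "X \<in> range elts \<Longrightarrow> z \<in> carrier L \<Longrightarrow> (\<And>x. x \<in> X \<Longrightarrow> x \<in> carrier L \<Longrightarrow> x \<sqsubseteq> z) \<Longrightarrow> \<Squnion> X \<sqsubseteq> z"
  using least_Sup[of X] unfolding least_def Upper_def by blast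

lemma Inf_lower: "X \<in> range elts \<Longrightarrow> x \<in> X \<Longrightarrow> x \<in> carrier L \<Longrightarrow> \<Sqinter> X \<sqsubseteq> x"
  using greatest_Inf[of X] unfolding greatest_def Lower_def by blast

lemma Inf_greatest:
  "X \<in> range elts \<Longrightarrow> z \<in> carrier L \<Longrightarrow> (\<And>x. x \<in> X \<Longrightarrow> x \<in> carrier L \<Longrightarrow> z \<sqsubseteq> x) \<Longrightarrow> z \<sqsubseteq> \<Sqinter> X"
  using greatest_Inf[of X] unfolding greatest_def Lower_def by blast

lemma meet_closed_total [simp]: "x \<sqinter> y \<in> carrier L"
  unfolding meet_def by (rule Inf_closed[OF doubleton_in_V])

lemma join_closed_total [simp]: "x \<squnion> y \<in> carrier L"
  unfolding join_def by (rule Sup_closed[OF doubleton_in_V])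

text \<open>A join is determined by the elements above it, and these are definable from the set.\<close>

lemma definable_term_Sup:
  assumes "definable_set A" shows "definable_term (\<lambda>e. \<Squnion> (A e))"
proof -
  have *: "y = \<Squnion> (elts a) \<longleftrightarrow> y \<in> carrier L \<and>
      (\<forall>u. (u \<in> carrier L \<and> (\<forall>x\<in>elts a. x \<in> carrier L \<longrightarrow> x \<in> carrier L \<and> u \<in> carrier L \<and> x \<sqsubseteq> u)) \<longleftrightarrow>
        y \<in> carrier L \<and> u \<in> carrier L \<and> y \<sqsubseteq> u)" (is "_ \<longleftrightarrow> ?rhs y") for y a
  proof -
    have 1: "?rhs (\<Squnion> (elts a))"
      using Sup_closed[of "elts a"] Sup_upper[of "elts a"] Sup_least[of "elts a"] by (blast intro: le_trans)
    show ?thesis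
    proof
      assume r: "?rhs y"
      then have y: "y \<in> carrier L" by blast
      have s: "\<Squnion> (elts a) \<in> carrier L" by (rule Sup_closed) simp
      have h: "y \<sqsubseteq> u \<longleftrightarrow> \<Squnion> (elts a) \<sqsubseteq> u" if u: "u \<in> carrier L" for u
        using r 1 u s y by metis
      have "y \<sqsubseteq> \<Squnion> (elts a)" "\<Squnion> (elts a) \<sqsubseteq> y"
        using h[OF y] h[OF s] le_refl[OF y] le_refl[OF s] by blast+
      then show "y = \<Squnion> (elts a)" using s y by (intro le_antisym)
    qed (use 1 in simp)
  qed
  have "definable_term (\<lambda>e. \<Squnion> (elts (vset (A e))))"
    by (rule definable_term_app1[of "\<lambda>a. \<Squnion> (elts a)"], unfold definable_term_def *)
       (intro definable_fun_intros definable_le definable_set_carrier,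
        rule definable_term_vset[OF assms, unfolded definable_term_def])
  then show ?thesis using elts_vset[OF definable_set_in_V[OF assms]] by simp
qed

lemma definable_term_Inf:
  assumes "definable_set A" shows "definable_term (\<lambda>e. \<Sqinter> (A e))"
proof -
  have *: "y = \<Sqinter> (elts a) \<longleftrightarrow> y \<in> carrier L \<and>
      (\<forall>u. (u \<in> carrier L \<and> (\<forall>x\<in>elts a. x \<in> carrier L \<longrightarrow> u \<in> carrier L \<and> x \<in> carrier L \<and> u \<sqsubseteq> x)) \<longleftrightarrow>
        u \<in> carrier L \<and> y \<in> carrier L \<and> u \<sqsubseteq> y)" (is "_ \<longleftrightarrow> ?rhs y") for y a
  proof -
    have 1: "?rhs (\<Sqinter> (elts a))"
      using Inf_closed[of "elts a"] Inf_lower[of "elts a"] Inf_greatest[of "elts a"] by (blast intro: le_trans)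
    show ?thesis
    proof
      assume r: "?rhs y"
      then have y: "y \<in> carrier L" by blast
      have s: "\<Sqinter> (elts a) \<in> carrier L" by (rule Inf_closed) simp
      have h: "u \<sqsubseteq> y \<longleftrightarrow> u \<sqsubseteq> \<Sqinter> (elts a)" if u: "u \<in> carrier L" for u
        using r 1 u s y by metis
      have "y \<sqsubseteq> \<Sqinter> (elts a)" "\<Sqinter> (elts a) \<sqsubseteq> y"
        using h[OF y] h[OF s] le_refl[OF y] le_refl[OF s] by blast+
      then show "y = \<Sqinter> (elts a)" using s y by (intro le_antisym)
    qed (use 1 in simp)
  qed
  have "definable_term (\<lambda>e. \<Sqinter> (elts (vset (A e))))"
    by (rule definable_term_app1[of "\<lambda>a. \<Sqinter> (elts a)"], unfold definable_term_def *)
       (intro definable_fun_intros definable_le definable_set_carrier,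
        rule definable_term_vset[OF assms, unfolded definable_term_def])
  then show ?thesis using elts_vset[OF definable_set_in_V[OF assms]] by simp
qed

lemma definable_term_meet: "definable_term s \<Longrightarrow> definable_term t \<Longrightarrow> definable_term (\<lambda>e. s e \<sqinter> t e)"
  unfolding meet_def by (intro definable_term_Inf definable_fun_intros)

lemma definable_term_join: "definable_term s \<Longrightarrow> definable_term t \<Longrightarrow> definable_term (\<lambda>e. s e \<squnion> t e)"
  unfolding join_def by (intro definable_term_Sup definable_fun_intros)

lemma complement_unique:
  assumes "x \<in> carrier L" "y \<in> carrier L" "z \<in> carrier L"
    "x \<sqinter> y = \<bottom>" "x \<squnion> y = \<top>" "x \<sqinter> z = \<bottom>" "x \<squnion> z = \<top>"
  shows "y = z"
proof -
  have le: "y \<sqsubseteq> z" if yz: "y \<in> carrier L" "z \<in> carrier L" "x \<sqinter> y = \<bottom>" "x \<squnion> z = \<top>" for y z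
  proof -
    have 1: "y \<sqsubseteq> y \<sqinter> (x \<squnion> z)" by (rule meet_le) (simp_all add: yz)
    have 2: "y \<sqinter> (x \<squnion> z) = (y \<sqinter> x) \<squnion> (y \<sqinter> z)" using yz assms(1) by (intro distributive)
    have 3: "y \<sqinter> x = \<bottom>" using yz meet_comm[of L y x] by simp
    have 4: "(y \<sqinter> x) \<squnion> (y \<sqinter> z) \<sqsubseteq> z" unfolding 3 by (rule join_le) (simp_all add: yz meet_right)
    show "y \<sqsubseteq> z" using le_trans[OF 1[unfolded 2] 4] yz by simp
  qed
  show ?thesis using assms by (intro le_antisym) (simp_all add: le)
qed

lemma compl_props:
  assumes "x \<in> carrier L"
  shows compl_closed: "compl L x \<in> carrier L" and meet_compl: "x \<sqinter> compl L x = \<bottom>"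
    and join_compl: "x \<squnion> compl L x = \<top>"
proof -
  have "\<exists>!y. y \<in> carrier L \<and> x \<sqinter> y = \<bottom> \<and> x \<squnion> y = \<top>"
  proof -
    obtain y where y: "y \<in> carrier L" "x \<sqinter> y = \<bottom>" "x \<squnion> y = \<top>"
      using complemented[OF assms] by blast
    show ?thesis
      by (rule ex1I[of _ y]) (simp_all add: y complement_unique[OF assms _ y(1) _ _ y(2,3)])
  qed
  from theI'[OF this] show "compl L x \<in> carrier L" "x \<sqinter> compl L x = \<bottom>" "x \<squnion> compl L x = \<top>"
    unfolding compl_def by blast+
qed

lemma compl_eqI:
  "x \<in> carrier L \<Longrightarrow> y \<in> carrier L \<Longrightarrow> x \<sqinter> y = \<bottom> \<Longrightarrow> x \<squnion> y = \<top> \<Longrightarrow> compl L x = y"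
  by (rule complement_unique[OF _ compl_closed _ meet_compl join_compl])

lemma definable_term_compl:
  assumes "definable_term t" "\<And>e. t e \<in> carrier L" shows "definable_term (\<lambda>e. compl L (t e))"
proof -
  have "compl L x = the_default (\<lambda>y. y \<in> carrier L \<and> x \<sqinter> y = \<bottom> \<and> x \<squnion> y = \<top>)" if "x \<in> carrier L" for x
  proof (rule the_default_eqI[symmetric])
    show "compl L x \<in> carrier L \<and> x \<sqinter> compl L x = \<bottom> \<and> x \<squnion> compl L x = \<top>"
      using compl_props[OF that] by simp
    show "y = compl L x" if "y \<in> carrier L \<and> x \<sqinter> y = \<bottom> \<and> x \<squnion> y = \<top>" for y
      using compl_eqI[OF \<open>x \<in> carrier L\<close>, of y] that by simp
  qed
  moreover have "definable_term (\<lambda>e. the_default (\<lambda>y. y \<in> carrier L \<and> t e \<sqinter> y = \<bottom> \<and> t e \<squnion> y = \<top>))"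
    by (rule definable_term_app1[OF _ assms(1), of "\<lambda>x. the_default (\<lambda>y. y \<in> carrier L \<and> x \<sqinter> y = \<bottom> \<and> x \<squnion> y = \<top>)"])
       (intro definable_fun_intros definable_set_carrier definable_term_meet definable_term_join)
  ultimately show ?thesis using assms(2) by simp
qed

text \<open>Residuation. It turns the implications in the definition of \<open>[\<tau> \<subseteq> \<sigma>]\<close> into hypothetical reasoning and
  yields the infinite distributive law behind the next lemma.\<close>

lemma le_imp_iff:
  assumes x: "x \<in> carrier L" and y: "y \<in> carrier L" and z: "z \<in> carrier L"
  shows "x \<sqsubseteq> compl L y \<squnion> z \<longleftrightarrow> x \<sqinter> y \<sqsubseteq> z"
proof
  note c = compl_closed[OF y]
  assume le: "x \<sqsubseteq> compl L y \<squnion> z"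
  have 1: "x \<sqinter> y \<sqsubseteq> y \<sqinter> (compl L y \<squnion> z)"
    by (rule meet_le) (simp_all add: x y z c meet_right le_trans[OF meet_left le])
  have 2: "y \<sqinter> (compl L y \<squnion> z) = (y \<sqinter> compl L y) \<squnion> (y \<sqinter> z)" using y z c by (intro distributive)
  have 3: "(y \<sqinter> compl L y) \<squnion> (y \<sqinter> z) \<sqsubseteq> z"
    unfolding meet_compl[OF y] by (rule join_le) (simp_all add: y z meet_right)
  show "x \<sqinter> y \<sqsubseteq> z" using le_trans[OF 1[unfolded 2] 3] z by simp
next
  note c = compl_closed[OF y]
  assume le: "x \<sqinter> y \<sqsubseteq> z"
  have 1: "x \<sqsubseteq> x \<sqinter> (y \<squnion> compl L y)" by (rule meet_le) (simp_all add: x join_compl[OF y])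
  have 2: "x \<sqinter> (y \<squnion> compl L y) = (x \<sqinter> y) \<squnion> (x \<sqinter> compl L y)" using x y c by (intro distributive)
  have 3: "(x \<sqinter> y) \<squnion> (x \<sqinter> compl L y) \<sqsubseteq> compl L y \<squnion> z"
  proof (rule join_le)
    show "x \<sqinter> y \<sqsubseteq> compl L y \<squnion> z" by (rule le_trans[OF le join_right]) (simp_all add: z c)
    show "x \<sqinter> compl L y \<sqsubseteq> compl L y \<squnion> z"
      by (rule le_trans[OF meet_right join_left]) (simp_all add: x z c)
  qed simp_all
  show "x \<sqsubseteq> compl L y \<squnion> z" using le_trans[OF 1[unfolded 2] 3] x by simp
qed

text \<open>Elimination of a join in the style of forcing: if every \<open>q \<sqsubseteq> p\<close> below a joinand is below \<open>z\<close>, then \<open>p\<close>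
  is, because \<open>\<Squnion>X \<sqsubseteq> compl p \<squnion> z\<close>.\<close>

lemma le_Sup_cases:
  assumes "p \<in> carrier L" "X \<in> range elts" "p \<sqsubseteq> \<Squnion> X" "z \<in> carrier L"
    and cases: "\<And>x q. x \<in> X \<Longrightarrow> x \<in> carrier L \<Longrightarrow> q \<in> carrier L \<Longrightarrow> q \<sqsubseteq> p \<Longrightarrow> q \<sqsubseteq> x \<Longrightarrow> q \<sqsubseteq> z"
  shows "p \<sqsubseteq> z"
proof -
  have "\<Squnion> X \<sqsubseteq> compl L p \<squnion> z"
  proof (rule Sup_least[OF assms(2) join_closed_total])
    fix x assume x: "x \<in> X" "x \<in> carrier L"
    have "x \<sqinter> p \<sqsubseteq> z"
      by (rule cases[OF x]) (simp_all add: x(2) assms(1) meet_left meet_right)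
    then show "x \<sqsubseteq> compl L p \<squnion> z" using le_imp_iff[OF x(2) assms(1,4)] by blast
  qed
  then have "p \<sqsubseteq> compl L p \<squnion> z"
    using le_trans[OF assms(3)] assms(1) Sup_closed[OF assms(2)] by simp
  then have "p \<sqinter> p \<sqsubseteq> z" using le_imp_iff[OF assms(1,1,4)] by blast
  moreover have "p \<sqsubseteq> p \<sqinter> p" by (rule meet_le) (simp_all add: assms(1))
  ultimately show ?thesis using le_trans[of p "p \<sqinter> p" z] assms(1,4) by simp
qed

section \<open>Boolean values\<close>

lemmas definable_alg_intros = definable_fun_intros definable_le definable_set_carrier
  definable_term_Sup definable_term_Inf definable_term_meet definable_term_join

text \<open>The recursion step for the value of an equation, with the values at smaller pairs of names supplied
  by \<open>f\<close>. Membership and inclusion are expanded, so that equality alone is defined by recursion.\<close>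

definition mem_rec where
  "mem_rec f \<eta> \<sigma> = \<Squnion> ((\<lambda>q. f (vpair \<eta> (vfst q)) \<sqinter> vsnd q) ` {q \<in> elts \<sigma>. \<exists>\<zeta> b. q = vpair \<zeta> b})"

definition sub_rec where
  "sub_rec f \<tau> \<sigma> = \<Sqinter> ((\<lambda>\<eta>. compl L (mem_rec f \<eta> \<tau>) \<squnion> mem_rec f \<eta> \<sigma>) ` ndom \<tau>)"

lemma bval_mem_rec: "bval_mem L \<tau> \<sigma> = mem_rec (\<lambda>p. bval_eq L (vfst p) (vsnd p)) \<tau> \<sigma>"
  unfolding bval_mem.simps[of L \<tau>] mem_rec_def image_pairs_eq by simp

lemma bval_sub_rec: "bval_sub L \<tau> \<sigma> = sub_rec (\<lambda>p. bval_eq L (vfst p) (vsnd p)) \<tau> \<sigma>"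
  unfolding bval_sub.simps[of L \<tau>] sub_rec_def bval_mem_rec ..

lemma mem_rec_cong:
  assumes "\<And>\<zeta>. \<zeta> \<in> ndom \<sigma> \<Longrightarrow> f (vpair \<eta> \<zeta>) = g (vpair \<eta> \<zeta>)"
  shows "mem_rec f \<eta> \<sigma> = mem_rec g \<eta> \<sigma>"
proof -
  have "f (vpair \<eta> (vfst q)) = g (vpair \<eta> (vfst q))" if "q \<in> elts \<sigma>" "\<exists>\<zeta> b. q = vpair \<zeta> b" for q
  proof -
    obtain \<zeta> b where q: "q = vpair \<zeta> b" using \<open>\<exists>\<zeta> b. q = vpair \<zeta> b\<close> by blast
    then have "\<zeta> \<in> ndom \<sigma>" using that(1) unfolding ndom_def elts_def by blast
    then show ?thesis using assms q by simp
  qed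
  then have "(\<lambda>q. f (vpair \<eta> (vfst q)) \<sqinter> vsnd q) ` {q \<in> elts \<sigma>. \<exists>\<zeta> b. q = vpair \<zeta> b} =
    (\<lambda>q. g (vpair \<eta> (vfst q)) \<sqinter> vsnd q) ` {q \<in> elts \<sigma>. \<exists>\<zeta> b. q = vpair \<zeta> b}"
    by (intro image_cong) auto
  then show ?thesis unfolding mem_rec_def by simp
qed

lemma sub_rec_cong:
  assumes "\<And>\<eta> \<zeta>. \<eta> \<in> ndom \<tau> \<Longrightarrow> \<zeta> \<in> ndom \<tau> \<union> ndom \<sigma> \<Longrightarrow> f (vpair \<eta> \<zeta>) = g (vpair \<eta> \<zeta>)"
  shows "sub_rec f \<tau> \<sigma> = sub_rec g \<tau> \<sigma>"
proof -
  have "mem_rec f \<eta> \<tau> = mem_rec g \<eta> \<tau>" "mem_rec f \<eta> \<sigma> = mem_rec g \<eta> \<sigma>" if "\<eta> \<in> ndom \<tau>" for \<eta>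
    using assms[OF that] by (auto intro!: mem_rec_cong)
  then have "(\<lambda>\<eta>. compl L (mem_rec f \<eta> \<tau>) \<squnion> mem_rec f \<eta> \<sigma>) ` ndom \<tau> =
    (\<lambda>\<eta>. compl L (mem_rec g \<eta> \<tau>) \<squnion> mem_rec g \<eta> \<sigma>) ` ndom \<tau>"
    by (intro image_cong) auto
  then show ?thesis unfolding sub_rec_def by simp
qed

text \<open>Names are paired to make equality a function of one argument. The predecessors of \<open>(\<tau>, \<sigma>)\<close> are all pairs
  of members of the two domains; they are smaller in the multiset order.\<close>

lemma definable_term_bval_eq:
  assumes "definable_term s" "definable_term t"
  shows "definable_term (\<lambda>e. bval_eq L (s e) (t e))"
proof -
  define F where "F p = bval_eq L (vfst p) (vsnd p)" for p
  define S where "S p = (\<Union>\<eta>\<in>ndom (vfst p) \<union> ndom (vsnd p). (\<lambda>\<zeta>. vpair \<eta> \<zeta>) ` (ndom (vfst p) \<union> ndom (vsnd p)))"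
    for p :: 'v
  define H where "H p f = sub_rec f (vfst p) (vsnd p) \<sqinter> sub_rec f (vsnd p) (vfst p)" for p f
  have "definable_term (\<lambda>e. F (e 0))"
  proof (rule definable_term_recursion)
    have "{(q, p). q \<in> S p} \<subseteq>
        inv_image (mult {(\<eta>, \<tau>). \<eta> \<in> ndom \<tau>}) (\<lambda>p. {#vfst p, vsnd p#})"
    proof clarify
      fix q p assume "q \<in> S p"
      then obtain \<eta> \<zeta> where q: "q = vpair \<eta> \<zeta>"
        and k: "\<eta> \<in> ndom (vfst p) \<union> ndom (vsnd p)" "\<zeta> \<in> ndom (vfst p) \<union> ndom (vsnd p)"
        unfolding S_def by blast
      have "({#} + {#\<eta>, \<zeta>#}, {#} + {#vfst p, vsnd p#}) \<in> mult {(\<eta>, \<tau>). \<eta> \<in> ndom \<tau>}"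
        by (rule one_step_implies_mult) (use k in auto)
      then show "(q, p) \<in> inv_image (mult {(\<eta>, \<tau>). \<eta> \<in> ndom \<tau>}) (\<lambda>p. {#vfst p, vsnd p#})"
        unfolding q by simp
    qed
    then show "wf {(q, p). q \<in> S p}"
      by (rule wf_subset[rotated]) (intro wf_inv_image wf_mult wf_ndom)
    show "definable_set (\<lambda>e. S (e 0))"
      unfolding S_def by (intro definable_fun_intros)
    show "definable_term (\<lambda>e. H (e 0) (app (e (Suc 0))))"
      unfolding H_def sub_rec_def mem_rec_def
      by (intro definable_alg_intros definable_term_compl;
          rule Sup_closed, rule definable_set_in_V, intro definable_alg_intros)
    show "H p f = H p g" if "\<And>q. q \<in> S p \<Longrightarrow> f q = g q" for p f g
      unfolding H_def
      by (intro arg_cong2[where f = "meet L"] sub_rec_cong that) (auto simp: S_def)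
    show "F p = H p F" for p
      unfolding F_def H_def bval_sub_rec[symmetric] by (rule bval_eq.simps)
  qed
  then have "definable_term (\<lambda>e. F (vpair (s e) (t e)))"
    by (rule definable_term_app1) (intro definable_fun_intros assms)
  then show ?thesis unfolding F_def by simp
qed

lemma bval_mem_set_in_V:
  "(\<lambda>(\<eta>, b). bval_eq L \<tau> \<eta> \<sqinter> b) ` {(\<eta>, b). vpair \<eta> b \<in>\<^sub>V \<sigma>} \<in> range elts"
  unfolding image_pairs_eq
  by (rule definable_set_in_V[where e = undefined]) (intro definable_alg_intros definable_term_bval_eq)

lemma bval_mem_closed [simp]: "bval_mem L \<tau> \<sigma> \<in> carrier L"
  unfolding bval_mem.simps[of L \<tau>] by (rule Sup_closed[OF bval_mem_set_in_V])

lemma bval_eq_closed [simp]: "bval_eq L \<tau> \<sigma> \<in> carrier L"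
  unfolding bval_eq.simps[of L \<tau>] by simp

lemma definable_term_bval_mem:
  assumes "definable_term s" "definable_term t"
  shows "definable_term (\<lambda>e. bval_mem L (s e) (t e))"
  by (rule definable_term_app2[OF _ assms], unfold bval_mem_rec mem_rec_def)
     (intro definable_alg_intros definable_term_bval_eq)

lemma bval_sub_set_in_V:
  "(\<lambda>\<eta>. compl L (bval_mem L \<eta> \<tau>) \<squnion> bval_mem L \<eta> \<sigma>) ` ndom \<tau> \<in> range elts"
  by (rule definable_set_in_V[where e = undefined])
     (intro definable_alg_intros definable_term_compl definable_term_bval_mem bval_mem_closed)

lemma bval_sub_closed [simp]: "bval_sub L \<tau> \<sigma> \<in> carrier L"
  unfolding bval_sub.simps[of L \<tau>] by (rule Inf_closed[OF bval_sub_set_in_V])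

lemma definable_term_check:
  assumes "definable_term t" shows "definable_term (\<lambda>e. check L (t e))"
proof (rule definable_term_app1[OF _ assms])
  show "definable_term (\<lambda>e. check L (e 0))"
  proof (rule definable_term_recursion[where S = elts and H = "\<lambda>x f. vset ((\<lambda>y. vpair (f y) \<top>) ` elts x)"])
    show "wf {(y, x). y \<in> elts (x :: 'v)}"
      using wellfounded unfolding wfp_def elts_def by simp
    show "vset ((\<lambda>y. vpair (f y) \<top>) ` elts x) = vset ((\<lambda>y. vpair (g y) \<top>) ` elts x)"
      if "\<And>y. y \<in> elts x \<Longrightarrow> f y = g y" for x f g
      using that by (intro arg_cong[where f = vset] image_cong) auto
    show "check L x = vset ((\<lambda>y. vpair (check L y) \<top>) ` elts x)" for x
      by (rule check.simps)
  qed (intro definable_fun_intros)+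
qed

lemma elts_check: "elts (check L x) = (\<lambda>y. vpair (check L y) \<top>) ` elts x"
  unfolding check.simps[of L x]
  by (rule elts_vset, rule in_range_elts_image) (simp, intro definable_fun_intros definable_term_check)

lemma vpair_mem_check: "vpair \<eta> b \<in>\<^sub>V check L x \<longleftrightarrow> (\<exists>y\<in>elts x. \<eta> = check L y \<and> b = \<top>)"
proof -
  have "vpair \<eta> b \<in>\<^sub>V check L x \<longleftrightarrow> vpair \<eta> b \<in> elts (check L x)" by (simp add: elts_def)
  then show ?thesis unfolding elts_check by auto
qed

lemma ndom_check: "ndom (check L x) = check L ` elts x"
  unfolding ndom_def vpair_mem_check by blast

lemma bname_check: "bname L (check L x)"
  using wellfounded
proof (induction x rule: wfp_induct_rule)
  case (less x)
  show ?case
  proof (rule bname.intros, rule)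
    fix p assume "p \<in> elts (check L x)"
    then obtain y where y: "y \<in> elts x" "p = vpair (check L y) \<top>" unfolding elts_check by blast
    then have "bname L (check L y)" using less by (simp add: elts_def)
    then show "\<exists>\<sigma> b. p = vpair \<sigma> b \<and> bname L \<sigma> \<and> b \<in> carrier L" using y by blast
  qed
qed

lemma bname_pairD: "bname L \<tau> \<Longrightarrow> vpair \<sigma> b \<in>\<^sub>V \<tau> \<Longrightarrow> bname L \<sigma> \<and> b \<in> carrier L"
proof -
  assume n: "bname L \<tau>" and "vpair \<sigma> b \<in>\<^sub>V \<tau>"
  then have *: "vpair \<sigma> b \<in> elts \<tau>" by (simp add: elts_def)
  from n show ?thesis by cases (use * in auto)
qed

lemma bname_ndom: "bname L \<tau> \<Longrightarrow> \<sigma> \<in> ndom \<tau> \<Longrightarrow> bname L \<sigma>"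
  using bname_pairD unfolding ndom_def by blast

lemma le_bottomD: "p \<sqsubseteq> \<bottom> \<Longrightarrow> p \<in> carrier L \<Longrightarrow> z \<in> carrier L \<Longrightarrow> p \<sqsubseteq> z"
  by (rule le_trans[of p \<bottom> z]) simp_all

lemma le_bval_memI:
  assumes "vpair \<eta> b \<in>\<^sub>V \<sigma>" "b \<in> carrier L" "p \<in> carrier L" "p \<sqsubseteq> bval_eq L \<tau> \<eta>" "p \<sqsubseteq> b"
  shows "p \<sqsubseteq> bval_mem L \<tau> \<sigma>"
proof (rule le_trans)
  show "p \<sqsubseteq> bval_eq L \<tau> \<eta> \<sqinter> b" using assms by (intro meet_le) simp_all
  show "bval_eq L \<tau> \<eta> \<sqinter> b \<sqsubseteq> bval_mem L \<tau> \<sigma>"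
    unfolding bval_mem.simps[of L \<tau>]
    by (rule Sup_upper[OF bval_mem_set_in_V]) (use assms in auto)
qed (use assms in simp_all)

lemma le_bval_memE:
  assumes "p \<sqsubseteq> bval_mem L \<tau> \<sigma>" "bname L \<sigma>" "p \<in> carrier L" "z \<in> carrier L"
    and cases: "\<And>\<eta> b q. vpair \<eta> b \<in>\<^sub>V \<sigma> \<Longrightarrow> b \<in> carrier L \<Longrightarrow> q \<in> carrier L \<Longrightarrow> q \<sqsubseteq> p \<Longrightarrow>
      q \<sqsubseteq> bval_eq L \<tau> \<eta> \<Longrightarrow> q \<sqsubseteq> b \<Longrightarrow> q \<sqsubseteq> z"
  shows "p \<sqsubseteq> z"
proof (rule le_Sup_cases[OF assms(3) bval_mem_set_in_V assms(1)[unfolded bval_mem.simps[of L \<tau>]] assms(4)])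
  fix x q
  assume x: "x \<in> (\<lambda>(\<eta>, b). bval_eq L \<tau> \<eta> \<sqinter> b) ` {(\<eta>, b). vpair \<eta> b \<in>\<^sub>V \<sigma>}"
    and q: "q \<in> carrier L" "q \<sqsubseteq> p" "q \<sqsubseteq> x"
  from x obtain \<eta> b where e: "vpair \<eta> b \<in>\<^sub>V \<sigma>" "x = bval_eq L \<tau> \<eta> \<sqinter> b" by auto
  have b: "b \<in> carrier L" using bname_pairD[OF assms(2) e(1)] by simp
  show "q \<sqsubseteq> z"
  proof (rule cases[OF e(1) b q(1,2)])
    show "q \<sqsubseteq> bval_eq L \<tau> \<eta>"
      using le_trans[OF q(3)[unfolded e(2)] meet_left] q(1) b by simp
    show "q \<sqsubseteq> b"
      using le_trans[OF q(3)[unfolded e(2)] meet_right] q(1) b by simp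
  qed
qed

lemma le_meet_iff:
  assumes "p \<in> carrier L" "x \<in> carrier L" "y \<in> carrier L"
  shows "p \<sqsubseteq> x \<sqinter> y \<longleftrightarrow> p \<sqsubseteq> x \<and> p \<sqsubseteq> y"
  using assms le_trans[OF _ meet_left, of p x y] le_trans[OF _ meet_right, of p x y] meet_le[of p x y] by auto

lemma le_bval_eq_iff: "p \<in> carrier L \<Longrightarrow> p \<sqsubseteq> bval_eq L \<tau> \<sigma> \<longleftrightarrow> p \<sqsubseteq> bval_sub L \<tau> \<sigma> \<and> p \<sqsubseteq> bval_sub L \<sigma> \<tau>"
  unfolding bval_eq.simps[of L \<tau>] by (rule le_meet_iff) simp_all

lemma le_bval_subI:
  assumes "p \<in> carrier L"
    and "\<And>\<eta> q. \<eta> \<in> ndom \<tau> \<Longrightarrow> q \<in> carrier L \<Longrightarrow> q \<sqsubseteq> p \<Longrightarrow> q \<sqsubseteq> bval_mem L \<eta> \<tau> \<Longrightarrow> q \<sqsubseteq> bval_mem L \<eta> \<sigma>"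
  shows "p \<sqsubseteq> bval_sub L \<tau> \<sigma>"
  unfolding bval_sub.simps[of L \<tau>]
proof (rule Inf_greatest[OF bval_sub_set_in_V assms(1)], clarify)
  fix \<eta> assume \<eta>: "\<eta> \<in> ndom \<tau>"
  have "p \<sqinter> bval_mem L \<eta> \<tau> \<sqsubseteq> bval_mem L \<eta> \<sigma>"
    by (rule assms(2)[OF \<eta>]) (simp_all add: assms(1) meet_left meet_right)
  then show "p \<sqsubseteq> compl L (bval_mem L \<eta> \<tau>) \<squnion> bval_mem L \<eta> \<sigma>"
    using le_imp_iff[OF assms(1) bval_mem_closed bval_mem_closed] by blast
qed

lemma le_bval_subD:
  assumes "p \<sqsubseteq> bval_sub L \<tau> \<sigma>" "p \<sqsubseteq> bval_mem L \<eta> \<tau>" "p \<in> carrier L" "\<eta> \<in> ndom \<tau>"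
  shows "p \<sqsubseteq> bval_mem L \<eta> \<sigma>"
proof -
  have "bval_sub L \<tau> \<sigma> \<sqsubseteq> compl L (bval_mem L \<eta> \<tau>) \<squnion> bval_mem L \<eta> \<sigma>"
    unfolding bval_sub.simps[of L \<tau>]
    by (rule Inf_lower[OF bval_sub_set_in_V]) (use assms(4) in auto)
  then have "p \<sqsubseteq> compl L (bval_mem L \<eta> \<tau>) \<squnion> bval_mem L \<eta> \<sigma>"
    using le_trans[OF assms(1)] assms(3) by simp
  then have "p \<sqinter> bval_mem L \<eta> \<tau> \<sqsubseteq> bval_mem L \<eta> \<sigma>"
    using le_imp_iff[OF assms(3) bval_mem_closed bval_mem_closed] by blast
  moreover have "p \<sqsubseteq> p \<sqinter> bval_mem L \<eta> \<tau>" using assms by (intro meet_le) simp_all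
  ultimately show ?thesis using le_trans[of p "p \<sqinter> bval_mem L \<eta> \<tau>"] assms(3) by simp
qed

lemma bval_eq_commute: "bval_eq L \<tau> \<sigma> = bval_eq L \<sigma> \<tau>"
  unfolding bval_eq.simps[of L] by (rule meet_comm)

lemma le_bval_eq_refl: "p \<in> carrier L \<Longrightarrow> p \<sqsubseteq> bval_eq L \<tau> \<tau>"
  by (simp add: le_bval_eq_iff le_bval_subI)

lemma bval_eq_refl: "bval_eq L \<tau> \<tau> = \<top>"
  by (rule top_eq) (simp_all add: le_bval_eq_refl)

lemma le_bval_mem_ndom:
  assumes "vpair \<eta> b \<in>\<^sub>V \<tau>" "bname L \<tau>" "p \<in> carrier L" "p \<sqsubseteq> b"
  shows "p \<sqsubseteq> bval_mem L \<eta> \<tau>"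
  using assms bname_pairD[OF assms(2,1)] by (intro le_bval_memI[OF assms(1)]) (simp_all add: le_bval_eq_refl)

text \<open>The substitution properties of membership need transitivity of equality only for members of the
  domains involved. In this form they can be used within the induction that proves transitivity.\<close>

lemma le_bval_mem_left_step:
  assumes "bname L \<tau>" "p \<in> carrier L" "p \<sqsubseteq> bval_eq L \<eta>' \<eta>" "p \<sqsubseteq> bval_mem L \<eta> \<tau>"
    and trans: "\<And>\<zeta> q. \<zeta> \<in> ndom \<tau> \<Longrightarrow> q \<in> carrier L \<Longrightarrow> q \<sqsubseteq> bval_eq L \<eta>' \<eta> \<Longrightarrow> q \<sqsubseteq> bval_eq L \<eta> \<zeta> \<Longrightarrow> q \<sqsubseteq> bval_eq L \<eta>' \<zeta>"
  shows "p \<sqsubseteq> bval_mem L \<eta>' \<tau>"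
proof (rule le_bval_memE[OF assms(4,1,2) bval_mem_closed])
  fix \<zeta> b q assume *: "vpair \<zeta> b \<in>\<^sub>V \<tau>" "b \<in> carrier L" "q \<in> carrier L" "q \<sqsubseteq> p"
    "q \<sqsubseteq> bval_eq L \<eta> \<zeta>" "q \<sqsubseteq> b"
  have "q \<sqsubseteq> bval_eq L \<eta>' \<eta>" using le_trans[OF *(4) assms(3)] *(3) assms(2) by simp
  moreover have "\<zeta> \<in> ndom \<tau>" using *(1) unfolding ndom_def by blast
  ultimately have "q \<sqsubseteq> bval_eq L \<eta>' \<zeta>" using trans *(3,5) by blast
  then show "q \<sqsubseteq> bval_mem L \<eta>' \<tau>" by (rule le_bval_memI[OF *(1-3) _ *(6)])
qed

lemma le_bval_mem_right_step:
  assumes "bname L \<tau>" "bname L \<sigma>" "p \<in> carrier L" "p \<sqsubseteq> bval_mem L \<eta> \<tau>" "p \<sqsubseteq> bval_eq L \<tau> \<sigma>"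
    and trans: "\<And>\<zeta> \<xi> q. \<zeta> \<in> ndom \<tau> \<Longrightarrow> \<xi> \<in> ndom \<sigma> \<Longrightarrow> q \<in> carrier L \<Longrightarrow>
      q \<sqsubseteq> bval_eq L \<eta> \<zeta> \<Longrightarrow> q \<sqsubseteq> bval_eq L \<zeta> \<xi> \<Longrightarrow> q \<sqsubseteq> bval_eq L \<eta> \<xi>"
  shows "p \<sqsubseteq> bval_mem L \<eta> \<sigma>"
proof (rule le_bval_memE[OF assms(4,1,3) bval_mem_closed])
  fix \<zeta> b q assume *: "vpair \<zeta> b \<in>\<^sub>V \<tau>" "b \<in> carrier L" "q \<in> carrier L" "q \<sqsubseteq> p"
    "q \<sqsubseteq> bval_eq L \<eta> \<zeta>" "q \<sqsubseteq> b"
  have d: "\<zeta> \<in> ndom \<tau>" using *(1) unfolding ndom_def by blast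
  have "q \<sqsubseteq> bval_eq L \<tau> \<sigma>" using le_trans[OF *(4) assms(5)] *(3) assms(3) by simp
  then have "q \<sqsubseteq> bval_sub L \<tau> \<sigma>" using le_bval_eq_iff[OF *(3)] by blast
  moreover have "q \<sqsubseteq> bval_mem L \<zeta> \<tau>" by (rule le_bval_mem_ndom[OF *(1) assms(1) *(3,6)])
  ultimately have "q \<sqsubseteq> bval_mem L \<zeta> \<sigma>" by (rule le_bval_subD[OF _ _ *(3) d])
  then show "q \<sqsubseteq> bval_mem L \<eta> \<sigma>"
    by (rule le_bval_mem_left_step[OF assms(2) *(3,5)]) (rule trans[OF d])
qed

text \<open>Both inclusions are obtained from two applications of \<open>le_bval_mem_right_step\<close>. These use transitivity
  for triples of members of the three domains, possibly several from the same one, hence the multiset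
  order.\<close>

lemma le_bval_eq_trans:
  assumes "bname L \<tau>" "bname L \<sigma>" "bname L \<rho>" "p \<in> carrier L"
    "p \<sqsubseteq> bval_eq L \<tau> \<sigma>" "p \<sqsubseteq> bval_eq L \<sigma> \<rho>"
  shows "p \<sqsubseteq> bval_eq L \<tau> \<rho>"
  using assms
proof (induction "{#\<tau>, \<sigma>, \<rho>#}" arbitrary: \<tau> \<sigma> \<rho> p rule: wf_induct_rule[OF wf_mult[OF wf_ndom]])
  case (1 \<tau> \<sigma> \<rho> p)
  note names = "1.prems"(1-3)
  have IH: "q \<sqsubseteq> bval_eq L \<eta> \<xi>"
    if "\<eta> \<in> ndom \<tau> \<union> ndom \<sigma> \<union> ndom \<rho>" "\<zeta> \<in> ndom \<tau> \<union> ndom \<sigma> \<union> ndom \<rho>" "\<xi> \<in> ndom \<tau> \<union> ndom \<sigma> \<union> ndom \<rho>"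
      "q \<in> carrier L" "q \<sqsubseteq> bval_eq L \<eta> \<zeta>" "q \<sqsubseteq> bval_eq L \<zeta> \<xi>" for \<eta> \<zeta> \<xi> q
  proof (rule "1.hyps"[OF _ _ _ _ that(4-6)])
    have "({#} + {#\<eta>, \<zeta>, \<xi>#}, {#} + {#\<tau>, \<sigma>, \<rho>#}) \<in> mult {(\<eta>, \<tau>). \<eta> \<in> ndom \<tau>}"
      by (rule one_step_implies_mult) (use that(1-3) in auto)
    then show "({#\<eta>, \<zeta>, \<xi>#}, {#\<tau>, \<sigma>, \<rho>#}) \<in> mult {(\<eta>, \<tau>). \<eta> \<in> ndom \<tau>}" by simp
    show "bname L \<eta>" "bname L \<zeta>" "bname L \<xi>" using that(1-3) names bname_ndom[of \<tau>] bname_ndom[of \<sigma>] bname_ndom[of \<rho>] by auto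
  qed
  have sub: "p \<sqsubseteq> bval_sub L \<alpha> \<gamma>"
    if "bname L \<alpha>" "bname L \<beta>" "bname L \<gamma>" "p \<sqsubseteq> bval_eq L \<alpha> \<beta>" "p \<sqsubseteq> bval_eq L \<beta> \<gamma>"
      "ndom \<alpha> \<union> ndom \<beta> \<union> ndom \<gamma> \<subseteq> ndom \<tau> \<union> ndom \<sigma> \<union> ndom \<rho>" for \<alpha> \<beta> \<gamma>
  proof (rule le_bval_subI[OF "1.prems"(4)])
    fix \<eta> q assume *: "\<eta> \<in> ndom \<alpha>" "q \<in> carrier L" "q \<sqsubseteq> p" "q \<sqsubseteq> bval_mem L \<eta> \<alpha>"
    have q: "q \<sqsubseteq> bval_eq L \<alpha> \<beta>" "q \<sqsubseteq> bval_eq L \<beta> \<gamma>"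
      using le_trans[OF *(3) that(4)] le_trans[OF *(3) that(5)] *(2) "1.prems"(4) by simp_all
    have \<beta>: "q \<sqsubseteq> bval_mem L \<eta> \<beta>"
      by (rule le_bval_mem_right_step[OF that(1,2) *(2,4) q(1)], rule IH) (use * that(6) in auto)
    show "q \<sqsubseteq> bval_mem L \<eta> \<gamma>"
      by (rule le_bval_mem_right_step[OF that(2,3) *(2) \<beta> q(2)], rule IH) (use * that(6) in auto)
  qed
  have "p \<sqsubseteq> bval_sub L \<tau> \<rho>" by (rule sub[OF names "1.prems"(5,6)]) blast
  moreover have "p \<sqsubseteq> bval_sub L \<rho> \<tau>"
    using sub[OF names(3,2,1)] "1.prems"(5,6) unfolding bval_eq_commute[of \<rho> \<sigma>] bval_eq_commute[of \<sigma> \<tau>] by blast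
  ultimately show ?case using le_bval_eq_iff[OF "1.prems"(4)] by blast
qed

lemma le_bval_mem_subst:
  assumes "bname L \<tau>" "bname L \<tau>'" "bname L \<sigma>" "bname L \<sigma>'" "p \<in> carrier L"
    "p \<sqsubseteq> bval_eq L \<tau> \<tau>'" "p \<sqsubseteq> bval_eq L \<sigma> \<sigma>'" "p \<sqsubseteq> bval_mem L \<tau> \<sigma>"
  shows "p \<sqsubseteq> bval_mem L \<tau>' \<sigma>'"
proof -
  have "p \<sqsubseteq> bval_mem L \<tau>' \<sigma>"
  proof (rule le_bval_mem_left_step[OF assms(3,5) _ assms(8)])
    show "p \<sqsubseteq> bval_eq L \<tau>' \<tau>" using assms(6) unfolding bval_eq_commute[of \<tau>' \<tau>] .
  qed (rule le_bval_eq_trans[OF assms(2,1) bname_ndom[OF assms(3)]])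
  then show ?thesis
    by (rule le_bval_mem_right_step[OF assms(3,4,5) _ assms(7)])
       (rule le_bval_eq_trans[OF assms(2) bname_ndom[OF assms(3)] bname_ndom[OF assms(4)]])
qed

lemma le_bval_eq_subst:
  assumes "bname L \<tau>" "bname L \<tau>'" "bname L \<sigma>" "bname L \<sigma>'" "p \<in> carrier L"
    "p \<sqsubseteq> bval_eq L \<tau> \<tau>'" "p \<sqsubseteq> bval_eq L \<sigma> \<sigma>'" "p \<sqsubseteq> bval_eq L \<tau> \<sigma>"
  shows "p \<sqsubseteq> bval_eq L \<tau>' \<sigma>'"
proof (rule le_bval_eq_trans[OF assms(2,3,4,5) _ assms(7)])
  have "p \<sqsubseteq> bval_eq L \<tau>' \<tau>" using assms(6) unfolding bval_eq_commute[of \<tau>' \<tau>] .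
  then show "p \<sqsubseteq> bval_eq L \<tau>' \<sigma>" by (rule le_bval_eq_trans[OF assms(2,1,3,5) _ assms(8)])
qed

lemma le_bval_mem_checkE:
  assumes "p \<sqsubseteq> bval_mem L \<tau> (check L x)" "p \<in> carrier L" "z \<in> carrier L"
    and "\<And>y q. y \<in> elts x \<Longrightarrow> q \<in> carrier L \<Longrightarrow> q \<sqsubseteq> p \<Longrightarrow> q \<sqsubseteq> bval_eq L \<tau> (check L y) \<Longrightarrow> q \<sqsubseteq> z"
  shows "p \<sqsubseteq> z"
  by (rule le_bval_memE[OF assms(1) bname_check assms(2,3)]) (auto simp: vpair_mem_check intro: assms(4))

lemma le_bval_mem_checkI:
  assumes "y \<in> elts x" "p \<in> carrier L" "p \<sqsubseteq> bval_eq L \<tau> (check L y)"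
  shows "p \<sqsubseteq> bval_mem L \<tau> (check L x)"
  by (rule le_bval_memI[of "check L y" \<top>]) (use assms in \<open>auto simp: vpair_mem_check\<close>)

text \<open>Distinct sets differ in an element \<open>z\<close>, say \<open>z \<in> x\<close> and \<open>z \<notin> y\<close>. Then \<open>p\<close> is below the value of \<open>z \<in> y\<close>,
  that is, below the join of the values \<open>[z = w]\<close> with \<open>w \<in> y\<close>, which vanish by induction.\<close>

lemma bval_eq_check_distinct:
  assumes "x \<noteq> y" "p \<in> carrier L" "p \<sqsubseteq> bval_eq L (check L x) (check L y)"
  shows "p \<sqsubseteq> \<bottom>"
  using wellfounded assms
proof (induction x arbitrary: y p rule: wfp_induct_rule)
  case (less x)
  note p = \<open>p \<in> carrier L\<close>
  have sub: "p \<sqsubseteq> bval_sub L (check L x) (check L y)" "p \<sqsubseteq> bval_sub L (check L y) (check L x)"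
    using less.prems(3) unfolding le_bval_eq_iff[OF p] by simp_all
  have "elts x \<noteq> elts y" using less.prems(1) by (simp add: elts_inject)
  then consider z where "z \<in> elts x" "z \<notin> elts y" | z where "z \<in> elts y" "z \<notin> elts x" by blast
  then show ?case
  proof cases
    case 1
    have "p \<sqsubseteq> bval_mem L (check L z) (check L x)"
      by (rule le_bval_mem_checkI[OF 1(1) p]) (rule le_bval_eq_refl[OF p])
    then have "p \<sqsubseteq> bval_mem L (check L z) (check L y)"
      by (rule le_bval_subD[OF sub(1) _ p]) (use 1 in \<open>simp add: ndom_check\<close>)
    then show ?thesis
    proof (rule le_bval_mem_checkE[OF _ p bottom_closed])
      fix w q assume *: "w \<in> elts y" "q \<in> carrier L" "q \<sqsubseteq> bval_eq L (check L z) (check L w)"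
      show "q \<sqsubseteq> \<bottom>" by (rule less.IH[OF _ _ *(2,3)]) (use 1 * in \<open>auto simp: elts_def\<close>)
    qed
  next
    case 2
    have "p \<sqsubseteq> bval_mem L (check L z) (check L y)"
      by (rule le_bval_mem_checkI[OF 2(1) p]) (rule le_bval_eq_refl[OF p])
    then have "p \<sqsubseteq> bval_mem L (check L z) (check L x)"
      by (rule le_bval_subD[OF sub(2) _ p]) (use 2 in \<open>simp add: ndom_check\<close>)
    then show ?thesis
    proof (rule le_bval_mem_checkE[OF _ p bottom_closed])
      fix w q assume *: "w \<in> elts x" "q \<in> carrier L" "q \<sqsubseteq> bval_eq L (check L z) (check L w)"
      show "q \<sqsubseteq> \<bottom>"
        by (rule less.IH[OF _ _ *(2) *(3)[unfolded bval_eq_commute[of "check L z"]]])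
           (use 2 * in \<open>auto simp: elts_def\<close>)
    qed
  qed
qed

lemma bval_mem_check_notin:
  assumes "x \<notin> elts y" "p \<in> carrier L" "p \<sqsubseteq> bval_mem L (check L x) (check L y)"
  shows "p \<sqsubseteq> \<bottom>"
proof (rule le_bval_mem_checkE[OF assms(3,2) bottom_closed])
  fix z q assume "z \<in> elts y" "q \<in> carrier L" "q \<sqsubseteq> bval_eq L (check L x) (check L z)"
  then show "q \<sqsubseteq> \<bottom>" using assms(1) by (intro bval_eq_check_distinct[of x z]) auto
qed

end

section \<open>Ultrafilters on power sets and classical ultrapowers\<close>

lemma Int_in_V: "elts X \<inter> elts Y \<in> range elts"
proof -
  have "{x \<in> elts X. x \<in> elts Y} \<in> range elts"
    by (rule in_range_elts_Collect) (simp, intro definable_fun_intros)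
  then show ?thesis by (simp add: Int_def)
qed

lemma Diff_in_V: "elts X - elts Y \<in> range elts"
proof -
  have "{x \<in> elts X. \<not> x \<in> elts Y} \<in> range elts"
    by (rule in_range_elts_Collect) (simp, intro definable_fun_intros)
  then show ?thesis by (simp add: set_diff_eq)
qed

lemma Un_in_V: "elts X \<union> elts Y \<in> range elts"
  by (rule definable_set_in_V[where e = undefined]) (intro definable_fun_intros)

lemma empty_in_V: "{} \<in> range elts"
  by (rule definable_set_in_V[where e = undefined]) (rule definable_set_empty)

lemma meet_powerset_algebra:
  assumes "elts X \<subseteq> elts Z" "elts Y \<subseteq> elts Z"
  shows "X \<sqinter>\<^bsub>powerset_algebra Z\<^esub> Y = vset (elts X \<inter> elts Y)"
  unfolding meet_def inf_def
proof (rule some_equality)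
  let ?L = "Lower (powerset_algebra Z) {X, Y}"
  have L: "?L = {W. elts W \<subseteq> elts X \<inter> elts Y}"
    using assms unfolding Lower_def powerset_algebra_def by auto
  show "greatest (powerset_algebra Z) (vset (elts X \<inter> elts Y)) ?L"
    unfolding greatest_def L using assms
    by (auto simp: powerset_algebra_def elts_vset[OF Int_in_V])
  fix M assume M: "greatest (powerset_algebra Z) M ?L"
  have "vset (elts X \<inter> elts Y) \<in> {W. elts W \<subseteq> elts X \<inter> elts Y}"
    by (simp add: elts_vset[OF Int_in_V])
  then have "M \<in> {W. elts W \<subseteq> elts X \<inter> elts Y}" "vset (elts X \<inter> elts Y) \<sqsubseteq>\<^bsub>powerset_algebra Z\<^esub> M"
    using M unfolding greatest_def L by blast+
  then have "elts M = elts X \<inter> elts Y"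
    by (auto simp: powerset_algebra_def elts_vset[OF Int_in_V])
  then show "M = vset (elts X \<inter> elts Y)" by (simp add: vset_eqI)
qed

lemma join_powerset_algebra:
  assumes "elts X \<subseteq> elts Z" "elts Y \<subseteq> elts Z"
  shows "X \<squnion>\<^bsub>powerset_algebra Z\<^esub> Y = vset (elts X \<union> elts Y)"
  unfolding join_def sup_def
proof (rule some_equality)
  let ?U = "Upper (powerset_algebra Z) {X, Y}"
  have U: "?U = {W. elts X \<union> elts Y \<subseteq> elts W \<and> elts W \<subseteq> elts Z}"
    using assms unfolding Upper_def powerset_algebra_def by auto
  show "least (powerset_algebra Z) (vset (elts X \<union> elts Y)) ?U"
    unfolding least_def U using assms
    by (auto simp: powerset_algebra_def elts_vset[OF Un_in_V])
  fix M assume M: "least (powerset_algebra Z) M ?U"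
  have "vset (elts X \<union> elts Y) \<in> {W. elts X \<union> elts Y \<subseteq> elts W \<and> elts W \<subseteq> elts Z}"
    using assms by (simp add: elts_vset[OF Un_in_V])
  then have "M \<in> {W. elts X \<union> elts Y \<subseteq> elts W \<and> elts W \<subseteq> elts Z}"
      "M \<sqsubseteq>\<^bsub>powerset_algebra Z\<^esub> vset (elts X \<union> elts Y)"
    using M unfolding least_def U by blast+
  then have "elts M = elts X \<union> elts Y"
    by (auto simp: powerset_algebra_def elts_vset[OF Un_in_V])
  then show "M = vset (elts X \<union> elts Y)" by (simp add: vset_eqI)
qed

lemma top_powerset_algebra: "\<top>\<^bsub>powerset_algebra Z\<^esub> = Z"
  unfolding top_def
proof (rule some_equality)
  show "greatest (powerset_algebra Z) Z (carrier (powerset_algebra Z))"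
    by (simp add: greatest_def powerset_algebra_def)
  fix M assume "greatest (powerset_algebra Z) M (carrier (powerset_algebra Z))"
  then have "elts M = elts Z" by (auto simp: greatest_def powerset_algebra_def)
  then show "M = Z" by (simp add: elts_inject)
qed

lemma bottom_powerset_algebra: "\<bottom>\<^bsub>powerset_algebra Z\<^esub> = vset {}"
  unfolding bottom_def
proof (rule some_equality)
  show "least (powerset_algebra Z) (vset {}) (carrier (powerset_algebra Z))"
    by (simp add: least_def powerset_algebra_def elts_vset[OF empty_in_V])
  fix M assume M: "least (powerset_algebra Z) M (carrier (powerset_algebra Z))"
  have "vset {} \<in> carrier (powerset_algebra Z)"
    by (simp add: powerset_algebra_def elts_vset[OF empty_in_V])
  then have "M \<sqsubseteq>\<^bsub>powerset_algebra Z\<^esub> vset {}" using M unfolding least_def by blast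
  then have "elts M = {}" by (simp add: powerset_algebra_def elts_vset[OF empty_in_V])
  then show "M = vset {}" by (simp add: vset_eqI)
qed

lemma compl_powerset_algebra:
  assumes "elts X \<subseteq> elts Z"
  shows "compl (powerset_algebra Z) X = vset (elts Z - elts X)"
  unfolding compl_def
proof (rule the_equality)
  have c: "elts (vset (elts Z - elts X)) = elts Z - elts X" by (rule elts_vset[OF Diff_in_V])
  have u: "elts X \<union> elts Z = elts Z" using assms by blast
  show "vset (elts Z - elts X) \<in> carrier (powerset_algebra Z) \<and>
    X \<sqinter>\<^bsub>powerset_algebra Z\<^esub> vset (elts Z - elts X) = \<bottom>\<^bsub>powerset_algebra Z\<^esub> \<and>
    X \<squnion>\<^bsub>powerset_algebra Z\<^esub> vset (elts Z - elts X) = \<top>\<^bsub>powerset_algebra Z\<^esub>"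
    using meet_powerset_algebra[OF assms, of "vset (elts Z - elts X)"]
      join_powerset_algebra[OF assms, of "vset (elts Z - elts X)"]
    by (simp add: c u top_powerset_algebra bottom_powerset_algebra vset_eqI)
       (auto simp: powerset_algebra_def c)
next
  fix Y assume Y: "Y \<in> carrier (powerset_algebra Z) \<and>
    X \<sqinter>\<^bsub>powerset_algebra Z\<^esub> Y = \<bottom>\<^bsub>powerset_algebra Z\<^esub> \<and> X \<squnion>\<^bsub>powerset_algebra Z\<^esub> Y = \<top>\<^bsub>powerset_algebra Z\<^esub>"
  then have "elts Y \<subseteq> elts Z" by (simp add: powerset_algebra_def)
  with Y have Y: "elts Y \<subseteq> elts Z" "vset (elts X \<inter> elts Y) = vset {}" "vset (elts X \<union> elts Y) = Z"
    using meet_powerset_algebra[OF assms, of Y] join_powerset_algebra[OF assms, of Y]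
    by (simp_all add: top_powerset_algebra bottom_powerset_algebra)
  have "elts X \<inter> elts Y = {}" using Y(2) elts_vset[OF Int_in_V] elts_vset[OF empty_in_V] by metis
  moreover have "elts X \<union> elts Y = elts Z" using Y(3) elts_vset[OF Un_in_V] by metis
  ultimately have "elts Y = elts Z - elts X" by auto
  then show "Y = vset (elts Z - elts X)" by (simp add: vset_eqI)
qed

lemma ultrafilter_powerset_algebra_iff:
  "ultrafilter (powerset_algebra Z) W \<longleftrightarrow>
     W \<subseteq> {X. elts X \<subseteq> elts Z} \<and> Z \<in> W \<and> vset {} \<notin> W \<and>
     (\<forall>X\<in>W. \<forall>Y\<in>W. vset (elts X \<inter> elts Y) \<in> W) \<and>
     (\<forall>X\<in>W. \<forall>Y. elts Y \<subseteq> elts Z \<longrightarrow> elts X \<subseteq> elts Y \<longrightarrow> Y \<in> W) \<and>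
     (\<forall>X. elts X \<subseteq> elts Z \<longrightarrow> X \<in> W \<or> vset (elts Z - elts X) \<in> W)"
proof -
  have c: "carrier (powerset_algebra Z) = {X. elts X \<subseteq> elts Z}" by (simp add: powerset_algebra_def)
  have le: "X \<sqsubseteq>\<^bsub>powerset_algebra Z\<^esub> Y \<longleftrightarrow> elts X \<subseteq> elts Y" for X Y by (simp add: powerset_algebra_def)
  show ?thesis
  proof (cases "W \<subseteq> {X. elts X \<subseteq> elts Z}")
    case True
    then have m: "X \<sqinter>\<^bsub>powerset_algebra Z\<^esub> Y = vset (elts X \<inter> elts Y)" if "X \<in> W" "Y \<in> W" for X Y
      using that by (intro meet_powerset_algebra) auto
    show ?thesis unfolding ultrafilter_def c le top_powerset_algebra bottom_powerset_algebra
      using True by (simp add: m compl_powerset_algebra)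
  qed (auto simp: ultrafilter_def c)
qed

text \<open>In this form the filter properties apply directly to sets of indices given by comprehension.\<close>

lemma ultrafilter_powerset_mono:
  assumes "ultrafilter (powerset_algebra Z) W" "vset A \<in> W" "vset B \<in> W" "A \<inter> B \<subseteq> C" "C \<subseteq> elts Z"
    "A \<in> range elts" "B \<in> range elts" "C \<in> range elts"
  shows "vset C \<in> W"
proof -
  have "vset (elts (vset A) \<inter> elts (vset B)) \<in> W"
    using assms(1-3) unfolding ultrafilter_powerset_algebra_iff by blast
  then have 1: "vset (A \<inter> B) \<in> W" using assms(6,7) by (simp add: elts_vset)
  have "A \<inter> B \<in> range elts" using Int_in_V[of "vset A" "vset B"] assms(6,7) by (simp add: elts_vset)
  then have "elts (vset (A \<inter> B)) \<subseteq> elts (vset C)" "elts (vset C) \<subseteq> elts Z"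
    using assms by (simp_all add: elts_vset)
  then show ?thesis using 1 assms(1) unfolding ultrafilter_powerset_algebra_iff by blast
qed

lemma vfun_Collect_in_V:
  assumes "vfun Z f" "vfun Z g" "definable (\<lambda>e. q (app f (e 0)) (app g (e 0)))"
  shows "{z \<in> elts Z. q (vapp f z) (vapp g z)} \<in> range elts"
proof -
  have "{z \<in> elts Z. q (app f z) (app g z)} \<in> range elts"
    by (rule in_range_elts_Collect) (use assms(3) in simp_all)
  moreover have "{z \<in> elts Z. q (app f z) (app g z)} = {z \<in> elts Z. q (vapp f z) (vapp g z)}"
    using vapp_eq_app[OF assms(1)] vapp_eq_app[OF assms(2)] by auto
  ultimately show ?thesis by simp
qed

lemma vfun_eq_in_V: "vfun Z f \<Longrightarrow> vfun Z g \<Longrightarrow> {z \<in> elts Z. vapp f z = vapp g z} \<in> range elts"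
  by (rule vfun_Collect_in_V) (assumption+, intro definable_fun_intros)

lemma vfun_mem_in_V: "vfun Z f \<Longrightarrow> vfun Z g \<Longrightarrow> {z \<in> elts Z. vapp f z \<in>\<^sub>V vapp g z} \<in> range elts"
  by (rule vfun_Collect_in_V) (assumption+, intro definable_fun_intros)

lemma vset_elts [simp]: "vset (elts x) = x"
  by (rule vset_eqI) (rule refl)

lemma fun_class_eq_iff:
  assumes W: "ultrafilter (powerset_algebra Z) W" and f: "vfun Z f" and g: "vfun Z g"
  shows "fun_class Z W f = fun_class Z W g \<longleftrightarrow> vset {z \<in> elts Z. vapp f z = vapp g z} \<in> W"
proof
  have Z: "Z \<in> W" using W unfolding ultrafilter_powerset_algebra_iff by blast
  assume eq: "fun_class Z W f = fun_class Z W g"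
  have "g \<in> fun_class Z W g" unfolding fun_class_def using g Z by simp
  then show "vset {z \<in> elts Z. vapp f z = vapp g z} \<in> W"
    unfolding eq[symmetric] by (simp add: fun_class_def)
next
  assume fg: "vset {z \<in> elts Z. vapp f z = vapp g z} \<in> W"
  have "vset {z \<in> elts Z. vapp g z = vapp h z} \<in> W \<longleftrightarrow> vset {z \<in> elts Z. vapp f z = vapp h z} \<in> W"
    if h: "vfun Z h" for h
  proof
    assume "vset {z \<in> elts Z. vapp g z = vapp h z} \<in> W"
    then show "vset {z \<in> elts Z. vapp f z = vapp h z} \<in> W"
      by (rule ultrafilter_powerset_mono[OF W fg]) (intro vfun_eq_in_V f g h | auto)+
  next
    assume "vset {z \<in> elts Z. vapp f z = vapp h z} \<in> W"
    then show "vset {z \<in> elts Z. vapp g z = vapp h z} \<in> W"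
      by (rule ultrafilter_powerset_mono[OF W fg]) (intro vfun_eq_in_V f g h | auto)+
  qed
  then show "fun_class Z W f = fun_class Z W g" unfolding fun_class_def by auto
qed

lemma ultrapower_mem_iff:
  assumes W: "ultrafilter (powerset_algebra Z) W" and f: "vfun Z f" and g: "vfun Z g"
  shows "ultrapower_mem Z W (fun_class Z W f) (fun_class Z W g) \<longleftrightarrow>
    vset {z \<in> elts Z. vapp f z \<in>\<^sub>V vapp g z} \<in> W"
proof
  have Z: "Z \<in> W" using W unfolding ultrafilter_powerset_algebra_iff by blast
  assume "vset {z \<in> elts Z. vapp f z \<in>\<^sub>V vapp g z} \<in> W"
  moreover have "f \<in> fun_class Z W f" "g \<in> fun_class Z W g"
    unfolding fun_class_def using f g Z by simp_all
  ultimately show "ultrapower_mem Z W (fun_class Z W f) (fun_class Z W g)"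
    unfolding ultrapower_mem_def by blast
next
  assume "ultrapower_mem Z W (fun_class Z W f) (fun_class Z W g)"
  then obtain f' g' where f': "vfun Z f'" "vset {z \<in> elts Z. vapp f z = vapp f' z} \<in> W"
    and g': "vfun Z g'" "vset {z \<in> elts Z. vapp g z = vapp g' z} \<in> W"
    and fg': "vset {z \<in> elts Z. vapp f' z \<in>\<^sub>V vapp g' z} \<in> W"
    unfolding ultrapower_mem_def fun_class_def by blast
  have "vset {z \<in> elts Z. vapp f z \<in>\<^sub>V vapp g' z} \<in> W"
    by (rule ultrafilter_powerset_mono[OF W f'(2) fg'])
       (auto intro!: vfun_eq_in_V vfun_mem_in_V f f' g')
  then show "vset {z \<in> elts Z. vapp f z \<in>\<^sub>V vapp g z} \<in> W"
    by (rule ultrafilter_powerset_mono[OF W g'(2)])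
       (auto intro!: vfun_eq_in_V vfun_mem_in_V f g g')
qed

text \<open>An isomorphism between two structures of equivalence classes can be given by a relation between the
  representatives. It has to be total and surjective and to respect equality of classes in both
  directions, which provides well-definedness and injectivity at once.\<close>

lemma isomorphic_embeddings_by_relation:
  assumes left: "\<And>p. p \<in> P \<Longrightarrow> \<exists>q\<in>Q. R p q" and right: "\<And>q. q \<in> Q \<Longrightarrow> \<exists>p\<in>P. R p q"
    and eq: "\<And>p q p' q'. p \<in> P \<Longrightarrow> q \<in> Q \<Longrightarrow> p' \<in> P \<Longrightarrow> q' \<in> Q \<Longrightarrow> R p q \<Longrightarrow> R p' q' \<Longrightarrow>
      f p = f p' \<longleftrightarrow> g q = g q'"
    and mem: "\<And>p q p' q'. p \<in> P \<Longrightarrow> q \<in> Q \<Longrightarrow> p' \<in> P \<Longrightarrow> q' \<in> Q \<Longrightarrow> R p q \<Longrightarrow> R p' q' \<Longrightarrow>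
      E (f p) (f p') \<longleftrightarrow> F (g q) (g q')"
    and emb: "\<And>x. \<exists>p\<in>P. \<exists>q\<in>Q. R p q \<and> j x = f p \<and> k x = g q"
  shows "isomorphic_embeddings (f ` P) E j (g ` Q) F k"
proof -
  define \<pi> where "\<pi> X = g (SOME q. q \<in> Q \<and> (\<exists>p\<in>P. R p q \<and> X = f p))" for X
  have \<pi>: "\<pi> (f p) = g q" if "p \<in> P" "q \<in> Q" "R p q" for p q
  proof -
    let ?q = "SOME q. q \<in> Q \<and> (\<exists>p'\<in>P. R p' q \<and> f p = f p')"
    have "?q \<in> Q \<and> (\<exists>p'\<in>P. R p' ?q \<and> f p = f p')"
      by (rule someI[of _ q]) (use that in blast)
    then obtain p' where "?q \<in> Q" "p' \<in> P" "R p' ?q" "f p = f p'" by blast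
    then have "g q = g ?q" using eq[of p q p' ?q] that by simp
    then show ?thesis unfolding \<pi>_def by simp
  qed
  have "inj_on \<pi> (f ` P)"
  proof (rule inj_onI, clarify)
    fix p p' assume *: "p \<in> P" "p' \<in> P" "\<pi> (f p) = \<pi> (f p')"
    obtain q where q: "q \<in> Q" "R p q" using left[OF *(1)] by blast
    obtain q' where q': "q' \<in> Q" "R p' q'" using left[OF *(2)] by blast
    show "f p = f p'" using * q q' \<pi>[of p q] \<pi>[of p' q'] eq[of p q p' q'] by simp
  qed
  moreover have "\<pi> ` f ` P = g ` Q"
  proof
    show "\<pi> ` f ` P \<subseteq> g ` Q"
    proof clarify
      fix p assume p: "p \<in> P"
      then obtain q where "q \<in> Q" "R p q" using left by blast
      then show "\<pi> (f p) \<in> g ` Q" using \<pi>[OF p] by simp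
    qed
    show "g ` Q \<subseteq> \<pi> ` f ` P"
    proof clarify
      fix q assume q: "q \<in> Q"
      then obtain p where "p \<in> P" "R p q" using right by blast
      then show "g q \<in> \<pi> ` f ` P" using \<pi>[OF _ q, of p] by (metis imageI)
    qed
  qed
  moreover have "E X Y \<longleftrightarrow> F (\<pi> X) (\<pi> Y)" if XY: "X \<in> f ` P" "Y \<in> f ` P" for X Y
  proof -
    obtain p p' where p: "p \<in> P" "p' \<in> P" "X = f p" "Y = f p'" using XY by blast
    obtain q where q: "q \<in> Q" "R p q" using left[OF p(1)] by blast
    obtain q' where q': "q' \<in> Q" "R p' q'" using left[OF p(2)] by blast
    show ?thesis using p q q' \<pi>[of p q] \<pi>[of p' q'] mem[of p q p' q'] by simp
  qed
  moreover have "\<pi> (j x) = k x" for x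
  proof -
    obtain p q where "p \<in> P" "q \<in> Q" "R p q" "j x = f p" "k x = g q" using emb[of x] by blast
    then show ?thesis using \<pi>[of p q] by simp
  qed
  ultimately show ?thesis
    unfolding isomorphic_embeddings_def bij_betw_def by blast
qed

context complete_boolean_algebra_in_V
begin

section \<open>Antichains, mixtures and agreement\<close>

lemma le_bottom_eq: "p \<sqsubseteq> \<bottom> \<Longrightarrow> p \<in> carrier L \<Longrightarrow> p = \<bottom>"
  by (intro le_antisym) simp_all

lemma le_compl_disjoint:
  assumes "p \<sqsubseteq> x" "p \<sqsubseteq> compl L x" "p \<in> carrier L" "x \<in> carrier L" shows "p \<sqsubseteq> \<bottom>"
  using meet_le[OF assms(1,2)] assms by (simp add: meet_compl compl_closed)

lemma le_compl_cases:
  assumes "p \<in> carrier L" "x \<in> carrier L" "z \<in> carrier L"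
    and "\<And>q. q \<in> carrier L \<Longrightarrow> q \<sqsubseteq> p \<Longrightarrow> q \<sqsubseteq> x \<Longrightarrow> q \<sqsubseteq> z"
    and "\<And>q. q \<in> carrier L \<Longrightarrow> q \<sqsubseteq> p \<Longrightarrow> q \<sqsubseteq> compl L x \<Longrightarrow> q \<sqsubseteq> z"
  shows "p \<sqsubseteq> z"
proof (rule le_Sup_cases[OF assms(1) doubleton_in_V _ assms(3)])
  show "p \<sqsubseteq> \<Squnion> {x, compl L x}"
    using join_compl[OF assms(2)] assms(1) by (simp add: join_def)
qed (use assms in auto)

lemma antichain_disjoint:
  assumes "antichain L A" "a \<in> elts A" "b \<in> elts A" "a \<noteq> b" "p \<sqsubseteq> a" "p \<sqsubseteq> b" "p \<in> carrier L"
  shows "p \<sqsubseteq> \<bottom>"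
proof -
  have "a \<in> carrier L" "b \<in> carrier L" "a \<sqinter> b = \<bottom>" using assms unfolding antichain_def by blast+
  then show ?thesis using meet_le[OF assms(5,6)] assms(7) by simp
qed

lemma antichain_carrier: "antichain L A \<Longrightarrow> a \<in> elts A \<Longrightarrow> a \<in> carrier L"
  unfolding antichain_def by blast

lemma maximal_antichainI:
  assumes A: "antichain L A"
    and dense: "\<And>p. p \<in> carrier L \<Longrightarrow>
      (\<And>a q. a \<in> elts A \<Longrightarrow> q \<in> carrier L \<Longrightarrow> q \<sqsubseteq> p \<Longrightarrow> q \<sqsubseteq> a \<Longrightarrow> q \<sqsubseteq> \<bottom>) \<Longrightarrow> p \<sqsubseteq> \<bottom>"
  shows "maximal_antichain L A"
  unfolding maximal_antichain_def
proof (intro conjI A allI impI)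
  fix D assume D: "antichain L D \<and> elts A \<subseteq> elts D"
  have "d \<in> elts A" if d: "d \<in> elts D" for d
  proof (rule ccontr)
    assume n: "d \<notin> elts A"
    have c: "d \<in> carrier L" using D d antichain_carrier by blast
    have "d \<sqsubseteq> \<bottom>"
    proof (rule dense[OF c])
      fix a q assume "a \<in> elts A" "q \<in> carrier L" "q \<sqsubseteq> d" "q \<sqsubseteq> a"
      then show "q \<sqsubseteq> \<bottom>" using D d n by (intro antichain_disjoint[of D d a q]) auto
    qed
    then have "d = \<bottom>" using c by (rule le_bottom_eq)
    then show False using D d unfolding antichain_def by blast
  qed
  then have "elts D = elts A" using D by blast
  then show "D = A" by (simp add: elts_inject)
qed

text \<open>Otherwise the complement of the join could be added to the antichain.\<close>

lemma Sup_maximal_antichain: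
  assumes "maximal_antichain L A" shows "\<Squnion> (elts A) = \<top>"
proof -
  let ?s = "\<Squnion> (elts A)" and ?c = "compl L (\<Squnion> (elts A))"
  have A: "antichain L A" using assms unfolding maximal_antichain_def by blast
  have s: "?s \<in> carrier L" by (rule Sup_closed) simp
  have c: "?c \<in> carrier L" by (rule compl_closed[OF s])
  have upper: "a \<sqsubseteq> ?s" if "a \<in> elts A" for a
    using that by (intro Sup_upper) (simp_all add: antichain_carrier[OF A])
  have "?c = \<bottom>"
  proof (rule ccontr)
    assume nz: "?c \<noteq> \<bottom>"
    have "insert ?c (elts A) \<in> range elts"
      by (rule definable_set_in_V[where e = undefined]) (intro definable_fun_intros)
    then obtain D where D: "elts D = insert ?c (elts A)" by auto
    have disj: "a \<sqinter> ?c = \<bottom>" "?c \<sqinter> a = \<bottom>" if a: "a \<in> elts A" for a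
    proof -
      have ac: "a \<in> carrier L" using a by (rule antichain_carrier[OF A])
      have "a \<sqinter> ?c \<sqsubseteq> \<bottom>"
        by (rule le_compl_disjoint[OF _ _ _ s])
           (use ac c s le_trans[OF meet_left upper[OF a]] meet_right in auto)
      then show "a \<sqinter> ?c = \<bottom>" by (rule le_bottom_eq) simp
      then show "?c \<sqinter> a = \<bottom>" using meet_comm[of L a ?c] by simp
    qed
    have "antichain L D"
      using A c nz disj unfolding antichain_def D by auto
    then have "D = A" using assms D unfolding maximal_antichain_def by auto
    then have "?c \<in> elts A" using D by blast
    then have "?c \<sqsubseteq> \<bottom>" using upper c s by (intro le_compl_disjoint[OF _ _ c s]) auto
    then show False using nz le_bottom_eq[OF _ c] by blast
  qed
  then have "?s \<squnion> \<bottom> = \<top>" using join_compl[OF s] by simp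
  moreover have "?s \<squnion> \<bottom> \<sqsubseteq> ?s" by (rule join_le) (simp_all add: s)
  ultimately show ?thesis using s by (intro le_antisym) simp_all
qed

text \<open>Case distinction along a maximal antichain; \<open>maximal_antichainI\<close> is the converse.\<close>

lemma le_antichain_cases:
  assumes A: "maximal_antichain L A" and "p \<in> carrier L" "z \<in> carrier L"
    and "\<And>a q. a \<in> elts A \<Longrightarrow> q \<in> carrier L \<Longrightarrow> q \<sqsubseteq> p \<Longrightarrow> q \<sqsubseteq> a \<Longrightarrow> q \<sqsubseteq> z"
  shows "p \<sqsubseteq> z"
proof (rule le_Sup_cases[OF assms(2) _ _ assms(3)])
  show "elts A \<in> range elts" by simp
  show "p \<sqsubseteq> \<Squnion> (elts A)" unfolding Sup_maximal_antichain[OF A] using assms(2) by simp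
qed (rule assms(4))

text \<open>The name that has value \<open>F a\<close> on each \<open>a\<close>: a set \<open>y\<close> belongs to it with value \<open>\<Squnion>{a. y \<in> F a}\<close>.\<close>

definition mixture where
  "mixture A F = vset (\<Union>a\<in>elts A. (\<lambda>y. vpair (check L y) a) ` elts (F a))"

context
  fixes A :: 'v and F :: "'v \<Rightarrow> 'v"
  assumes antichain: "antichain L A" and F: "definable_term (\<lambda>e. F (e 0))"
begin

lemma vpair_mem_mixture:
  "p \<in>\<^sub>V mixture A F \<longleftrightarrow> (\<exists>a\<in>elts A. \<exists>y\<in>elts (F a). p = vpair (check L y) a)"
proof -
  have "(\<Union>a\<in>elts A. (\<lambda>y. vpair (check L y) a) ` elts (F a)) \<in> range elts"
    by (rule definable_set_in_V[where e = undefined])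
       (intro definable_fun_intros definable_term_check definable_term_app1[OF F])
  then have "elts (mixture A F) = (\<Union>a\<in>elts A. (\<lambda>y. vpair (check L y) a) ` elts (F a))"
    unfolding mixture_def by (rule elts_vset)
  then show ?thesis unfolding elts_def[of "mixture A F"] by blast
qed

lemma bname_mixture: "bname L (mixture A F)"
proof (rule bname.intros, rule)
  fix p assume "p \<in> elts (mixture A F)"
  then obtain a y where "a \<in> elts A" "p = vpair (check L y) a"
    using vpair_mem_mixture by (auto simp: elts_def)
  then show "\<exists>\<sigma> b. p = vpair \<sigma> b \<and> bname L \<sigma> \<and> b \<in> carrier L"
    using bname_check antichain_carrier[OF antichain] by blast
qed

text \<open>Below \<open>a\<close> the other members of the antichain contribute nothing, so the mixture has the same members
  as \<open>F a\<close>.\<close>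

lemma le_bval_eq_mixture:
  assumes a: "a \<in> elts A" and p: "p \<in> carrier L" "p \<sqsubseteq> a"
  shows "p \<sqsubseteq> bval_eq L (mixture A F) (check L (F a))"
  unfolding le_bval_eq_iff[OF p(1)]
proof
  have ac: "a \<in> carrier L" by (rule antichain_carrier[OF antichain a])
  show "p \<sqsubseteq> bval_sub L (mixture A F) (check L (F a))"
  proof (rule le_bval_subI[OF p(1)])
    fix \<eta> q assume q: "q \<in> carrier L" "q \<sqsubseteq> p" "q \<sqsubseteq> bval_mem L \<eta> (mixture A F)"
    show "q \<sqsubseteq> bval_mem L \<eta> (check L (F a))"
    proof (rule le_bval_memE[OF q(3) bname_mixture q(1) bval_mem_closed])
      fix \<eta>' b r
      assume r: "vpair \<eta>' b \<in>\<^sub>V mixture A F" "r \<in> carrier L" "r \<sqsubseteq> q" "r \<sqsubseteq> bval_eq L \<eta> \<eta>'" "r \<sqsubseteq> b"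
      from r(1) obtain y where y: "b \<in> elts A" "y \<in> elts (F b)" "\<eta>' = check L y"
        unfolding vpair_mem_mixture by auto
      show "r \<sqsubseteq> bval_mem L \<eta> (check L (F a))"
      proof (cases "b = a")
        case True
        then show ?thesis using y r by (intro le_bval_mem_checkI[of y]) simp_all
      next
        case False
        have "r \<sqsubseteq> a" using le_trans[OF le_trans[OF r(3) q(2)] p(2)] r(2) q(1) p(1) ac by simp
        then have "r \<sqsubseteq> \<bottom>" by (rule antichain_disjoint[OF antichain y(1) a False r(5) _ r(2)])
        then show ?thesis using r(2) by (rule le_bottomD) simp
      qed
    qed
  qed
  show "p \<sqsubseteq> bval_sub L (check L (F a)) (mixture A F)"
  proof (rule le_bval_subI[OF p(1)])
    fix \<eta> q assume q: "\<eta> \<in> ndom (check L (F a))" "q \<in> carrier L" "q \<sqsubseteq> p"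
    then obtain y where y: "y \<in> elts (F a)" "\<eta> = check L y" unfolding ndom_check by blast
    show "q \<sqsubseteq> bval_mem L \<eta> (mixture A F)"
    proof (rule le_bval_mem_ndom[OF _ bname_mixture q(2)])
      show "vpair \<eta> a \<in>\<^sub>V mixture A F" unfolding vpair_mem_mixture using a y by blast
      show "q \<sqsubseteq> a" using le_trans[OF q(3) p(2)] q(2) p(1) ac by simp
    qed
  qed
qed

end

text \<open>The join over all of \<open>V\<close> is a join of a set of \<open>V\<close>, by separation from the carrier.\<close>

lemma bval_in_V_set_in_V: "range (\<lambda>x. bval_eq L \<tau> (check L x)) \<in> range elts"
proof -
  have "{b \<in> carrier L. \<exists>x. b = bval_eq L \<tau> (check L x)} \<in> range elts"
    by (rule definable_set_in_V[where e = undefined])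
       (intro definable_alg_intros definable_term_bval_eq definable_term_check)
  moreover have "range (\<lambda>x. bval_eq L \<tau> (check L x)) = {b \<in> carrier L. \<exists>x. b = bval_eq L \<tau> (check L x)}"
    by auto
  ultimately show ?thesis by simp
qed

lemma bval_in_V_closed: "bval_in_V L \<tau> \<in> carrier L"
  unfolding bval_in_V_def by (rule Sup_closed[OF bval_in_V_set_in_V])

lemma bval_eq_check_le_bval_in_V: "bval_eq L \<tau> (check L x) \<sqsubseteq> bval_in_V L \<tau>"
  unfolding bval_in_V_def by (rule Sup_upper[OF bval_in_V_set_in_V]) simp_all

lemma le_bval_in_VI:
  "p \<sqsubseteq> bval_eq L \<tau> (check L x) \<Longrightarrow> p \<in> carrier L \<Longrightarrow> p \<sqsubseteq> bval_in_V L \<tau>"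
  by (rule le_trans[OF _ bval_eq_check_le_bval_in_V]) (simp_all add: bval_in_V_closed)

lemma le_bval_in_VE:
  assumes "p \<sqsubseteq> bval_in_V L \<tau>" "p \<in> carrier L" "z \<in> carrier L"
    and "\<And>x q. q \<in> carrier L \<Longrightarrow> q \<sqsubseteq> p \<Longrightarrow> q \<sqsubseteq> bval_eq L \<tau> (check L x) \<Longrightarrow> q \<sqsubseteq> z"
  shows "p \<sqsubseteq> z"
  by (rule le_Sup_cases[OF assms(2) bval_in_V_set_in_V assms(1)[unfolded bval_in_V_def] assms(3)])
     (use assms(4) in auto)

lemma bval_in_V_mixture:
  assumes "maximal_antichain L A" "definable_term (\<lambda>e. F (e 0))"
  shows "bval_in_V L (mixture A F) = \<top>"
proof -
  have A: "antichain L A" using assms(1) unfolding maximal_antichain_def by blast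
  have "\<top> \<sqsubseteq> bval_in_V L (mixture A F)"
    by (rule le_antichain_cases[OF assms(1) top_closed bval_in_V_closed])
       (rule le_bval_in_VI[OF le_bval_eq_mixture[OF A assms(2)]])
  then show ?thesis by (intro le_antisym) (simp_all add: bval_in_V_closed)
qed

text \<open>The value of the assertion that \<open>\<tau>\<close> is the element represented by \<open>f\<close>: if the members of \<open>A\<close> are seen as
  the possible values of an index \<open>a\<close>, it says \<open>\<tau> = f a\<close>.\<close>

definition agreement where
  "agreement A \<tau> f = \<Squnion> ((\<lambda>a. a \<sqinter> bval_eq L \<tau> (check L (app f a))) ` elts A)"

lemma agreement_set_in_V: "(\<lambda>a. a \<sqinter> bval_eq L \<tau> (check L (app f a))) ` elts A \<in> range elts"
  by (rule definable_set_in_V[where e = undefined])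
     (intro definable_alg_intros definable_term_bval_eq definable_term_check)

lemma agreement_closed [simp]: "agreement A \<tau> f \<in> carrier L"
  unfolding agreement_def by (rule Sup_closed[OF agreement_set_in_V])

lemma le_agreementI:
  assumes "a \<in> elts A" "a \<in> carrier L" "p \<in> carrier L" "p \<sqsubseteq> a" "p \<sqsubseteq> bval_eq L \<tau> (check L (app f a))"
  shows "p \<sqsubseteq> agreement A \<tau> f"
proof (rule le_trans)
  show "p \<sqsubseteq> a \<sqinter> bval_eq L \<tau> (check L (app f a))" using assms by (intro meet_le) simp_all
  show "a \<sqinter> bval_eq L \<tau> (check L (app f a)) \<sqsubseteq> agreement A \<tau> f"
    unfolding agreement_def by (rule Sup_upper[OF agreement_set_in_V]) (use assms(1) in auto)
qed (use assms in simp_all)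

lemma le_agreementD:
  assumes A: "antichain L A" and "a \<in> elts A" "p \<in> carrier L" "p \<sqsubseteq> a" "p \<sqsubseteq> agreement A \<tau> f"
  shows "p \<sqsubseteq> bval_eq L \<tau> (check L (app f a))"
proof (rule le_Sup_cases[OF assms(3) agreement_set_in_V assms(5)[unfolded agreement_def] bval_eq_closed])
  fix x q assume q: "x \<in> (\<lambda>a. a \<sqinter> bval_eq L \<tau> (check L (app f a))) ` elts A" "q \<in> carrier L" "q \<sqsubseteq> p" "q \<sqsubseteq> x"
  then obtain b where b: "b \<in> elts A" "x = b \<sqinter> bval_eq L \<tau> (check L (app f b))" by blast
  have c: "a \<in> carrier L" "b \<in> carrier L" using assms(2) b(1) antichain_carrier[OF A] by blast+
  have qb: "q \<sqsubseteq> b" "q \<sqsubseteq> bval_eq L \<tau> (check L (app f b))"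
    using q(4) unfolding b(2) le_meet_iff[OF q(2) c(2) bval_eq_closed] by simp_all
  show "q \<sqsubseteq> bval_eq L \<tau> (check L (app f a))"
  proof (cases "b = a")
    case False
    have "q \<sqsubseteq> a" using le_trans[OF q(3) assms(4)] q(2) assms(3) c by simp
    then have "q \<sqsubseteq> \<bottom>" by (rule antichain_disjoint[OF A b(1) assms(2) False qb(1) _ q(2)])
    then show ?thesis using q(2) by (rule le_bottomD) simp
  qed (use qb in simp)
qed

lemma bval_eq_check_disjoint:
  assumes \<tau>: "bname L \<tau>" and "x \<noteq> y" "p \<in> carrier L"
    "p \<sqsubseteq> bval_eq L \<tau> (check L x)" "p \<sqsubseteq> bval_eq L \<tau> (check L y)"
  shows "p \<sqsubseteq> \<bottom>"
proof -
  have "p \<sqsubseteq> bval_eq L (check L x) \<tau>"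
    using assms(4) unfolding bval_eq_commute[of "check L x" \<tau>] .
  from le_bval_eq_trans[OF bname_check \<tau> bname_check assms(3) this assms(5)] show ?thesis
    by (rule bval_eq_check_distinct[OF assms(2,3)])
qed

text \<open>The values \<open>[\<tau> = x]\<close> are disjoint for distinct \<open>x\<close>, and their join is \<open>[\<tau> \<in> V]\<close>, so one further element is
  enough for maximality.\<close>

lemma decision_antichain:
  assumes \<tau>: "bname L \<tau>"
  obtains D where "maximal_antichain L D"
    "\<And>d. d \<in> elts D \<Longrightarrow> d = compl L (bval_in_V L \<tau>) \<or> (\<exists>x. d = bval_eq L \<tau> (check L x))"
    "\<And>x. bval_eq L \<tau> (check L x) \<noteq> \<bottom> \<Longrightarrow> bval_eq L \<tau> (check L x) \<in> elts D"
proof -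
  let ?v = "\<lambda>x. bval_eq L \<tau> (check L x)"
  define b where "b = bval_in_V L \<tau>"
  have b: "b \<in> carrier L" "compl L b \<in> carrier L"
    unfolding b_def using bval_in_V_closed compl_closed by blast+
  have "{d \<in> carrier L. d \<noteq> \<bottom> \<and> (d = compl L b \<or> (\<exists>x. d = ?v x))} \<in> range elts"
    by (rule definable_set_in_V[where e = undefined])
       (intro definable_alg_intros definable_term_bval_eq definable_term_check)
  then obtain D where D: "elts D = {d \<in> carrier L. d \<noteq> \<bottom> \<and> (d = compl L b \<or> (\<exists>x. d = ?v x))}"
    by auto
  have v_compl: "p \<sqsubseteq> \<bottom>" if "p \<in> carrier L" "p \<sqsubseteq> ?v x" "p \<sqsubseteq> compl L b" for x p
    by (rule le_compl_disjoint[OF le_bval_in_VI[OF that(2,1)] that(3)[unfolded b_def] that(1) bval_in_V_closed])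
  have disjoint: "p \<sqsubseteq> \<bottom>" if u: "u \<in> elts D" and w: "w \<in> elts D" and "u \<noteq> w"
    and p: "p \<in> carrier L" "p \<sqsubseteq> u" "p \<sqsubseteq> w" for u w p
  proof (cases "u = compl L b \<or> w = compl L b")
    case True
    then obtain x where "u = ?v x \<and> w = compl L b \<or> w = ?v x \<and> u = compl L b"
      using u w \<open>u \<noteq> w\<close> unfolding D by blast
    then show ?thesis using v_compl[OF p(1), of x] p(2,3) by auto
  next
    case False
    then obtain x y where "u = ?v x" "w = ?v y" "x \<noteq> y"
      using u w \<open>u \<noteq> w\<close> unfolding D by blast
    then show ?thesis using bval_eq_check_disjoint[OF \<tau> _ p(1), of x y] p(2,3) by simp
  qed
  have "antichain L D"
    unfolding antichain_def
  proof (intro conjI ballI impI)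
    show "elts D \<subseteq> carrier L - {\<bottom>}" unfolding D by blast
    fix u w assume uw: "u \<in> elts D" "w \<in> elts D" "u \<noteq> w"
    then have "u \<in> carrier L" "w \<in> carrier L" unfolding D by blast+
    then have "u \<sqinter> w \<sqsubseteq> \<bottom>" by (intro disjoint[OF uw]) (simp_all add: meet_left meet_right)
    then show "u \<sqinter> w = \<bottom>" by (rule le_bottom_eq) simp
  qed
  then have "maximal_antichain L D"
  proof (rule maximal_antichainI)
    fix p assume p: "p \<in> carrier L"
      and disj: "\<And>d q. d \<in> elts D \<Longrightarrow> q \<in> carrier L \<Longrightarrow> q \<sqsubseteq> p \<Longrightarrow> q \<sqsubseteq> d \<Longrightarrow> q \<sqsubseteq> \<bottom>"
    have below: "r \<sqsubseteq> \<bottom>" if "u \<in> carrier L" "u = compl L b \<or> (\<exists>x. u = ?v x)" "r \<in> carrier L" "r \<sqsubseteq> p" "r \<sqsubseteq> u" for u r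
    proof (cases "u = \<bottom>")
      case False
      then have "u \<in> elts D" using that(1,2) unfolding D by blast
      then show ?thesis by (rule disj[OF _ that(3-5)])
    qed (use that(5) in simp)
    show "p \<sqsubseteq> \<bottom>"
    proof (rule le_compl_cases[OF p b(1) bottom_closed])
      fix r assume r: "r \<in> carrier L" "r \<sqsubseteq> p" "r \<sqsubseteq> compl L b"
      show "r \<sqsubseteq> \<bottom>" by (rule below[OF b(2) _ r]) simp
    next
      fix r assume r: "r \<in> carrier L" "r \<sqsubseteq> p" "r \<sqsubseteq> b"
      show "r \<sqsubseteq> \<bottom>"
      proof (rule le_bval_in_VE[OF r(3)[unfolded b_def] r(1) bottom_closed])
        fix x t assume t: "t \<in> carrier L" "t \<sqsubseteq> r" "t \<sqsubseteq> ?v x"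
        have "t \<sqsubseteq> p" using le_trans[OF t(2) r(2)] t(1) r(1) p by simp
        then show "t \<sqsubseteq> \<bottom>" by (intro below[OF bval_eq_closed _ t(1) _ t(3)]) blast+
      qed
    qed
  qed
  then show thesis by (rule that) (auto simp: D b_def)
qed

lemma common_refinement:
  assumes A: "maximal_antichain L A" and D: "maximal_antichain L D"
  obtains C where "maximal_antichain L C" "\<And>c. c \<in> elts C \<Longrightarrow> \<exists>a\<in>elts A. \<exists>d\<in>elts D. c = a \<sqinter> d"
proof -
  have anti: "antichain L A" "antichain L D" using A D unfolding maximal_antichain_def by blast+
  note Ac = antichain_carrier[OF anti(1)] and Dc = antichain_carrier[OF anti(2)]
  have "{c \<in> carrier L. c \<noteq> \<bottom> \<and> (\<exists>a\<in>elts A. \<exists>d\<in>elts D. c = a \<sqinter> d)} \<in> range elts"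
    by (rule definable_set_in_V[where e = undefined]) (intro definable_alg_intros)
  then obtain C where C0: "elts C = {c \<in> carrier L. c \<noteq> \<bottom> \<and> (\<exists>a\<in>elts A. \<exists>d\<in>elts D. c = a \<sqinter> d)}"
    by auto
  have "antichain L C"
    unfolding antichain_def
  proof (intro conjI ballI impI)
    show "elts C \<subseteq> carrier L - {\<bottom>}" unfolding C0 by blast
    fix c c' assume c: "c \<in> elts C" "c' \<in> elts C" "c \<noteq> c'"
    from c(1) obtain a d where a: "a \<in> elts A" "d \<in> elts D" "c = a \<sqinter> d" unfolding C0 by blast
    from c(2) obtain a' d' where a': "a' \<in> elts A" "d' \<in> elts D" "c' = a' \<sqinter> d'" unfolding C0 by blast
    let ?p = "c \<sqinter> c'"
    have "?p \<sqsubseteq> c" "?p \<sqsubseteq> c'" by (simp_all add: a(3) a'(3) meet_left meet_right)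
    then have p: "?p \<sqsubseteq> a" "?p \<sqsubseteq> d" "?p \<sqsubseteq> a'" "?p \<sqsubseteq> d'"
      unfolding a(3) a'(3) using Ac[OF a(1)] Ac[OF a'(1)] Dc[OF a(2)] Dc[OF a'(2)]
      by (simp_all add: le_meet_iff)
    have "a \<noteq> a' \<or> d \<noteq> d'" using c(3) a(3) a'(3) by blast
    then have "?p \<sqsubseteq> \<bottom>"
      using antichain_disjoint[OF anti(1) a(1) a'(1) _ p(1,3) meet_closed_total]
        antichain_disjoint[OF anti(2) a(2) a'(2) _ p(2,4) meet_closed_total] by blast
    then show "?p = \<bottom>" by (rule le_bottom_eq) simp
  qed
  then have "maximal_antichain L C"
  proof (rule maximal_antichainI)
    fix p assume p: "p \<in> carrier L"
      and disj: "\<And>c q. c \<in> elts C \<Longrightarrow> q \<in> carrier L \<Longrightarrow> q \<sqsubseteq> p \<Longrightarrow> q \<sqsubseteq> c \<Longrightarrow> q \<sqsubseteq> \<bottom>"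
    show "p \<sqsubseteq> \<bottom>"
    proof (rule le_antichain_cases[OF A p bottom_closed])
      fix a q assume q: "a \<in> elts A" "q \<in> carrier L" "q \<sqsubseteq> p" "q \<sqsubseteq> a"
      show "q \<sqsubseteq> \<bottom>"
      proof (rule le_antichain_cases[OF D q(2) bottom_closed])
        fix d r assume r: "d \<in> elts D" "r \<in> carrier L" "r \<sqsubseteq> q" "r \<sqsubseteq> d"
        have rp: "r \<sqsubseteq> p" "r \<sqsubseteq> a"
          using le_trans[OF r(3) q(3)] le_trans[OF r(3) q(4)] r(2) q(2) p Ac[OF q(1)] by simp_all
        have le: "r \<sqsubseteq> a \<sqinter> d" using rp r Ac[OF q(1)] Dc[OF r(1)] by (intro meet_le) simp_all
        show "r \<sqsubseteq> \<bottom>"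
        proof (cases "a \<sqinter> d = \<bottom>")
          case False
          then have "a \<sqinter> d \<in> elts C" using q(1) r(1) unfolding C0 by auto
          then show ?thesis by (rule disj[OF _ r(2) rp(1) le])
        qed (use le in simp)
      qed
    qed
  qed
  then show thesis by (rule that) (auto simp: C0)
qed

context
  fixes U :: "'v set"
  assumes U: "ultrafilter L U"
begin

section \<open>The Boolean ultrapower\<close>

lemma ultrafilter_closed: "x \<in> U \<Longrightarrow> x \<in> carrier L"
  using U unfolding ultrafilter_def by blast

lemma ultrafilter_up: "x \<in> U \<Longrightarrow> x \<sqsubseteq> y \<Longrightarrow> y \<in> carrier L \<Longrightarrow> y \<in> U"
  using U unfolding ultrafilter_def by blast

lemma ultrafilter_meet: "x \<in> U \<Longrightarrow> y \<in> U \<Longrightarrow> x \<sqinter> y \<in> U"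
  using U unfolding ultrafilter_def by blast

lemma ultrafilter_top: "\<top> \<in> U"
  using U unfolding ultrafilter_def by blast

lemma ultrafilter_bottom: "\<bottom> \<notin> U"
  using U unfolding ultrafilter_def by blast

text \<open>A deduction rule: whatever follows from values in \<open>U\<close> has its value in \<open>U\<close>.\<close>

lemma ultrafilter_consequence2:
  assumes "x \<in> U" "y \<in> U" "z \<in> carrier L" "\<And>p. p \<in> carrier L \<Longrightarrow> p \<sqsubseteq> x \<Longrightarrow> p \<sqsubseteq> y \<Longrightarrow> p \<sqsubseteq> z"
  shows "z \<in> U"
  by (rule ultrafilter_up[OF ultrafilter_meet[OF assms(1,2)] assms(4) assms(3)])
     (simp_all add: ultrafilter_closed assms meet_left meet_right)

lemma ultrafilter_consequence3:
  assumes "x \<in> U" "y \<in> U" "w \<in> U" "z \<in> carrier L"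
    and "\<And>p. p \<in> carrier L \<Longrightarrow> p \<sqsubseteq> x \<Longrightarrow> p \<sqsubseteq> y \<Longrightarrow> p \<sqsubseteq> w \<Longrightarrow> p \<sqsubseteq> z"
  shows "z \<in> U"
proof (rule ultrafilter_consequence2[OF ultrafilter_meet[OF assms(1,2)] assms(3,4)])
  fix p assume "p \<in> carrier L" "p \<sqsubseteq> x \<sqinter> y" "p \<sqsubseteq> w"
  then show "p \<sqsubseteq> z"
    using le_meet_iff[OF _ ultrafilter_closed[OF assms(1)] ultrafilter_closed[OF assms(2)], of p] assms(5) by blast
qed

lemma name_class_eq_iff:
  assumes "bname L \<tau>" "bname L \<sigma>"
  shows "name_class L U \<tau> = name_class L U \<sigma> \<longleftrightarrow> bval_eq L \<tau> \<sigma> \<in> U"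
proof
  assume eq: "name_class L U \<tau> = name_class L U \<sigma>"
  have "\<sigma> \<in> name_class L U \<sigma>" unfolding name_class_def using assms ultrafilter_top by (simp add: bval_eq_refl)
  then show "bval_eq L \<tau> \<sigma> \<in> U" unfolding eq[symmetric] by (simp add: name_class_def)
next
  assume ts: "bval_eq L \<tau> \<sigma> \<in> U"
  then have st: "bval_eq L \<sigma> \<tau> \<in> U" unfolding bval_eq_commute[of \<sigma> \<tau>] .
  have "bval_eq L \<tau> \<rho> \<in> U \<longleftrightarrow> bval_eq L \<sigma> \<rho> \<in> U" if \<rho>: "bname L \<rho>" for \<rho>
  proof
    assume "bval_eq L \<tau> \<rho> \<in> U"
    then show "bval_eq L \<sigma> \<rho> \<in> U"
      by (rule ultrafilter_consequence2[OF st]) (simp, rule le_bval_eq_trans[OF assms(2,1) \<rho>])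
  next
    assume "bval_eq L \<sigma> \<rho> \<in> U"
    then show "bval_eq L \<tau> \<rho> \<in> U"
      by (rule ultrafilter_consequence2[OF ts]) (simp, rule le_bval_eq_trans[OF assms \<rho>])
  qed
  then show "name_class L U \<tau> = name_class L U \<sigma>" unfolding name_class_def by auto
qed

lemma bool_ultrapower_mem_iff:
  assumes "bname L \<tau>" "bname L \<sigma>"
  shows "bool_ultrapower_mem L U (name_class L U \<tau>) (name_class L U \<sigma>) \<longleftrightarrow> bval_mem L \<tau> \<sigma> \<in> U"
proof
  assume "bval_mem L \<tau> \<sigma> \<in> U"
  moreover have "\<tau> \<in> name_class L U \<tau>" "\<sigma> \<in> name_class L U \<sigma>"
    unfolding name_class_def using assms ultrafilter_top by (simp_all add: bval_eq_refl)
  ultimately show "bool_ultrapower_mem L U (name_class L U \<tau>) (name_class L U \<sigma>)"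
    unfolding bool_ultrapower_mem_def by blast
next
  assume "bool_ultrapower_mem L U (name_class L U \<tau>) (name_class L U \<sigma>)"
  then obtain \<tau>' \<sigma>' where *: "bname L \<tau>'" "bname L \<sigma>'" "bval_eq L \<tau> \<tau>' \<in> U" "bval_eq L \<sigma> \<sigma>' \<in> U"
    "bval_mem L \<tau>' \<sigma>' \<in> U"
    unfolding bool_ultrapower_mem_def name_class_def by blast
  from *(3-5) show "bval_mem L \<tau> \<sigma> \<in> U"
  proof (rule ultrafilter_consequence3[OF _ _ _ bval_mem_closed])
    fix p assume p: "p \<in> carrier L" "p \<sqsubseteq> bval_eq L \<tau> \<tau>'" "p \<sqsubseteq> bval_eq L \<sigma> \<sigma>'" "p \<sqsubseteq> bval_mem L \<tau>' \<sigma>'"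
    show "p \<sqsubseteq> bval_mem L \<tau> \<sigma>"
      using le_bval_mem_subst[OF *(1) assms(1) *(2) assms(2) p(1) _ _ p(4)] p(2,3)
      unfolding bval_eq_commute[of \<tau>' \<tau>] bval_eq_commute[of \<sigma>' \<sigma>] by blast
  qed
qed

section \<open>Relative genericity gives a power set ultrapower\<close>

lemma induced_ultrafilter_iff:
  assumes "X \<in> range elts" "X \<subseteq> elts A"
  shows "vset X \<in> induced_ultrafilter L U A \<longleftrightarrow> \<Squnion> X \<in> U"
  unfolding induced_ultrafilter_def using assms by (simp add: elts_vset)

text \<open>The form of the theorem of Los that is needed, for \<open>q\<close> either equality or membership and \<open>Q\<close> its
  Boolean value. Below \<open>a\<close> the names \<open>\<tau>\<close> and \<open>\<sigma>\<close> may be replaced by \<open>f a\<close> and \<open>g a\<close>, and for check names \<open>Q\<close>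
  is top or bottom according to \<open>q\<close>. Hence below the two agreement values \<open>Q \<tau> \<sigma>\<close> coincides with the
  join of all \<open>a\<close> that satisfy \<open>q (f a) (g a)\<close>.\<close>

lemma agreement_decides:
  assumes A: "maximal_antichain L A" and \<tau>: "agreement A \<tau> f \<in> U" and \<sigma>: "agreement A \<sigma> g \<in> U"
    and names: "bname L \<tau>" "bname L \<sigma>" and fg: "vfun A f" "vfun A g"
    and V: "{a \<in> elts A. q (vapp f a) (vapp g a)} \<in> range elts"
    and Q: "\<And>\<tau> \<sigma>. Q \<tau> \<sigma> \<in> carrier L"
    and subst: "\<And>\<tau> \<tau>' \<sigma> \<sigma>' p. bname L \<tau> \<Longrightarrow> bname L \<tau>' \<Longrightarrow> bname L \<sigma> \<Longrightarrow> bname L \<sigma>' \<Longrightarrow> p \<in> carrier L \<Longrightarrow>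
      p \<sqsubseteq> bval_eq L \<tau> \<tau>' \<Longrightarrow> p \<sqsubseteq> bval_eq L \<sigma> \<sigma>' \<Longrightarrow> p \<sqsubseteq> Q \<tau> \<sigma> \<Longrightarrow> p \<sqsubseteq> Q \<tau>' \<sigma>'"
    and yes: "\<And>x y p. q x y \<Longrightarrow> p \<in> carrier L \<Longrightarrow> p \<sqsubseteq> Q (check L x) (check L y)"
    and no: "\<And>x y p. \<not> q x y \<Longrightarrow> p \<in> carrier L \<Longrightarrow> p \<sqsubseteq> Q (check L x) (check L y) \<Longrightarrow> p \<sqsubseteq> \<bottom>"
  shows "Q \<tau> \<sigma> \<in> U \<longleftrightarrow> vset {a \<in> elts A. q (vapp f a) (vapp g a)} \<in> induced_ultrafilter L U A"
proof -
  let ?X = "{a \<in> elts A. q (vapp f a) (vapp g a)}"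
  have anti: "antichain L A" using A unfolding maximal_antichain_def by blast
  have X: "\<Squnion> ?X \<in> carrier L" by (rule Sup_closed[OF V])
  have values_on: "p \<sqsubseteq> bval_eq L \<tau> (check L (vapp f a)) \<and> p \<sqsubseteq> bval_eq L \<sigma> (check L (vapp g a))"
    if "a \<in> elts A" "p \<in> carrier L" "p \<sqsubseteq> a" "p \<sqsubseteq> agreement A \<tau> f" "p \<sqsubseteq> agreement A \<sigma> g" for a p
    using le_agreementD[OF anti that(1-3)] that(4,5) vapp_eq_app[OF fg(1) that(1)] vapp_eq_app[OF fg(2) that(1)]
    by simp
  have "Q \<tau> \<sigma> \<in> U \<longleftrightarrow> \<Squnion> ?X \<in> U"
  proof
    assume "Q \<tau> \<sigma> \<in> U"
    then show "\<Squnion> ?X \<in> U"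
    proof (rule ultrafilter_consequence3[OF \<tau> \<sigma> _ X])
      fix p assume p: "p \<in> carrier L" "p \<sqsubseteq> agreement A \<tau> f" "p \<sqsubseteq> agreement A \<sigma> g" "p \<sqsubseteq> Q \<tau> \<sigma>"
      show "p \<sqsubseteq> \<Squnion> ?X"
      proof (rule le_antichain_cases[OF A p(1) X])
        fix a r assume r: "a \<in> elts A" "r \<in> carrier L" "r \<sqsubseteq> p" "r \<sqsubseteq> a"
        have ac: "a \<in> carrier L" by (rule antichain_carrier[OF anti r(1)])
        have rp: "r \<sqsubseteq> agreement A \<tau> f" "r \<sqsubseteq> agreement A \<sigma> g" "r \<sqsubseteq> Q \<tau> \<sigma>"
          using le_trans[OF r(3) p(2)] le_trans[OF r(3) p(3)] le_trans[OF r(3) p(4)] r(2) p(1) Q by simp_all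
        show "r \<sqsubseteq> \<Squnion> ?X"
        proof (cases "q (vapp f a) (vapp g a)")
          case True
          then have "a \<sqsubseteq> \<Squnion> ?X" using r(1) ac by (intro Sup_upper[OF V]) simp_all
          then show ?thesis using le_trans[OF r(4)] r(2) ac X by simp
        next
          case False
          have "r \<sqsubseteq> Q (check L (vapp f a)) (check L (vapp g a))"
            using subst[OF names(1) bname_check names(2) bname_check r(2) _ _ rp(3)]
              values_on[OF r(1,2,4) rp(1,2)] by blast
          then have "r \<sqsubseteq> \<bottom>" by (rule no[OF False r(2)])
          then show ?thesis using r(2) X by (rule le_bottomD)
        qed
      qed
    qed
  next
    assume "\<Squnion> ?X \<in> U"
    then show "Q \<tau> \<sigma> \<in> U"
    proof (rule ultrafilter_consequence3[OF \<tau> \<sigma> _ Q])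
      fix p assume p: "p \<in> carrier L" "p \<sqsubseteq> agreement A \<tau> f" "p \<sqsubseteq> agreement A \<sigma> g" "p \<sqsubseteq> \<Squnion> ?X"
      show "p \<sqsubseteq> Q \<tau> \<sigma>"
      proof (rule le_Sup_cases[OF p(1) V p(4) Q])
        fix a r assume r: "a \<in> ?X" "r \<in> carrier L" "r \<sqsubseteq> p" "r \<sqsubseteq> a"
        have rp: "r \<sqsubseteq> agreement A \<tau> f" "r \<sqsubseteq> agreement A \<sigma> g"
          using le_trans[OF r(3) p(2)] le_trans[OF r(3) p(3)] r(2) p(1) by simp_all
        have a: "a \<in> elts A" "q (vapp f a) (vapp g a)" using r(1) by simp_all
        show "r \<sqsubseteq> Q \<tau> \<sigma>"
          using subst[OF bname_check names(1) bname_check names(2) r(2) _ _ yes[OF a(2) r(2)]]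
            values_on[OF a(1) r(2,4) rp]
          unfolding bval_eq_commute[of "check L (vapp f a)"] bval_eq_commute[of "check L (vapp g a)"] by blast
      qed
    qed
  qed
  also have "\<dots> \<longleftrightarrow> vset ?X \<in> induced_ultrafilter L U A"
    by (rule induced_ultrafilter_iff[symmetric, OF V]) simp
  finally show ?thesis .
qed

lemma ultrafilter_induced_ultrafilter:
  assumes A: "maximal_antichain L A"
  shows "ultrafilter (powerset_algebra A) (induced_ultrafilter L U A)"
proof -
  have anti: "antichain L A" using A unfolding maximal_antichain_def by blast
  have c: "\<Squnion> (elts X) \<in> carrier L" for X by (rule Sup_closed) simp
  have empty: "\<Squnion> {} = \<bottom>"
    by (rule le_bottom_eq[OF Sup_least[OF empty_in_V] Sup_closed[OF empty_in_V]]) simp_all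
  have upper: "p \<sqsubseteq> \<Squnion> Y" if "p \<sqsubseteq> a" "p \<in> carrier L" "a \<in> Y" "Y \<in> range elts" "a \<in> elts A" for p a Y
    using le_trans[OF that(1) Sup_upper[OF that(4,3)]] that(2) antichain_carrier[OF anti that(5)]
      Sup_closed[OF that(4)] by simp
  have inter: "\<Squnion> (elts X \<inter> elts Y) \<in> U"
    if X: "\<Squnion> (elts X) \<in> U" "elts X \<subseteq> elts A" and Y: "\<Squnion> (elts Y) \<in> U" "elts Y \<subseteq> elts A" for X Y
  proof (rule ultrafilter_consequence2[OF X(1) Y(1) Sup_closed[OF Int_in_V]])
    fix p assume p: "p \<in> carrier L" "p \<sqsubseteq> \<Squnion> (elts X)" "p \<sqsubseteq> \<Squnion> (elts Y)"
    show "p \<sqsubseteq> \<Squnion> (elts X \<inter> elts Y)"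
    proof (rule le_Sup_cases[OF p(1) rangeI p(2) Sup_closed[OF Int_in_V]])
      fix x q assume x: "x \<in> elts X" "q \<in> carrier L" "q \<sqsubseteq> p" "q \<sqsubseteq> x"
      have qY: "q \<sqsubseteq> \<Squnion> (elts Y)" using le_trans[OF x(3) p(3)] x(2) p(1) c by simp
      show "q \<sqsubseteq> \<Squnion> (elts X \<inter> elts Y)"
      proof (rule le_Sup_cases[OF x(2) rangeI qY Sup_closed[OF Int_in_V]])
        fix y r assume y: "y \<in> elts Y" "r \<in> carrier L" "r \<sqsubseteq> q" "r \<sqsubseteq> y"
        have A': "x \<in> elts A" "y \<in> elts A" using x(1) y(1) X(2) Y(2) by blast+
        have rx: "r \<sqsubseteq> x" using le_trans[OF y(3) x(4)] x(2) y(2) antichain_carrier[OF anti A'(1)] by simp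
        show "r \<sqsubseteq> \<Squnion> (elts X \<inter> elts Y)"
        proof (cases "x = y")
          case True
          then show ?thesis using x(1) y(1) by (intro upper[OF rx y(2) _ Int_in_V A'(1)]) simp
        next
          case False
          have "r \<sqsubseteq> \<bottom>" by (rule antichain_disjoint[OF anti A' False rx y(4,2)])
          then show ?thesis using y(2) Sup_closed[OF Int_in_V] by (rule le_bottomD)
        qed
      qed
    qed
  qed
  have up: "\<Squnion> (elts Y) \<in> U" if X: "\<Squnion> (elts X) \<in> U" and XY: "elts X \<subseteq> elts Y" for X Y
    by (rule ultrafilter_up[OF X Sup_least[OF rangeI c] c]) (use XY Sup_upper[OF rangeI] in blast)
  have ultra: "\<Squnion> (elts X) \<in> U \<or> \<Squnion> (elts A - elts X) \<in> U" for X
  proof (cases "\<Squnion> (elts X) \<in> U")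
    case False
    then have n: "compl L (\<Squnion> (elts X)) \<in> U" using U c unfolding ultrafilter_def by blast
    note d = Sup_closed[OF Diff_in_V]
    have "compl L (\<Squnion> (elts X)) \<sqsubseteq> \<Squnion> (elts A - elts X)"
    proof (rule le_antichain_cases[OF A ultrafilter_closed[OF n] d])
      fix a q assume a: "a \<in> elts A" "q \<in> carrier L" "q \<sqsubseteq> compl L (\<Squnion> (elts X))" "q \<sqsubseteq> a"
      show "q \<sqsubseteq> \<Squnion> (elts A - elts X)"
      proof (cases "a \<in> elts X")
        case True
        have "q \<sqsubseteq> \<Squnion> (elts X)" by (rule upper[OF a(4,2) True rangeI a(1)])
        then have "q \<sqsubseteq> \<bottom>" by (rule le_compl_disjoint[OF _ a(3,2) c])
        then show ?thesis using a(2) d by (rule le_bottomD)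
      next
        case False
        then show ?thesis using a(1) by (intro upper[OF a(4,2) _ Diff_in_V a(1)]) simp
      qed
    qed
    then show ?thesis using ultrafilter_up[OF n _ d] by blast
  qed simp
  show ?thesis
    unfolding ultrafilter_powerset_algebra_iff induced_ultrafilter_def
    using inter up ultra ultrafilter_top ultrafilter_bottom
    by (simp add: elts_vset empty_in_V Int_in_V Diff_in_V empty Sup_maximal_antichain[OF A]) blast
qed

text \<open>The choice \<open>s\<close> provided by genericity picks, for every \<open>a\<close>, a nonzero element \<open>a \<sqinter> d\<close> with \<open>d\<close> in the
  decision antichain. If \<open>d = [\<tau> = x]\<close>, then \<open>f a = x\<close>. The indices with \<open>d\<close> the complement of \<open>[\<tau> \<in> V]\<close> can
  be ignored because \<open>[\<tau> \<in> V] \<in> U\<close>.\<close>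

lemma generic_name_agrees:
  assumes A: "maximal_antichain L A" and gen: "generic_relative L U A"
    and \<tau>: "bname L \<tau>" "bval_in_V L \<tau> \<in> U"
  shows "\<exists>f. vfun A f \<and> agreement A \<tau> f \<in> U"
proof -
  let ?v = "\<lambda>x. bval_eq L \<tau> (check L x)"
  define b where "b = bval_in_V L \<tau>"
  have b: "b \<in> carrier L" "b \<in> U" unfolding b_def using bval_in_V_closed \<tau>(2) by blast+
  have anti: "antichain L A" using A unfolding maximal_antichain_def by blast
  have Ac: "a \<in> carrier L" if "a \<in> elts A" for a by (rule antichain_carrier[OF anti that])
  obtain D where D: "maximal_antichain L D" "\<And>d. d \<in> elts D \<Longrightarrow> d = compl L b \<or> (\<exists>x. d = ?v x)"
    using decision_antichain[OF \<tau>(1)] unfolding b_def by blast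
  have Dc: "d \<in> carrier L" if "d \<in> elts D" for d
    using D(1) antichain_carrier that unfolding maximal_antichain_def by blast
  obtain C where C: "maximal_antichain L C" "\<And>c. c \<in> elts C \<Longrightarrow> \<exists>a\<in>elts A. \<exists>d\<in>elts D. c = a \<sqinter> d"
    using common_refinement[OF A D(1)] by blast
  have "refines L C A"
    unfolding refines_def
  proof
    fix c assume "c \<in> elts C"
    then obtain a d where "a \<in> elts A" "d \<in> elts D" "c = a \<sqinter> d" using C(2) by blast
    then show "\<exists>a\<in>elts A. c \<sqsubseteq> a" using meet_left[OF Ac Dc] by blast
  qed
  then have "meets_relative L U A C" using gen C(1) unfolding generic_relative_def by blast
  then obtain s where s: "vfun A s" "\<And>a. a \<in> elts A \<Longrightarrow> vapp s a \<in> elts C"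
    "\<And>a. a \<in> elts A \<Longrightarrow> vapp s a \<sqsubseteq> a" "\<Squnion> (vapp s ` elts A) \<in> U"
    unfolding meets_relative_def elts_def by blast
  define F where "F a = the_default (\<lambda>x. app s a \<in> carrier L \<and> ?v x \<in> carrier L \<and> app s a \<sqsubseteq> ?v x)" for a
  define f where "f = graph_on A F"
  have F: "definable_term (\<lambda>e. F (e 0))"
    unfolding F_def by (intro definable_alg_intros definable_term_bval_eq definable_term_check)
  have f: "vfun A f" unfolding f_def by (rule vfun_graph_on[OF F])
  have app_f: "app f a = F a" if "a \<in> elts A" for a
    using vapp_graph_on[OF F that] vapp_eq_app[OF f that] unfolding f_def by simp
  have "vapp s ` elts A = app s ` elts A" by (rule image_cong) (simp_all add: vapp_eq_app[OF s(1)])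
  also have "\<dots> \<in> range elts" by (rule in_range_elts_image) (simp, intro definable_fun_intros)
  finally have V: "vapp s ` elts A \<in> range elts" .
  have "agreement A \<tau> f \<in> U"
  proof (rule ultrafilter_consequence2[OF s(4) b(2) agreement_closed])
    fix p assume p: "p \<in> carrier L" "p \<sqsubseteq> \<Squnion> (vapp s ` elts A)" "p \<sqsubseteq> b"
    show "p \<sqsubseteq> agreement A \<tau> f"
    proof (rule le_Sup_cases[OF p(1) V p(2) agreement_closed])
      fix c q assume c: "c \<in> vapp s ` elts A" "c \<in> carrier L" and q: "q \<in> carrier L" "q \<sqsubseteq> p" "q \<sqsubseteq> c"
      from c obtain a where a: "a \<in> elts A" "c = vapp s a" by blast
      have "c \<in> elts C" "c \<sqsubseteq> a" using s(2,3)[OF a(1)] unfolding a(2) by blast+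
      then obtain a' u where c': "a' \<in> elts A" "u \<in> elts D" "c = a' \<sqinter> u" using C(2) by blast
      have nz: "c \<noteq> \<bottom>"
        using C(1) \<open>c \<in> elts C\<close> unfolding maximal_antichain_def antichain_def by blast
      have cu: "c \<sqsubseteq> u" unfolding c'(3) by (rule meet_right[OF Ac[OF c'(1)] Dc[OF c'(2)]])
      have qa: "q \<sqsubseteq> a" using le_trans[OF q(3) \<open>c \<sqsubseteq> a\<close>] q(1) c(2) Ac[OF a(1)] by simp
      have qu: "q \<sqsubseteq> u" using le_trans[OF q(3) cu] q(1) c(2) Dc[OF c'(2)] by simp
      have qb: "q \<sqsubseteq> b" using le_trans[OF q(2) p(3)] q(1) p(1) b(1) by simp
      show "q \<sqsubseteq> agreement A \<tau> f"
      proof (cases "u = compl L b")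
        case True
        have "q \<sqsubseteq> \<bottom>" using le_compl_disjoint[OF qb _ q(1) b(1)] qu unfolding True by blast
        then show ?thesis using q(1) agreement_closed by (rule le_bottomD)
      next
        case False
        then obtain x where x: "u = ?v x" using D(2)[OF c'(2)] by blast
        have sa: "app s a = c" using vapp_eq_app[OF s(1) a(1)] a(2) by simp
        have "F a = x"
          unfolding F_def sa
        proof (rule the_default_eqI)
          show "c \<in> carrier L \<and> ?v x \<in> carrier L \<and> c \<sqsubseteq> ?v x" using cu c(2) x by simp
          show "y = x" if "c \<in> carrier L \<and> ?v y \<in> carrier L \<and> c \<sqsubseteq> ?v y" for y
          proof (rule ccontr)
            assume "y \<noteq> x"
            then have "c \<sqsubseteq> \<bottom>" using that cu x by (intro bval_eq_check_disjoint[OF \<tau>(1), of y x c]) simp_all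
            then show False using nz le_bottom_eq c(2) by blast
          qed
        qed
        then show ?thesis
          using qa qu x by (intro le_agreementI[OF a(1) Ac[OF a(1)] q(1)]) (simp_all add: app_f[OF a(1)])
      qed
    qed
  qed
  then show ?thesis using f by blast
qed

lemma bval_in_V_check: "bval_in_V L (check L x) = \<top>"
  by (intro le_antisym le_bval_in_VI[of _ _ x]) (simp_all add: bval_in_V_closed bval_eq_refl)

lemma generic_iso_classical:
  assumes A: "maximal_antichain L A" and gen: "generic_relative L U A"
  shows "bool_ultrapower_iso_classical L U A (induced_ultrafilter L U A)"
proof -
  let ?W = "induced_ultrafilter L U A"
  have W: "ultrafilter (powerset_algebra A) ?W" by (rule ultrafilter_induced_ultrafilter[OF A])
  have anti: "antichain L A" using A unfolding maximal_antichain_def by blast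
  define P where "P = {\<tau>. bname L \<tau> \<and> bval_in_V L \<tau> \<in> U}"
  define Q where "Q = {f. vfun A f}"
  have agreement_top: "agreement A \<tau> f \<in> U"
    if "\<And>a p. a \<in> elts A \<Longrightarrow> p \<in> carrier L \<Longrightarrow> p \<sqsubseteq> a \<Longrightarrow> p \<sqsubseteq> bval_eq L \<tau> (check L (app f a))" for \<tau> f
  proof (rule ultrafilter_up[OF ultrafilter_top])
    show "\<top> \<sqsubseteq> agreement A \<tau> f"
    proof (rule le_antichain_cases[OF A top_closed agreement_closed])
      fix a q assume *: "a \<in> elts A" "q \<in> carrier L" "q \<sqsubseteq> a"
      show "q \<sqsubseteq> agreement A \<tau> f"
        by (rule le_agreementI[OF *(1) antichain_carrier[OF anti *(1)] *(2,3) that[OF *]])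
    qed
  qed simp
  have "isomorphic_embeddings (name_class L U ` P) (bool_ultrapower_mem L U) (bool_ultrapower_emb L U)
     (fun_class A ?W ` Q) (ultrapower_mem A ?W) (ultrapower_emb A ?W)"
  proof (rule isomorphic_embeddings_by_relation[where R = "\<lambda>\<tau> f. agreement A \<tau> f \<in> U"])
    show "\<exists>f\<in>Q. agreement A \<tau> f \<in> U" if "\<tau> \<in> P" for \<tau>
      using generic_name_agrees[OF A gen] that unfolding P_def Q_def by blast
    show "\<exists>\<tau>\<in>P. agreement A \<tau> f \<in> U" if "f \<in> Q" for f
    proof
      have F: "definable_term (\<lambda>e. app f (e 0))" by (intro definable_fun_intros)
      show "mixture A (app f) \<in> P"
        unfolding P_def using bname_mixture[OF anti F] bval_in_V_mixture[OF A F] ultrafilter_top by simp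
      show "agreement A (mixture A (app f)) f \<in> U"
        by (rule agreement_top) (rule le_bval_eq_mixture[OF anti F])
    qed
    fix \<tau> f \<sigma> g
    assume *: "\<tau> \<in> P" "f \<in> Q" "\<sigma> \<in> P" "g \<in> Q" "agreement A \<tau> f \<in> U" "agreement A \<sigma> g \<in> U"
    then have n: "bname L \<tau>" "bname L \<sigma>" and fg: "vfun A f" "vfun A g" unfolding P_def Q_def by blast+
    show "name_class L U \<tau> = name_class L U \<sigma> \<longleftrightarrow> fun_class A ?W f = fun_class A ?W g"
      unfolding name_class_eq_iff[OF n] fun_class_eq_iff[OF W fg]
    proof (rule agreement_decides[OF A *(5,6) n fg vfun_eq_in_V[OF fg]])
      show "p \<sqsubseteq> bval_eq L (check L x) (check L y)" if "x = y" "p \<in> carrier L" for x y p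
        using that by (simp add: le_bval_eq_refl)
    qed (rule bval_eq_closed, rule le_bval_eq_subst, assumption+, rule bval_eq_check_distinct)
    show "bool_ultrapower_mem L U (name_class L U \<tau>) (name_class L U \<sigma>) \<longleftrightarrow>
        ultrapower_mem A ?W (fun_class A ?W f) (fun_class A ?W g)"
      unfolding bool_ultrapower_mem_iff[OF n] ultrapower_mem_iff[OF W fg]
    proof (rule agreement_decides[OF A *(5,6) n fg vfun_mem_in_V[OF fg]])
      show "p \<sqsubseteq> bval_mem L (check L x) (check L y)" if "x \<in>\<^sub>V y" "p \<in> carrier L" for x y p
        using that by (intro le_bval_mem_checkI[of x]) (simp_all add: elts_def le_bval_eq_refl)
      show "p \<sqsubseteq> \<bottom>" if "\<not> x \<in>\<^sub>V y" "p \<in> carrier L" "p \<sqsubseteq> bval_mem L (check L x) (check L y)" for x y p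
        using that(1) by (intro bval_mem_check_notin[OF _ that(2,3)]) (simp add: elts_def)
    qed (rule bval_mem_closed, rule le_bval_mem_subst)
  next
    fix x :: 'v
    have F: "definable_term (\<lambda>e. (\<lambda>_. x) (e 0))" by (intro definable_fun_intros)
    let ?k = "graph_on A (\<lambda>_. x)"
    have k: "vfun A ?k" by (rule vfun_graph_on[OF F])
    have "agreement A (check L x) ?k \<in> U"
      by (rule agreement_top) (simp add: vapp_eq_app[OF k, symmetric] vapp_graph_on[OF F] le_bval_eq_refl)
    moreover have "check L x \<in> P" unfolding P_def using ultrafilter_top by (simp add: bname_check bval_in_V_check)
    moreover have "?k \<in> Q" unfolding Q_def using k by simp
    ultimately show "\<exists>\<tau>\<in>P. \<exists>f\<in>Q. agreement A \<tau> f \<in> U \<and> bool_ultrapower_emb L U x = name_class L U \<tau> \<and>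
        ultrapower_emb A ?W x = fun_class A ?W f"
      unfolding bool_ultrapower_emb_def ultrapower_emb_def graph_on_def by blast
  qed
  moreover have "name_class L U ` P = bool_ultrapower L U"
    unfolding bool_ultrapower_def P_def by blast
  moreover have "fun_class A ?W ` Q = ultrapower A ?W" unfolding ultrapower_def Q_def by blast
  ultimately show ?thesis unfolding bool_ultrapower_iso_classical_def by simp
qed

section \<open>A power set ultrapower gives relative genericity\<close>

text \<open>\<open>corr \<tau> f\<close> says that the isomorphism takes the class of \<open>\<tau>\<close> to the class of \<open>f\<close>. The choice function \<open>s\<close> on
  \<open>A\<close> maps \<open>a = [\<tau> = z]\<close> to the \<open>c \<in> C\<close> coded by \<open>g z\<close> if this \<open>c\<close> is below \<open>a\<close>, and to an arbitrary element of
  \<open>C\<close> below \<open>a\<close> otherwise. The element of \<open>U\<close> that is shown to lie below the join of the choices is the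
  conjunction of four memberships that hold on the classical side at every index.\<close>

lemma iso_classical_generic:
  assumes W: "ultrafilter (powerset_algebra Z) W" and iso: "bool_ultrapower_iso_classical L U Z W"
  shows "\<exists>A. maximal_antichain L A \<and> generic_relative L U A"
proof -
  obtain \<pi> where bij: "bij_betw \<pi> (bool_ultrapower L U) (ultrapower Z W)"
    and mem: "\<And>X Y. X \<in> bool_ultrapower L U \<Longrightarrow> Y \<in> bool_ultrapower L U \<Longrightarrow>
      bool_ultrapower_mem L U X Y \<longleftrightarrow> ultrapower_mem Z W (\<pi> X) (\<pi> Y)"
    and emb: "\<And>x. \<pi> (bool_ultrapower_emb L U x) = ultrapower_emb Z W x"
    using iso unfolding bool_ultrapower_iso_classical_def isomorphic_embeddings_def by blast
  define corr where "corr \<tau> f \<longleftrightarrow> bname L \<tau> \<and> bval_in_V L \<tau> \<in> U \<and> vfun Z f \<and>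
    \<pi> (name_class L U \<tau>) = fun_class Z W f" for \<tau> f
  have pull: "\<exists>\<tau>. corr \<tau> f" if f: "vfun Z f" for f
  proof -
    have "fun_class Z W f \<in> \<pi> ` bool_ultrapower L U"
      using bij_betw_imp_surj_on[OF bij] f unfolding ultrapower_def by blast
    then show ?thesis using f unfolding corr_def bool_ultrapower_def by fastforce
  qed
  have push: "\<exists>f. corr \<tau> f" if \<tau>: "bname L \<tau>" "bval_in_V L \<tau> \<in> U" for \<tau>
  proof -
    have "\<pi> (name_class L U \<tau>) \<in> ultrapower Z W"
      using bij_betw_imp_surj_on[OF bij] \<tau> unfolding bool_ultrapower_def by blast
    then show ?thesis using \<tau> unfolding corr_def ultrapower_def by blast
  qed
  have corr_mem: "bval_mem L \<tau> \<sigma> \<in> U"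
    if \<tau>: "corr \<tau> f" and \<sigma>: "corr \<sigma> g" and fg: "\<And>z. z \<in> elts Z \<Longrightarrow> vapp f z \<in>\<^sub>V vapp g z" for \<tau> f \<sigma> g
  proof -
    have "{z \<in> elts Z. vapp f z \<in>\<^sub>V vapp g z} = elts Z" using fg by blast
    then have "vset {z \<in> elts Z. vapp f z \<in>\<^sub>V vapp g z} \<in> W"
      using W unfolding ultrafilter_powerset_algebra_iff by simp
    then have "ultrapower_mem Z W (fun_class Z W f) (fun_class Z W g)"
      using ultrapower_mem_iff[OF W] \<tau> \<sigma> unfolding corr_def by blast
    then have "bool_ultrapower_mem L U (name_class L U \<tau>) (name_class L U \<sigma>)"
      using mem[of "name_class L U \<tau>" "name_class L U \<sigma>"] \<tau> \<sigma>
      unfolding corr_def bool_ultrapower_def by auto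
    then show ?thesis using bool_ultrapower_mem_iff \<tau> \<sigma> unfolding corr_def by blast
  qed
  have const: "vfun Z (graph_on Z (\<lambda>_. x))" "z \<in> elts Z \<Longrightarrow> vapp (graph_on Z (\<lambda>_. x)) z = x" for x z
    using vfun_graph_on[of "\<lambda>_. x" Z] vapp_graph_on[of "\<lambda>_. x" z Z] definable_term_const[of x] by blast+
  have corr_check: "corr (check L x) (graph_on Z (\<lambda>_. x))" for x
    using emb[of x] const(1)[of x] bname_check[of x] bval_in_V_check[of x] ultrafilter_top
    unfolding corr_def bool_ultrapower_emb_def ultrapower_emb_def graph_on_def by simp
  define i where "i = graph_on Z (\<lambda>z. z)"
  have i: "vfun Z i" "\<And>z. z \<in> elts Z \<Longrightarrow> vapp i z = z"
    unfolding i_def using vfun_graph_on[of "\<lambda>z. z" Z] vapp_graph_on[of "\<lambda>z. z" _ Z] definable_term_var by blast+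
  obtain \<tau> where \<tau>: "corr \<tau> i" using pull[OF i(1)] by blast
  have \<tau>n: "bname L \<tau>" using \<tau> unfolding corr_def by blast
  let ?v = "\<lambda>x. bval_eq L \<tau> (check L x)"
  obtain A where A: "maximal_antichain L A" "\<And>x. ?v x \<noteq> \<bottom> \<Longrightarrow> ?v x \<in> elts A"
    using decision_antichain[OF \<tau>n] by blast
  have anti: "antichain L A" using A(1) unfolding maximal_antichain_def by blast
  note Ac = antichain_carrier[OF anti]
  have "meets_relative L U A C" if C: "maximal_antichain L C" and ref: "refines L C A" for C
  proof -
    have antiC: "antichain L C" using C unfolding maximal_antichain_def by blast
    note Cc = antichain_carrier[OF antiC]
    have F: "definable_term (\<lambda>e. vpair Z (e 0))" by (intro definable_fun_intros)
    \<comment> \<open>The code of \<open>c\<close> is the pair \<open>(Z, c)\<close>, which is not an element of \<open>Z\<close> by well-foundedness.\<close>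
    define \<sigma> where "\<sigma> = mixture C (vpair Z)"
    have \<sigma>n: "bname L \<sigma>" unfolding \<sigma>_def by (rule bname_mixture[OF antiC F])
    have "bval_in_V L \<sigma> \<in> U" unfolding \<sigma>_def bval_in_V_mixture[OF C F] by (rule ultrafilter_top)
    then obtain g where g: "corr \<sigma> g" using push[OF \<sigma>n] by blast
    have gf: "vfun Z g" using g unfolding corr_def by blast
    have H: "definable_term (\<lambda>e. vset {e 0, app g (e 0)})" by (intro definable_fun_intros)
    define r where "r = graph_on Z (\<lambda>z. vset {z, app g z})"
    have r: "vfun Z r" "\<And>z. z \<in> elts Z \<Longrightarrow> vapp r z = vset {z, app g z}"
      unfolding r_def using vfun_graph_on[OF H] vapp_graph_on[OF H] by blast+
    obtain \<rho> where \<rho>: "corr \<rho> r" using pull[OF r(1)] by blast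
    have \<rho>n: "bname L \<rho>" using \<rho> unfolding corr_def by blast
    have "(\<lambda>z. vset {z, app g z}) ` elts Z \<in> range elts"
      by (rule in_range_elts_image[OF rangeI H])
    then obtain G where G: "elts G = (\<lambda>z. vset {z, app g z}) ` elts Z" by auto
    have m1: "bval_mem L \<rho> (check L G) \<in> U"
    proof (rule corr_mem[OF \<rho> corr_check])
      fix z assume z: "z \<in> elts Z"
      then have "vset {z, app g z} \<in> elts G" unfolding G by blast
      then show "vapp r z \<in>\<^sub>V vapp (graph_on Z (\<lambda>_. G)) z"
        using r(2)[OF z] const(2)[OF z, of G] by (simp add: elts_def)
    qed
    have doubleton: "x \<in>\<^sub>V vset {y, y'} \<longleftrightarrow> x = y \<or> x = y'" for x y y' :: 'v
      using elts_vset_pair[of y y'] unfolding elts_def by blast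
    have m2: "bval_mem L \<tau> \<rho> \<in> U"
      by (rule corr_mem[OF \<tau> \<rho>]) (simp add: i r doubleton)
    have m3: "bval_mem L \<sigma> \<rho> \<in> U"
      by (rule corr_mem[OF g \<rho>]) (simp add: r doubleton vapp_eq_app[OF gf])
    have m4: "bval_mem L \<tau> (check L Z) \<in> U"
      by (rule corr_mem[OF \<tau> corr_check]) (simp add: i const(2) elts_def)
    \<comment> \<open>\<open>R\<close> requires \<open>c\<close> to be below \<open>a\<close>, and to be the prescribed element whenever there is one. The
      references to the carrier put the order into the form in which it is definable.\<close>
    define R where "R a c \<longleftrightarrow> (c \<in> carrier L \<and> a \<in> carrier L \<and> c \<sqsubseteq> a) \<and>
      (\<forall>z\<in>elts Z. \<forall>c'\<in>elts C. a = ?v z \<and> (c' \<in> carrier L \<and> a \<in> carrier L \<and> c' \<sqsubseteq> a) \<and> app g z = vpair Z c' \<longrightarrow> c = c')"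
      for a c
    have "definable (\<lambda>e. R (e 0) (e (Suc 0)))"
      unfolding R_def by (intro definable_alg_intros definable_term_bval_eq definable_term_check)
    moreover have "\<exists>c\<in>elts C. R a c" if a: "a \<in> elts A" for a
    proof (cases "\<exists>z\<in>elts Z. \<exists>c\<in>elts C. a = ?v z \<and> c \<sqsubseteq> a \<and> app g z = vpair Z c")
      case True
      then obtain z c where z: "z \<in> elts Z" "c \<in> elts C" "a = ?v z" "c \<sqsubseteq> a" "app g z = vpair Z c" by blast
      \<comment> \<open>The prescription is unique, since a nonzero \<open>a\<close> determines \<open>z\<close> and the coding is injective.\<close>
      have "c' = c" if "z' \<in> elts Z" "a = ?v z'" "app g z' = vpair Z c'" for z' c'
      proof -
        have "z' = z"
        proof (rule ccontr)
          assume "z' \<noteq> z"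
          then have "a \<sqsubseteq> \<bottom>"
            by (rule bval_eq_check_disjoint[OF \<tau>n _ Ac[OF a]]) (use Ac[OF a] that(2) z(3) in simp_all)
          then show False using le_bottom_eq[OF _ Ac[OF a]] a anti unfolding antichain_def by blast
        qed
        then show ?thesis using that(3) z(5) by simp
      qed
      then show ?thesis using z Cc[OF z(2)] Ac[OF a] unfolding R_def by blast
    next
      case False
      have "\<exists>c\<in>elts C. c \<sqsubseteq> a"
      proof (rule ccontr)
        assume none: "\<not> (\<exists>c\<in>elts C. c \<sqsubseteq> a)"
        have "a \<sqsubseteq> \<bottom>"
        proof (rule le_antichain_cases[OF C Ac[OF a] bottom_closed])
          fix c q assume q: "c \<in> elts C" "q \<in> carrier L" "q \<sqsubseteq> a" "q \<sqsubseteq> c"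
          obtain a' where a': "a' \<in> elts A" "c \<sqsubseteq> a'" using ref q(1) unfolding refines_def by blast
          have ne: "a' \<noteq> a" using none q(1) a'(2) by blast
          have "q \<sqsubseteq> a'" using le_trans[OF q(4) a'(2)] q(2) Cc[OF q(1)] Ac[OF a'(1)] by simp
          then show "q \<sqsubseteq> \<bottom>" by (rule antichain_disjoint[OF anti a'(1) a ne _ q(3,2)])
        qed
        then show False using le_bottom_eq[OF _ Ac[OF a]] a anti unfolding antichain_def by blast
      qed
      then show ?thesis using False Cc Ac[OF a] unfolding R_def by blast
    qed
    ultimately obtain s where s: "vfun A s" "\<And>a. a \<in> elts A \<Longrightarrow> vapp s a \<in> elts C"
      "\<And>a. a \<in> elts A \<Longrightarrow> R a (vapp s a)"
      using vfun_choice[of R A C] by blast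
    have "vapp s ` elts A = app s ` elts A" by (rule image_cong) (simp_all add: vapp_eq_app[OF s(1)])
    also have "\<dots> \<in> range elts" by (rule in_range_elts_image) (simp, intro definable_fun_intros)
    finally have V: "vapp s ` elts A \<in> range elts" .
    let ?S = "\<Squnion> (vapp s ` elts A)"
    have Sc: "?S \<in> carrier L" by (rule Sup_closed[OF V])
    have notin: "vpair Z c \<notin> elts Z" for c
    proof
      assume "vpair Z c \<in> elts Z"
      then have "Z \<in> ndom Z" unfolding ndom_def elts_def by blast
      then show False using wf_not_refl[OF wf_ndom, of Z] by blast
    qed
    \<comment> \<open>If \<open>\<tau> = z\<close> and \<open>\<sigma>\<close> is the code of \<open>c\<close>, then \<open>\<rho>\<close>, being some \<open>{y, g y}\<close>, contains \<open>z\<close> and the code. The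
      code is not in \<open>Z\<close>, so it must be \<open>g y\<close>, and then \<open>z = y\<close>.\<close>
    have key: "p \<sqsubseteq> ?S" if p: "p \<in> carrier L" "p \<sqsubseteq> bval_mem L \<rho> (check L G)" "p \<sqsubseteq> bval_mem L \<tau> \<rho>"
      "p \<sqsubseteq> bval_mem L \<sigma> \<rho>" "p \<sqsubseteq> ?v z" and z: "z \<in> elts Z" for p z
    proof (rule le_antichain_cases[OF C p(1) Sc])
      fix c q assume c: "c \<in> elts C" and q: "q \<in> carrier L" "q \<sqsubseteq> p" "q \<sqsubseteq> c"
      have down: "q \<sqsubseteq> x" if "p \<sqsubseteq> x" "x \<in> carrier L" for x
        using le_trans[OF q(2) that(1)] that(2) q(1) p(1) by simp
      show "q \<sqsubseteq> ?S"
      proof (rule le_bval_mem_checkE[OF down[OF p(2) bval_mem_closed] q(1) Sc])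
        fix h t assume h: "h \<in> elts G" and t: "t \<in> carrier L" "t \<sqsubseteq> q" "t \<sqsubseteq> bval_eq L \<rho> (check L h)"
        obtain y where y: "y \<in> elts Z" "h = vset {y, app g y}" using h unfolding G by blast
        have down': "t \<sqsubseteq> x" if "p \<sqsubseteq> x" "x \<in> carrier L" for x
          using le_trans[OF t(2) down[OF that]] that(2) q(1) t(1) by simp
        have tc: "t \<sqsubseteq> c" using le_trans[OF t(2) q(3)] t(1) q(1) Cc[OF c] by simp
        have tv: "t \<sqsubseteq> ?v z" by (rule down'[OF p(5) bval_eq_closed])
        have "t \<sqsubseteq> bval_eq L \<sigma> (check L (vpair Z c))"
          unfolding \<sigma>_def by (rule le_bval_eq_mixture[OF antiC F c t(1) tc])
        then have 1: "t \<sqsubseteq> bval_mem L (check L (vpair Z c)) (check L h)"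
          by (rule le_bval_mem_subst[OF \<sigma>n bname_check \<rho>n bname_check t(1) _ t(3) down'[OF p(4) bval_mem_closed]])
        have 2: "t \<sqsubseteq> bval_mem L (check L z) (check L h)"
          by (rule le_bval_mem_subst[OF \<tau>n bname_check \<rho>n bname_check t(1) tv t(3) down'[OF p(3) bval_mem_closed]])
        show "t \<sqsubseteq> ?S"
        proof (cases "t = \<bottom>")
          case True
          then show ?thesis using Sc by simp
        next
          case False
          then have nz: "\<not> t \<sqsubseteq> \<bottom>" using le_bottom_eq[OF _ t(1)] by blast
          have "vpair Z c \<in> elts h" "z \<in> elts h"
            using bval_mem_check_notin[OF _ t(1) 1] bval_mem_check_notin[OF _ t(1) 2] nz by blast+
          then have gz: "app g z = vpair Z c" using y z notin[of c] by auto
          have "?v z \<noteq> \<bottom>" using nz tv by auto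
          then have a: "?v z \<in> elts A" by (rule A(2))
          obtain a' where a': "a' \<in> elts A" "c \<sqsubseteq> a'" using ref c unfolding refines_def by blast
          have ta: "t \<sqsubseteq> a'" using le_trans[OF tc a'(2)] t(1) Cc[OF c] Ac[OF a'(1)] by simp
          have "a' = ?v z" using antichain_disjoint[OF anti a'(1) a _ ta tv t(1)] nz by blast
          then have "c \<sqsubseteq> ?v z" using a'(2) by simp
          then have "vapp s (?v z) = c"
            using s(3)[OF a] z c gz Cc[OF c] unfolding R_def by simp
          then have "c \<in> vapp s ` elts A" using a by blast
          then have "c \<sqsubseteq> ?S" by (rule Sup_upper[OF V _ Cc[OF c]])
          then show ?thesis using le_trans[OF tc] t(1) Cc[OF c] Sc by simp
        qed
      qed
    qed
    have "?S \<in> U"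
    proof (rule ultrafilter_consequence3[OF m1 m2 ultrafilter_meet[OF m3 m4] Sc])
      fix p assume p: "p \<in> carrier L" "p \<sqsubseteq> bval_mem L \<rho> (check L G)" "p \<sqsubseteq> bval_mem L \<tau> \<rho>"
        "p \<sqsubseteq> bval_mem L \<sigma> \<rho> \<sqinter> bval_mem L \<tau> (check L Z)"
      then have p': "p \<sqsubseteq> bval_mem L \<sigma> \<rho>" "p \<sqsubseteq> bval_mem L \<tau> (check L Z)"
        by (simp_all add: le_meet_iff)
      show "p \<sqsubseteq> ?S"
      proof (rule le_bval_mem_checkE[OF p'(2) p(1) Sc])
        fix z q assume z: "z \<in> elts Z" and q: "q \<in> carrier L" "q \<sqsubseteq> p" "q \<sqsubseteq> ?v z"
        have down: "q \<sqsubseteq> x" if "p \<sqsubseteq> x" "x \<in> carrier L" for x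
          using le_trans[OF q(2) that(1)] that(2) q(1) p(1) by simp
        show "q \<sqsubseteq> ?S"
          by (rule key[OF q(1) down[OF p(2)] down[OF p(3)] down[OF p'(1)] q(3) z]) simp_all
      qed
    qed
    then show ?thesis
      using s(1,2,3) unfolding meets_relative_def R_def elts_def by blast
  qed
  then show ?thesis using A(1) unfolding generic_relative_def by blast
qed

end

end

theorem theorem74:
  fixes B :: "'v::zfc_universe gorder" and U :: "'v set"
  assumes "complete_boolean_algebra_in_V B"
    and "ultrafilter B U"
  shows "((\<exists>Z W. ultrafilter (powerset_algebra Z) W \<and> bool_ultrapower_iso_classical B U Z W) \<longleftrightarrow>
          (\<exists>A. maximal_antichain B A \<and> generic_relative B U A)) \<and>
         (\<forall>A. maximal_antichain B A \<and> generic_relative B U A \<longrightarrow>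
            ultrafilter (powerset_algebra A) (induced_ultrafilter B U A) \<and>
            bool_ultrapower_iso_classical B U A (induced_ultrafilter B U A))"
proof -
  interpret complete_boolean_algebra_in_V B by (rule assms(1))
  show ?thesis
    using iso_classical_generic[OF assms(2)] ultrafilter_induced_ultrafilter[OF assms(2)]
      generic_iso_classical[OF assms(2)] by blast
qed

end
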